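(* Assume that (A1) $\bar A_k$ is invertible for every $k\in[\![0,N-1]\!]$, and (A2) there exists $k_{\mathrm r}\in[\![1,N]\!]$ such that $\mathcal R(k,0)$ is invertible for every $k\in[\![k_{\mathrm r},N]\!]$ and $\mathcal R(N,k)$ is invertible for every $k\in[\![0,k_{\mathrm r}]\!]$. Then the unique optimal policy of the MaxEnt density control problem (with $R_k\equiv I$, $\varepsilon=1$) described in the context is given by $$\pi_k^*(u|x_k)=\mathcal N\bigl(u\,\big|\,-(I+B_k^\top\Pi_{k+1,+}B_k)^{-1}(B_k^\top\Pi_{k+1,+}A_k+S_k^\top)x_k,\ (I+B_k^\top\Pi_{k+1,+}B_k)^{-1}\bigr)$$ for every $k\in[\![0,N-1]\!]$, $u\in\mathbb R^m$, $x_k\in\mathbb R^n$, where $\{\Pi_{k,+}\}_{k=0}^N$ is the solution to the Riccati equation $$\Pi_k=\bar A_k^\top\Pi_{k+1}\bar A_k-\bar A_k^\top\Pi_{k+1}B_k(I+B_k^\top\Pi_{k+1}B_k)^{-1}B_k^\top\Pi_{k+1}\bar A_k+\bar Q_k,\quad k\in[\![0,N-1]\!],$$ with the terminal value $$\Pi_N=-\varphi_{12}^{-1}\varphi_{11}+\bar\Sigma_N^{-1/2}\Bigl(\tfrac14I+\bar\Sigma_N^{1/2}\varphi_{12}^{-1}\bar\Sigma_0\varphi_{12}^{-\top}\bar\Sigma_N^{1/2}\Bigr)^{1/2}\bar\Sigma_N^{-1/2}+\tfrac12\bar\Sigma_N^{-1}.$$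
   Context: Notation: $n,m,N$ are positive integers; $[\![k,l]\!]=\{k,k+1,\dots,l\}$; $\mathcal S^n$ is the set of real symmetric $n\times n$ matrices; $\succ,\succeq$ denote the positive (semi)definite order; $X^{1/2}$ is the positive semidefinite square root of $X\succeq0$; $X^{-\top}$ is the transpose of the inverse; $\mathcal N(\cdot|\mu,\Sigma)$ is the Gaussian density with mean $\mu$ and covariance $\Sigma\succ0$. Data: for $k\in[\![0,N-1]\!]$, $A_k\in\mathbb R^{n\times n}$, $B_k\in\mathbb R^{n\times m}$, $S_k\in\mathbb R^{n\times m}$, $Q_k\in\mathcal S^n$; $\bar A_k:=A_k-B_kS_k^\top$, $\bar Q_k:=Q_k-S_kS_k^\top$, with $\bar Q_k\succeq0$; $G_k:=B_kB_k^\top$; $\bar\Sigma_0,\bar\Sigma_N\in\mathcal S^n$ are positive definite. MaxEnt density control problem ($R_k\equiv I$, $\varepsilon=1$): find a policy $\pi=\{\pi_k\}_{k=0}^{N-1}$ minimizing $$\mathbb E\Bigl[\sum_{k=0}^{N-1}\Bigl(\tfrac12\begin{bmatrix}x_k\\ u_k\end{bmatrix}^\top\begin{bmatrix}Q_k&S_k\\ S_k^\top&I\end{bmatrix}\begin{bmatrix}x_k\\ u_k\end{bmatrix}-\mathcal H(\pi_k(\cdot|h_k))\Bigr)\Bigr]$$ subject to $x_{k+1}=A_kx_k+B_ku_k$, $u_k\sim\pi_k(\cdot|h_k)$ given the history $h_k=\{x_0,u_0,\dots,x_{k-1},u_{k-1},x_k\}$ ($k=0,\dots,N-1$), and $x_0\sim\mathcal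 N(0,\bar\Sigma_0)$, $x_N\sim\mathcal N(0,\bar\Sigma_N)$. Here $\pi_k(\cdot|h_k)$ is the conditional density of $u_k$ given $h_k$ (as such determined only up to null sets), and $\mathcal H(\pi_k(\cdot|h_k))=-\int_{\mathbb R^m}\pi_k(u|h_k)\log\pi_k(u|h_k)\,du$. Writing $\pi_k(\cdot|x_k)$ means that $\pi_k(\cdot|h_k)$ depends on $h_k$ only through the current state $x_k$. Transition matrices: for invertible $\bar A_k$, $$M_k:=\begin{bmatrix}\bar A_k+G_k\bar A_k^{-\top}\bar Q_k&-G_k\bar A_k^{-\top}\\ -\bar A_k^{-\top}\bar Q_k&\bar A_k^{-\top}\end{bmatrix},\quad M_k^{-1}=\begin{bmatrix}\bar A_k^{-1}&\bar A_k^{-1}G_k\\ \bar Q_k\bar A_k^{-1}&\bar Q_k\bar A_k^{-1}G_k+\bar A_k^\top\end{bmatrix},$$ $\Phi_M(k,l):=M_{k-1}M_{k-2}\cdots M_l$ if $k>l$, $I$ if $k=l$, $M_k^{-1}M_{k+1}^{-1}\cdots M_{l-1}^{-1}$ if $k<l$. $\Phi_{ij}(k,l)$ ($i,j\in\{1,2\}$) are its $n\times n$ blocks, and $\varphi_{ij}:=\Phi_{ij}(0,N)$. $\Phi_{\bar A}(k,l)$ is defined in the same way from $\{\bar A_k\}$. Reachability Gramian: $\mathcal R(k_1,k_0):=\sum_{k=k_0}^{k_1-1}\Phi_{\bar A}(k_1,k+1)G_k\Phi_{\bar A}(k_1,k+1)^\top$ (empty sum $=0$ if $k_1=k_0$).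 Under (A1) and (A2), $\varphi_{12}$ is invertible and the Riccati recursion with the terminal value in the claim has a solution on $[\![0,N]\!]$. *)

theory Defs
  imports "HOL-Probability.Probability"
begin

section \<open>Matrices\<close>

definition symmetric_matrix :: "real^'n^'n \<Rightarrow> bool" where
  "symmetric_matrix X \<longleftrightarrow> transpose X = X"

definition pos_semidef :: "real^'n^'n \<Rightarrow> bool" where
  "pos_semidef X \<longleftrightarrow> symmetric_matrix X \<and> (\<forall>v. 0 \<le> v \<bullet> (X *v v))"

definition pos_def :: "real^'n^'n \<Rightarrow> bool" where
  "pos_def X \<longleftrightarrow> symmetric_matrix X \<and> (\<forall>v. v \<noteq> 0 \<longrightarrow> 0 < v \<bullet> (X *v v))"

text \<open>Meaningful for positive semidefinite \<open>X\<close>, where the square root exists and is unique.\<close>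

definition msqrt :: "real^'n^'n \<Rightarrow> real^'n^'n" where
  "msqrt X = (THE Y. pos_semidef Y \<and> Y ** Y = X)"

text \<open>Block vectors and matrices are indexed by sum types: \<open>Inl\<close> is the first block, \<open>Inr\<close> the
  second one.\<close>

definition block_vec :: "'a^'c::finite \<Rightarrow> 'a^'d::finite \<Rightarrow> 'a^('c + 'd)" where
  "block_vec x y = (\<chi> i. case i of Inl j \<Rightarrow> x $ j | Inr j \<Rightarrow> y $ j)"

definition block_matrix ::
  "'a^'c::finite^'r::finite \<Rightarrow> 'a^'d::finite^'r \<Rightarrow> 'a^'c^'s::finite \<Rightarrow> 'a^'d^'s \<Rightarrow> 'a^('c + 'd)^('r + 's)" where
  "block_matrix X11 X12 X21 X22 =
     (\<chi> i. case i of Inl r \<Rightarrow> block_vec (X11 $ r) (X12 $ r)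
                   | Inr s \<Rightarrow> block_vec (X21 $ s) (X22 $ s))"

definition block11 :: "'a^('c::finite + 'd::finite)^('r::finite + 's::finite) \<Rightarrow> 'a^'c^'r" where
  "block11 X = (\<chi> i j. X $ Inl i $ Inl j)"

definition block12 :: "'a^('c::finite + 'd::finite)^('r::finite + 's::finite) \<Rightarrow> 'a^'d^'r" where
  "block12 X = (\<chi> i j. X $ Inl i $ Inr j)"

text \<open>The state transition matrix of \<open>z\<^sub>k\<^sub>+\<^sub>1 = F\<^sub>k z\<^sub>k\<close>, equal to
  \<open>F\<^sub>k\<^sub>-\<^sub>1 \<dots> F\<^sub>l\<close> if \<open>k > l\<close> and to \<open>F\<^sub>k\<^sup>-\<^sup>1 \<dots> F\<^sub>l\<^sub>-\<^sub>1\<^sup>-\<^sup>1\<close> if \<open>k < l\<close>.\<close>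

function transition :: "(nat \<Rightarrow> real^'a^'a) \<Rightarrow> nat \<Rightarrow> nat \<Rightarrow> real^'a^'a" where
  "transition F k l =
     (if k = l then mat 1
      else if k > l then F (k - 1) ** transition F (k - 1) l
      else matrix_inv (F k) ** transition F (k + 1) l)"
  by pat_completeness auto
termination
  by (relation "Wellfounded.measure (\<lambda>(F, k, l). (k - l) + (l - k))") auto

declare transition.simps [simp del]


section \<open>System data\<close>

text \<open>The matrices \<open>B k\<close> and \<open>S k\<close> have type \<open>real^'m^'n\<close>, i.e. \<open>n\<close> rows and \<open>m\<close> columns.\<close>

definition Abar ::
  "(nat \<Rightarrow> real^'n^'n) \<Rightarrow> (nat \<Rightarrow> real^'m^'n) \<Rightarrow> (nat \<Rightarrow> real^'m^'n) \<Rightarrow> nat \<Rightarrow> real^'n^'n" where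
  "Abar A B S k = A k - B k ** transpose (S k)"

definition Qbar :: "(nat \<Rightarrow> real^'n^'n) \<Rightarrow> (nat \<Rightarrow> real^'m^'n) \<Rightarrow> nat \<Rightarrow> real^'n^'n" where
  "Qbar Q S k = Q k - S k ** transpose (S k)"

definition Gmat :: "(nat \<Rightarrow> real^'m^'n) \<Rightarrow> nat \<Rightarrow> real^'n^'n" where
  "Gmat B k = B k ** transpose (B k)"

definition Mmat ::
  "(nat \<Rightarrow> real^'n^'n) \<Rightarrow> (nat \<Rightarrow> real^'m^'n) \<Rightarrow> (nat \<Rightarrow> real^'n^'n) \<Rightarrow> (nat \<Rightarrow> real^'m^'n)
    \<Rightarrow> nat \<Rightarrow> real^('n + 'n)^('n + 'n)" where
  "Mmat A B Q S k =
     (let Ab = Abar A B S k; Qb = Qbar Q S k; G = Gmat B k; AbiT = transpose (matrix_inv Ab)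
      in block_matrix (Ab + G ** AbiT ** Qb) (- (G ** AbiT))
                      (- (AbiT ** Qb))       AbiT)"

definition reach_gramian ::
  "(nat \<Rightarrow> real^'n^'n) \<Rightarrow> (nat \<Rightarrow> real^'m^'n) \<Rightarrow> (nat \<Rightarrow> real^'m^'n) \<Rightarrow> nat \<Rightarrow> nat \<Rightarrow> real^'n^'n" where
  "reach_gramian A B S k1 k0 =
     (\<Sum>k = k0..<k1. transition (Abar A B S) k1 (k + 1) ** Gmat B k
                     ** transpose (transition (Abar A B S) k1 (k + 1)))"

definition riccati_step ::
  "(nat \<Rightarrow> real^'n^'n) \<Rightarrow> (nat \<Rightarrow> real^'m^'n) \<Rightarrow> (nat \<Rightarrow> real^'n^'n) \<Rightarrow> (nat \<Rightarrow> real^'m^'n)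
    \<Rightarrow> nat \<Rightarrow> real^'n^'n \<Rightarrow> real^'n^'n" where
  "riccati_step A B Q S k P =
     (let Ab = Abar A B S k
      in transpose Ab ** P ** Ab
         - transpose Ab ** P ** B k ** matrix_inv (mat 1 + transpose (B k) ** P ** B k)
             ** transpose (B k) ** P ** Ab
         + Qbar Q S k)"

definition riccati_terminal ::
  "(nat \<Rightarrow> real^'n^'n) \<Rightarrow> (nat \<Rightarrow> real^'m^'n) \<Rightarrow> (nat \<Rightarrow> real^'n^'n) \<Rightarrow> (nat \<Rightarrow> real^'m^'n)
    \<Rightarrow> nat \<Rightarrow> real^'n^'n \<Rightarrow> real^'n^'n \<Rightarrow> real^'n^'n" where
  "riccati_terminal A B Q S N \<Sigma>0 \<Sigma>N =
     (let \<phi> = transition (Mmat A B Q S) 0 N; \<phi>11 = block11 \<phi>; \<phi>12 = block12 \<phi>;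
          H = msqrt \<Sigma>N; Hi = matrix_inv H
      in - (matrix_inv \<phi>12 ** \<phi>11)
         + Hi ** msqrt ((1/4) *\<^sub>R mat 1
                        + H ** matrix_inv \<phi>12 ** \<Sigma>0 ** transpose (matrix_inv \<phi>12) ** H) ** Hi
         + (1/2) *\<^sub>R matrix_inv \<Sigma>N)"


section \<open>Gaussian densities and differential entropy\<close>

definition gaussian_density :: "real^'d \<Rightarrow> real^'d^'d \<Rightarrow> real^'d \<Rightarrow> real" where
  "gaussian_density \<mu> \<Sigma> v =
     exp (- (1/2) * ((v - \<mu>) \<bullet> (matrix_inv \<Sigma> *v (v - \<mu>)))) / sqrt ((2 * pi) ^ CARD('d) * det \<Sigma>)"

definition gaussian_measure :: "real^'d \<Rightarrow> real^'d^'d \<Rightarrow> (real^'d) measure" where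
  "gaussian_measure \<mu> \<Sigma> = density lborel (\<lambda>v. ennreal (gaussian_density \<mu> \<Sigma> v))"

definition diff_entropy :: "(real^'m \<Rightarrow> real) \<Rightarrow> real" where
  "diff_entropy p = - (\<integral>v. p v * ln (p v) \<partial>lborel)"


section \<open>The maximum entropy density control problem\<close>

text \<open>A history \<open>h\<^sub>k = {x\<^sub>0, u\<^sub>0, \<dots>, x\<^sub>k\<^sub>-\<^sub>1, u\<^sub>k\<^sub>-\<^sub>1, x\<^sub>k}\<close> is a pair \<open>(x, u)\<close> of a family \<open>x\<close> of states
  indexed by \<open>{..k}\<close> and a family \<open>u\<close> of controls indexed by \<open>{..<k}\<close>.\<close>

type_synonym ('n, 'm) hist = "(nat \<Rightarrow> real^'n) \<times> (nat \<Rightarrow> real^'m)"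

text \<open>\<open>\<pi> k h v\<close> is the conditional density of the control at time \<open>k\<close> at the point \<open>v\<close>, given the
  history \<open>h\<close>.\<close>

type_synonym ('n, 'm) policy = "nat \<Rightarrow> ('n, 'm) hist \<Rightarrow> real^'m \<Rightarrow> real"

definition hist_space :: "nat \<Rightarrow> ('n::finite, 'm::finite) hist measure" where
  "hist_space k = PiM {..k} (\<lambda>_. borel) \<Otimes>\<^sub>M PiM {..<k} (\<lambda>_. borel)"

definition past :: "nat \<Rightarrow> ('n, 'm) hist \<Rightarrow> ('n, 'm) hist" where
  "past k h = (restrict (fst h) {..k}, restrict (snd h) {..<k})"

definition is_policy :: "nat \<Rightarrow> ('n::finite, 'm::finite) policy \<Rightarrow> bool" where
  "is_policy N \<pi> \<longleftrightarrow>
     (\<forall>k<N. (\<lambda>(h, v). \<pi> k h v) \<in> borel_measurable (hist_space k \<Otimes>\<^sub>M borel) \<and>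
            (\<forall>h \<in> space (hist_space k).
               (\<forall>v. 0 \<le> \<pi> k h v) \<and> (\<integral>\<^sup>+v. ennreal (\<pi> k h v) \<partial>lborel) = 1))"

text \<open>The law of the history \<open>h\<^sub>k\<close> when \<open>x\<^sub>0 \<sim> N(0, \<Sigma>0)\<close>, \<open>u\<^sub>j \<sim> \<pi> j h\<^sub>j\<close> given \<open>h\<^sub>j\<close> and
  \<open>x\<^sub>j\<^sub>+\<^sub>1 = A\<^sub>j x\<^sub>j + B\<^sub>j u\<^sub>j\<close> for all \<open>j < k\<close>.\<close>

primrec hist_law ::
  "(nat \<Rightarrow> real^'n^'n) \<Rightarrow> (nat \<Rightarrow> real^'m^'n) \<Rightarrow> real^'n^'n \<Rightarrow> ('n::finite, 'm::finite) policy
    \<Rightarrow> nat \<Rightarrow> ('n, 'm) hist measure" where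
  "hist_law A B \<Sigma>0 \<pi> 0 =
     distr (gaussian_measure 0 \<Sigma>0) (hist_space 0) (\<lambda>x0. (\<lambda>i\<in>{..0}. x0, \<lambda>i. undefined))"
| "hist_law A B \<Sigma>0 \<pi> (Suc k) =
     hist_law A B \<Sigma>0 \<pi> k \<bind> (\<lambda>h.
       distr (density lborel (\<lambda>v. ennreal (\<pi> k h v))) (hist_space (Suc k))
         (\<lambda>v. ((fst h)(Suc k := A k *v fst h k + B k *v v), (snd h)(k := v))))"

definition feasible ::
  "(nat \<Rightarrow> real^'n^'n) \<Rightarrow> (nat \<Rightarrow> real^'m^'n) \<Rightarrow> nat \<Rightarrow> real^'n^'n \<Rightarrow> real^'n^'n
    \<Rightarrow> ('n::finite, 'm::finite) policy \<Rightarrow> bool" where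
  "feasible A B N \<Sigma>0 \<Sigma>N \<pi> \<longleftrightarrow>
     is_policy N \<pi> \<and>
     distr (hist_law A B \<Sigma>0 \<pi> N) borel (\<lambda>h. fst h N) = gaussian_measure 0 \<Sigma>N"

definition stage_cost ::
  "(nat \<Rightarrow> real^'n^'n) \<Rightarrow> (nat \<Rightarrow> real^'m^'n) \<Rightarrow> nat \<Rightarrow> real^'n \<Rightarrow> real^'m \<Rightarrow> real" where
  "stage_cost Q S k x v =
     (1/2) * (block_vec x v \<bullet>
              (block_matrix (Q k) (S k) (transpose (S k)) (mat 1) *v block_vec x v))"

definition finite_cost ::
  "(nat \<Rightarrow> real^'n^'n) \<Rightarrow> (nat \<Rightarrow> real^'m^'n) \<Rightarrow> (nat \<Rightarrow> real^'n^'n) \<Rightarrow> (nat \<Rightarrow> real^'m^'n)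
    \<Rightarrow> nat \<Rightarrow> real^'n^'n \<Rightarrow> ('n::finite, 'm::finite) policy \<Rightarrow> bool" where
  "finite_cost A B Q S N \<Sigma>0 \<pi> \<longleftrightarrow>
     (\<forall>k<N.
        integrable (hist_law A B \<Sigma>0 \<pi> N) (\<lambda>h. stage_cost Q S k (fst h k) (snd h k)) \<and>
        (AE h in hist_law A B \<Sigma>0 \<pi> N.
           integrable lborel (\<lambda>v. \<pi> k (past k h) v * ln (\<pi> k (past k h) v))) \<and>
        integrable (hist_law A B \<Sigma>0 \<pi> N) (\<lambda>h. diff_entropy (\<pi> k (past k h))))"

text \<open>The objective has values in the extended reals. If the matrices \<open>Qbar Q S k\<close> are positive
  semidefinite, the stage costs are nonnegative, and if their expectations are finite, the entropies
  are bounded above by those of Gaussian densities; the objective is then either finite, with all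
  integrals below converging, or \<open>+\<infinity>\<close>. If some expected stage cost is infinite, the objective is
  \<open>+\<infinity>\<close> or of the indeterminate form \<open>\<infinity> - \<infinity>\<close>; the latter is also read as \<open>+\<infinity>\<close>.\<close>

definition maxent_cost ::
  "(nat \<Rightarrow> real^'n^'n) \<Rightarrow> (nat \<Rightarrow> real^'m^'n) \<Rightarrow> (nat \<Rightarrow> real^'n^'n) \<Rightarrow> (nat \<Rightarrow> real^'m^'n)
    \<Rightarrow> nat \<Rightarrow> real^'n^'n \<Rightarrow> ('n::finite, 'm::finite) policy \<Rightarrow> ereal" where
  "maxent_cost A B Q S N \<Sigma>0 \<pi> =
     (if finite_cost A B Q S N \<Sigma>0 \<pi>
      then ereal (\<integral>h. (\<Sum>k<N. stage_cost Q S k (fst h k) (snd h k) - diff_entropy (\<pi> k (past k h)))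
                    \<partial>(hist_law A B \<Sigma>0 \<pi> N))
      else \<infinity>)"

definition optimal ::
  "(nat \<Rightarrow> real^'n^'n) \<Rightarrow> (nat \<Rightarrow> real^'m^'n) \<Rightarrow> (nat \<Rightarrow> real^'n^'n) \<Rightarrow> (nat \<Rightarrow> real^'m^'n)
    \<Rightarrow> nat \<Rightarrow> real^'n^'n \<Rightarrow> real^'n^'n \<Rightarrow> ('n::finite, 'm::finite) policy \<Rightarrow> bool" where
  "optimal A B Q S N \<Sigma>0 \<Sigma>N \<pi> \<longleftrightarrow>
     feasible A B N \<Sigma>0 \<Sigma>N \<pi> \<and>
     (\<forall>\<pi>'. feasible A B N \<Sigma>0 \<Sigma>N \<pi>' \<longrightarrow>
            maxent_cost A B Q S N \<Sigma>0 \<pi> \<le> maxent_cost A B Q S N \<Sigma>0 \<pi>')"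

text \<open>A policy is a family of conditional densities, hence determined only up to null sets of
  histories and of controls.\<close>

definition unique_optimal ::
  "(nat \<Rightarrow> real^'n^'n) \<Rightarrow> (nat \<Rightarrow> real^'m^'n) \<Rightarrow> (nat \<Rightarrow> real^'n^'n) \<Rightarrow> (nat \<Rightarrow> real^'m^'n)
    \<Rightarrow> nat \<Rightarrow> real^'n^'n \<Rightarrow> real^'n^'n \<Rightarrow> ('n::finite, 'm::finite) policy \<Rightarrow> bool" where
  "unique_optimal A B Q S N \<Sigma>0 \<Sigma>N \<pi> \<longleftrightarrow>
     optimal A B Q S N \<Sigma>0 \<Sigma>N \<pi> \<and>
     (\<forall>\<pi>'. optimal A B Q S N \<Sigma>0 \<Sigma>N \<pi>' \<longrightarrow>
        (\<forall>k<N. AE h in hist_law A B \<Sigma>0 \<pi>' k. AE v in lborel. \<pi>' k h v = \<pi> k h v))"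

end

theory Submission
  imports Defs
begin

text \<open>
  In the control \<open>u + S\<^sup>\<top> x\<close> the stage cost is half of \<open>x \<bullet> (Qbar x)\<close> plus half of the squared control,
  and the dynamics have matrix \<open>Abar\<close>. Write \<open>R\<^sub>k = I + B\<^sub>k\<^sup>\<top> P\<^sub>k\<^sub>+\<^sub>1 B\<^sub>k\<close>. If \<open>P\<close> solves the
  Riccati recursion and \<open>R\<^sub>k\<close> is positive definite, completing the square turns the stage cost into the
  difference of the energies \<open>(1/2) x\<^sub>k \<bullet> P\<^sub>k x\<^sub>k\<close> at the times \<open>k\<close> and \<open>k + 1\<close>, plus a square
  which is, up to a constant, minus the logarithm of the Gaussian density \<open>opt_policy k\<close>. Subtracting the
  entropy, the expected cost of a stage is an energy difference plus a constant plus the relative entropy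
  of \<open>\<pi>\<^sub>k\<close> with respect to \<open>opt_policy k\<close> (\<open>stage_cost_relative_entropy\<close>). The energies telescope,
  and those at the times \<open>0\<close> and \<open>N\<close> are fixed by the prescribed laws. Hence the cost of a feasible policy
  is a constant plus a sum of relative entropies (\<open>feasible_cost\<close>), which is minimal exactly when the
  policy agrees with \<open>opt_policy\<close> almost everywhere. Two facts about \<open>P\<close> remain; both come from the
  Hamiltonian system \<open>z\<^sub>k\<^sub>+\<^sub>1 = M\<^sub>k z\<^sub>k\<close>, \<open>z = (x, y)\<close>.

  First, \<open>R\<^sub>k\<close> is positive definite (\<open>R_pos_def\<close>). Reachability makes \<open>\<phi>12\<close> invertible, and
  \<open>\<phi>12\<^sup>-\<^sup>1 \<phi>11\<close> is then the quadratic form of the least cost of steering \<open>0\<close> to a given final state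
  (\<open>min_energy_le\<close>). The terminal value is \<open>P\<^sub>N = W - \<phi>12\<^sup>-\<^sup>1 \<phi>11\<close> with \<open>W\<close> positive definite,
  so that the stage costs plus \<open>x\<^sub>N \<bullet> P\<^sub>N x\<^sub>N\<close> are positive along every nonzero trajectory that starts
  at \<open>0\<close>. The values of the form \<open>R\<^sub>k\<close> are such total costs.

  Second, the candidate policy reaches the prescribed final covariance (\<open>closed_loop_cov_final\<close>). The
  closed loop has Gaussian states with covariances \<open>C\<^sub>k\<close>. Along a Hamiltonian trajectory, the
  defects \<open>s\<^sub>k = P\<^sub>k x\<^sub>k - y\<^sub>k\<close> are transported backwards by the adjoint of the closed loop, and the
  relation \<open>C\<^sub>k s\<^sub>k = x\<^sub>k\<close> propagates forwards. For the trajectories with \<open>s\<^sub>N = \<Sigma>N\<^sup>-\<^sup>1 x\<^sub>N\<close> it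
  ends as \<open>C\<^sub>N \<Sigma>N\<^sup>-\<^sup>1 x\<^sub>N = x\<^sub>N\<close>, that is \<open>C\<^sub>N = \<Sigma>N\<close>. It holds at time \<open>0\<close> because
  \<open>\<Sigma>0 = \<phi>12 (W - \<Sigma>N\<^sup>-\<^sup>1) \<Sigma>N W \<phi>12\<^sup>\<top>\<close> (\<open>terminal_factorization\<close>), which is the quadratic equation
  that the square root in the terminal value solves.

  The analytic part provides square roots of matrices from an orthonormal eigenbasis, linear changes of
  variables in integrals, the propagation of Gaussian laws through affine kernels with Gaussian noise
  (\<open>gaussian_affine_kernel\<close>), and the description of the law of a history as the image of a
  density on a product space (\<open>bind_density_kernel\<close>), on which Fubini's theorem applies.
\<close>

section \<open>Symmetric matrices\<close>

(* Transposes are kept, so that adjoints can be moved across inner products. *)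
declare transpose_matrix_vector [simp del] vector_transpose_matrix [simp del]

lemma inner_matrix_transpose: "x \<bullet> (X *v y) = (transpose X *v x) \<bullet> (y :: real^_)"
  by (simp add: transpose_matrix_vector dot_lmul_matrix)

lemma symmetric_matrix_iff_self_adjoint:
  "symmetric_matrix X \<longleftrightarrow> (\<forall>x y. x \<bullet> (X *v y) = (X *v x) \<bullet> y)"
proof
  assume "\<forall>x y. x \<bullet> (X *v y) = (X *v x) \<bullet> y"
  then have "\<forall>x y. (transpose X *v x) \<bullet> y = (X *v x) \<bullet> y"
    by (simp add: inner_matrix_transpose)
  then have "\<forall>x. transpose X *v x = X *v x"
    by (metis vector_eq_rdot)
  then show "symmetric_matrix X"
    by (simp add: symmetric_matrix_def matrix_eq)
qed (simp add: symmetric_matrix_def inner_matrix_transpose)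

lemma self_adjointD: "symmetric_matrix X \<Longrightarrow> (X *v x) \<bullet> y = x \<bullet> (X *v y)"
  by (simp add: symmetric_matrix_iff_self_adjoint)

lemma invertible_iff_ker:
  fixes X :: "real^'n^'n"
  shows "invertible X \<longleftrightarrow> (\<forall>x. X *v x = 0 \<longrightarrow> x = 0)"
  by (simp add: invertible_left_inverse matrix_left_invertible_ker)

lemma matrix_inv_mul:
  assumes "invertible (X :: real^'n^'n)"
  shows "X ** matrix_inv X = mat 1" "matrix_inv X ** X = mat 1"
  using someI_ex[OF assms[unfolded invertible_def]] by (auto simp: matrix_inv_def)

lemma matrix_inv_vector_mul:
  assumes "invertible (X :: real^'n^'n)"
  shows "X *v (matrix_inv X *v x) = x" "matrix_inv X *v (X *v x) = x"
  using matrix_inv_mul[OF assms] by (simp_all add: matrix_vector_mul_assoc)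

lemma matrix_inv_eqI:
  assumes "(X :: real^'n^'n) ** Y = mat 1"
  shows "matrix_inv X = Y"
proof -
  have X: "invertible X"
    using assms invertible_right_inverse by blast
  have "matrix_inv X ** (X ** Y) = Y"
    by (simp add: matrix_mul_assoc matrix_inv_mul(2)[OF X])
  with assms show ?thesis by simp
qed

lemma symmetric_matrix_inv:
  assumes "invertible X" "symmetric_matrix X"
  shows "symmetric_matrix (matrix_inv X)"
  unfolding symmetric_matrix_iff_self_adjoint
  by (metis assms matrix_inv_vector_mul(1) self_adjointD)

lemma pos_def_invertible: "pos_def X \<Longrightarrow> invertible X"
  unfolding invertible_iff_ker pos_def_def by (metis inner_zero_right less_irrefl)

lemma pos_def_matrix_inv:
  assumes "pos_def X"
  shows "pos_def (matrix_inv X)"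
proof -
  note X = pos_def_invertible[OF assms]
  have "0 < v \<bullet> (matrix_inv X *v v)" if "v \<noteq> 0" for v
  proof -
    define w where "w = matrix_inv X *v v"
    have v: "v = X *v w" by (simp add: w_def matrix_inv_vector_mul[OF X])
    with that have "w \<noteq> 0" by auto
    then have "0 < w \<bullet> (X *v w)"
      using assms by (simp add: pos_def_def)
    also have "w \<bullet> (X *v w) = v \<bullet> (matrix_inv X *v v)"
      by (simp add: w_def[symmetric] v[symmetric] inner_commute)
    finally show ?thesis .
  qed
  then show ?thesis
    using assms X by (simp add: pos_def_def symmetric_matrix_inv)
qed

lemma pos_def_imp_pos_semidef: "pos_def X \<Longrightarrow> pos_semidef X"
  unfolding pos_def_def pos_semidef_def by (metis inner_zero_left less_eq_real_def)

text \<open>The first order condition at a maximum of a quadratic function. The proof inserts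
  \<open>t = a / (\<bar>b\<bar> + 1)\<close>.\<close>

lemma linear_term_vanishes:
  fixes a b :: real
  assumes "\<And>t. 2 * t * a \<le> t\<^sup>2 * b"
  shows "a = 0"
proof -
  have "2 * t * a \<le> t\<^sup>2 * \<bar>b\<bar>" for t
    using assms[of t] mult_left_mono[of b "\<bar>b\<bar>" "t\<^sup>2"] by force
  from this[of "a / (\<bar>b\<bar> + 1)"]
  have "2 * (a\<^sup>2 / (\<bar>b\<bar> + 1)) \<le> (a\<^sup>2 / (\<bar>b\<bar> + 1)) * (\<bar>b\<bar> / (\<bar>b\<bar> + 1))"
    by (simp add: power2_eq_square)
  also have "\<dots> \<le> (a\<^sup>2 / (\<bar>b\<bar> + 1)) * 1"
    by (intro mult_left_mono) auto
  finally have "a\<^sup>2 / (\<bar>b\<bar> + 1) \<le> 0" by simp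
  then show ?thesis
    by (smt (verit) divide_le_0_iff power2_less_0 zero_eq_power2 zero_less_power2)
qed

text \<open>A maximiser \<open>v\<close> of the Rayleigh quotient on the unit sphere of an invariant subspace is an
  eigenvector: the first variation in every direction orthogonal to \<open>v\<close> vanishes. Its orthogonal
  complement in the subspace is again invariant and has smaller dimension.\<close>

lemma self_adjoint_eigenbasis_subspace:
  fixes f :: "'a::euclidean_space \<Rightarrow> 'a"
  assumes f: "linear f" and adj: "\<And>x y. x \<bullet> f y = f x \<bullet> y"
    and V: "subspace V" and inv: "f ` V \<subseteq> V"
  shows "\<exists>E. E \<subseteq> V \<and> finite E \<and> pairwise orthogonal E \<and> (\<forall>e\<in>E. norm e = 1) \<and> V \<subseteq> span E
             \<and> (\<forall>e\<in>E. \<exists>c. f e = c *\<^sub>R e)"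
  using V inv
proof (induction "dim V" arbitrary: V rule: less_induct)
  case less
  show ?case
  proof (cases "V \<subseteq> {0}")
    case True
    then show ?thesis by (intro exI[of _ "{}"]) auto
  next
    case False
    then obtain z where z: "z \<in> V" "z \<noteq> 0" by auto
    have "compact (sphere 0 1 \<inter> V)"
      using closed_subspace[OF less.prems(1)] by (intro compact_Int_closed) auto
    moreover have "z /\<^sub>R norm z \<in> sphere 0 1 \<inter> V"
      using z less.prems(1) by (auto simp: subspace_scale)
    then have "sphere 0 1 \<inter> V \<noteq> {}" by blast
    moreover have "continuous_on (sphere 0 1 \<inter> V) (\<lambda>x. x \<bullet> f x)"
      using f by (intro continuous_intros linear_continuous_on) (simp add: linear_conv_bounded_linear)
    ultimately obtain v where v: "v \<in> sphere 0 1 \<inter> V"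
      and vmax: "\<And>y. y \<in> sphere 0 1 \<inter> V \<Longrightarrow> y \<bullet> f y \<le> v \<bullet> f v"
      using continuous_attains_sup by metis
    define l where "l = v \<bullet> f v"
    have nv: "v \<bullet> v = 1" "v \<noteq> 0" "norm v = 1" using v by (auto simp: norm_eq_1)
    have le: "y \<bullet> f y \<le> l * (y \<bullet> y)" if "y \<in> V" for y
    proof (cases "y = 0")
      case True
      then show ?thesis by simp
    next
      case False
      have "(y /\<^sub>R norm y) \<bullet> f (y /\<^sub>R norm y) \<le> l"
        unfolding l_def using False that less.prems(1) by (intro vmax) (auto simp: subspace_scale)
      then have "(y \<bullet> f y) / (norm y)\<^sup>2 \<le> l"
        by (simp add: linear_scale[OF f] power2_eq_square divide_inverse mult_ac)
      then show ?thesis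
        using False by (simp add: power2_norm_eq_inner divide_le_eq)
    qed
    have orth: "w \<bullet> f v = 0" if w: "w \<in> V" "w \<bullet> v = 0" for w
    proof (rule linear_term_vanishes)
      fix t :: real
      have "v + t *\<^sub>R w \<in> V"
        using v w less.prems(1) by (auto simp: subspace_add subspace_scale)
      from le[OF this] w(2) nv adj[of v w]
      show "2 * t * (w \<bullet> f v) \<le> t\<^sup>2 * (l * (w \<bullet> w) - w \<bullet> f w)"
        by (simp add: linear_add[OF f] linear_scale[OF f] inner_add inner_commute[of v w]
            inner_commute[of "f v"] l_def[symmetric] algebra_simps power2_eq_square)
    qed
    have eig: "f v = l *\<^sub>R v"
    proof -
      let ?w = "f v - l *\<^sub>R v"
      have "?w \<in> V"
        using v less.prems by (auto simp: subspace_diff subspace_scale)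
      moreover have "?w \<bullet> v = 0"
        by (simp add: inner_diff nv l_def inner_commute)
      ultimately have "?w \<bullet> f v = 0" by (rule orth)
      with \<open>?w \<bullet> v = 0\<close> have "?w \<bullet> ?w = 0"
        by (simp add: inner_diff_right)
      then show ?thesis by simp
    qed
    define W where "W = {x \<in> V. v \<bullet> x = 0}"
    have subW: "subspace W"
      unfolding W_def using subspace_inter[OF less.prems(1) subspace_hyperplane[of v]]
      by (simp add: Int_def)
    have "v \<notin> W" using nv by (simp add: W_def)
    then have "W \<subset> V" using v unfolding W_def by blast
    then have "dim W < dim V"
      using subW less.prems(1) by (intro dim_psubset) (metis span_eq_iff)
    moreover have "f ` W \<subseteq> W"
    proof clarsimp
      fix x assume "x \<in> W"
      then show "f x \<in> W"
        using less.prems(2) eig by (auto simp: W_def adj)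
    qed
    ultimately obtain E where E: "E \<subseteq> W" "finite E" "pairwise orthogonal E" "\<forall>e\<in>E. norm e = 1"
      "W \<subseteq> span E" "\<forall>e\<in>E. \<exists>c. f e = c *\<^sub>R e"
      using less.hyps[of W] subW by blast
    show ?thesis
    proof (intro exI[of _ "insert v E"] conjI)
      show "insert v E \<subseteq> V" using E v by (auto simp: W_def)
      show "pairwise orthogonal (insert v E)"
        using E by (auto simp: pairwise_insert orthogonal_def W_def inner_commute)
      show "V \<subseteq> span (insert v E)"
      proof
        fix x assume x: "x \<in> V"
        have "x - (v \<bullet> x) *\<^sub>R v \<in> W"
          using x v nv less.prems(1) by (auto simp: W_def subspace_diff subspace_scale inner_diff_right)
        then have "x - (v \<bullet> x) *\<^sub>R v \<in> span (insert v E)"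
          using E(5) span_mono[of E "insert v E"] by blast
        then have "x - (v \<bullet> x) *\<^sub>R v + (v \<bullet> x) *\<^sub>R v \<in> span (insert v E)"
          by (intro span_add span_scale) (auto simp: span_base)
        then show "x \<in> span (insert v E)" by simp
      qed
    qed (use E eig nv in auto)
  qed
qed

lemma symmetric_matrix_eigenbasis:
  fixes X :: "real^'n^'n"
  assumes "symmetric_matrix X"
  obtains E c where "finite E" "pairwise orthogonal E" "\<And>e. e \<in> E \<Longrightarrow> norm e = 1"
    "span E = UNIV" "\<And>e. e \<in> E \<Longrightarrow> X *v e = c e *\<^sub>R e"
proof -
  have "\<exists>E\<subseteq>UNIV. finite E \<and> pairwise orthogonal E \<and> (\<forall>e\<in>E. norm e = 1) \<and> UNIV \<subseteq> span E
             \<and> (\<forall>e\<in>E. \<exists>c. X *v e = c *\<^sub>R e)"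
    using assms by (intro self_adjoint_eigenbasis_subspace)
      (auto simp: symmetric_matrix_iff_self_adjoint)
  then obtain E where E: "finite E" "pairwise orthogonal E" "\<forall>e\<in>E. norm e = 1" "UNIV \<subseteq> span E"
    and "\<forall>e\<in>E. \<exists>c. X *v e = c *\<^sub>R e" by blast
  then obtain c where "\<forall>e\<in>E. X *v e = c e *\<^sub>R e" by metis
  with E show ?thesis by (intro that[of E c]) auto
qed

lemma matrix_eq_on_span:
  assumes "span E = UNIV" "\<And>e. e \<in> E \<Longrightarrow> X *v e = Y *v (e :: real^'n)"
  shows "X = Y"
proof -
  have "X *v x = Y *v x" for x
    by (rule linear_eq_on[of _ _ x E]) (use assms in auto)
  then show ?thesis by (simp add: matrix_eq)
qed

lemma pos_semidef_sqrt_exists: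
  assumes X: "pos_semidef (X :: real^'n^'n)"
  obtains Y where "pos_semidef Y" "Y ** Y = X"
proof -
  obtain E c where E: "finite E" "pairwise orthogonal E" "\<And>e. e \<in> E \<Longrightarrow> norm e = 1"
    "span E = UNIV" "\<And>e. e \<in> E \<Longrightarrow> X *v e = c e *\<^sub>R e"
    using X symmetric_matrix_eigenbasis unfolding pos_semidef_def by metis
  have c: "c e \<ge> 0" if "e \<in> E" for e
  proof -
    have "0 \<le> e \<bullet> (X *v e)" using X by (simp add: pos_semidef_def)
    then show ?thesis using E(3,5)[OF that] by (simp add: norm_eq_1)
  qed
  define f where "f v = (\<Sum>e\<in>E. (sqrt (c e) * (v \<bullet> e)) *\<^sub>R e)" for v
  have lin: "linear f"
    by (rule linearI) (simp_all add: f_def inner_add_left algebra_simps sum.distrib scaleR_sum_right)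
  define Y where "Y = matrix f"
  have Y: "Y *v v = f v" for v
    using lin by (simp add: Y_def matrix_works)
  have fe: "f e = sqrt (c e) *\<^sub>R e" if "e \<in> E" for e
  proof -
    have "f e = (\<Sum>d\<in>E. if d = e then sqrt (c e) *\<^sub>R e else 0)"
      unfolding f_def using E(2,3) that
      by (intro sum.cong) (auto simp: pairwise_def orthogonal_def norm_eq_1)
    also have "\<dots> = sqrt (c e) *\<^sub>R e"
      using E(1) that by simp
    finally show ?thesis .
  qed
  have "Y ** Y = X"
  proof (rule matrix_eq_on_span[OF E(4)])
    fix e assume "e \<in> E"
    then show "(Y ** Y) *v e = X *v e"
      using c[of e] by (simp add: matrix_vector_mul_assoc[symmetric] Y fe linear_scale[OF lin] E(5))
  qed
  moreover have "pos_semidef Y"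
    unfolding pos_semidef_def symmetric_matrix_iff_self_adjoint
  proof (intro conjI allI)
    fix x y
    show "x \<bullet> (Y *v y) = (Y *v x) \<bullet> y"
      by (simp add: Y f_def inner_sum_left inner_sum_right mult_ac inner_commute)
    show "0 \<le> x \<bullet> (Y *v x)"
      by (simp add: Y f_def inner_sum_right mult.assoc c sum_nonneg)
  qed
  ultimately show ?thesis using that by blast
qed

text \<open>On an eigenvector \<open>v\<close> of \<open>Y\<close> with eigenvalue \<open>l\<close>, the equation \<open>Z\<^sup>2 v = l\<^sup>2 v\<close> factors as
  \<open>(Z + l)(Z - l) v = 0\<close>, and \<open>Z + l\<close> is injective unless \<open>l = 0\<close>.\<close>

lemma pos_semidef_sqrt_unique:
  assumes Y: "pos_semidef (Y :: real^'n^'n)" and Z: "pos_semidef Z" and eq: "Y ** Y = Z ** Z"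
  shows "Y = Z"
proof -
  obtain E c where E: "span E = UNIV" "\<And>e. e \<in> E \<Longrightarrow> norm e = 1" "\<And>e. e \<in> E \<Longrightarrow> Y *v e = c e *\<^sub>R e"
    using Y symmetric_matrix_eigenbasis unfolding pos_semidef_def by metis
  show ?thesis
  proof (rule matrix_eq_on_span[OF E(1)])
    fix e assume e: "e \<in> E"
    have "0 \<le> e \<bullet> (Y *v e)" using Y by (simp add: pos_semidef_def)
    then have c: "c e \<ge> 0" using E(2,3)[OF e] by (simp add: norm_eq_1)
    define w where "w = Z *v e - c e *\<^sub>R e"
    have ZZ: "Z *v (Z *v e) = (c e * c e) *\<^sub>R e"
      using arg_cong[OF eq, of "\<lambda>X. X *v e"] E(3)[OF e]
      by (simp add: matrix_vector_mul_assoc[symmetric] matrix_vector_mult_scaleR)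
    then have Zw: "Z *v w = - c e *\<^sub>R w"
      by (simp add: w_def algebra_simps)
    have "0 \<le> w \<bullet> (Z *v w)" using Z by (simp add: pos_semidef_def)
    then have "c e * (w \<bullet> w) \<le> 0" unfolding Zw by simp
    then have cases: "c e = 0 \<or> w = 0"
      using c by (metis inner_ge_zero inner_eq_zero_iff mult_nonneg_nonneg mult_eq_0_iff order_antisym)
    have "w = 0"
    proof (rule disjE[OF cases])
      assume "c e = 0"
      then have "w = Z *v e" "Z *v w = 0" using Zw by (auto simp: w_def)
      then have "w \<bullet> w = 0"
        using Z self_adjointD[of Z e w] by (simp add: pos_semidef_def)
      then show ?thesis by simp
    qed
    then show "Y *v e = Z *v e"
      using E(3)[OF e] by (simp add: w_def)
  qed
qed

lemma msqrt:
  assumes "pos_semidef X"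
  shows "pos_semidef (msqrt X)" "msqrt X ** msqrt X = X"
proof -
  obtain Y where "pos_semidef Y" "Y ** Y = X" using pos_semidef_sqrt_exists[OF assms] .
  then have "\<exists>!Y. pos_semidef Y \<and> Y ** Y = X"
    using pos_semidef_sqrt_unique by blast
  from theI'[OF this] show "pos_semidef (msqrt X)" "msqrt X ** msqrt X = X"
    by (simp_all add: msqrt_def)
qed

text \<open>If \<open>v \<bullet> Y v = 0\<close>, then \<open>v\<close> minimises the form of \<open>Y\<close>, and its vanishing first variation in the
  direction \<open>Y v\<close> is \<open>v \<bullet> Y\<^sup>2 v\<close>.\<close>

lemma pos_semidef_pos_defI:
  assumes "pos_semidef Y" "pos_def (Y ** Y)"
  shows "pos_def Y"
  unfolding pos_def_def
proof (intro conjI allI impI)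
  show "symmetric_matrix Y" using assms(1) by (simp add: pos_semidef_def)
  fix v :: "real^'a" assume v: "v \<noteq> 0"
  have adj: "(Y *v x) \<bullet> y = x \<bullet> (Y *v y)" for x y
    using assms(1) by (simp add: pos_semidef_def self_adjointD)
  have psd: "0 \<le> x \<bullet> (Y *v x)" for x
    using assms(1) by (simp add: pos_semidef_def)
  have "v \<bullet> (Y *v v) \<noteq> 0"
  proof
    assume 0: "v \<bullet> (Y *v v) = 0"
    have "(Y *v v) \<bullet> (Y *v v) = 0"
    proof (rule linear_term_vanishes)
      fix t :: real
      have "0 \<le> (v - t *\<^sub>R (Y *v v)) \<bullet> (Y *v (v - t *\<^sub>R (Y *v v)))" by (rule psd)
      then show "2 * t * ((Y *v v) \<bullet> (Y *v v)) \<le> t\<^sup>2 * ((Y *v v) \<bullet> (Y *v (Y *v v)))"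
        using 0 adj[of v "Y *v v"] by (simp add: algebra_simps inner_diff power2_eq_square)
    qed
    moreover have "0 < v \<bullet> ((Y ** Y) *v v)"
      using assms(2) v by (simp add: pos_def_def)
    ultimately show False
      by (simp add: matrix_vector_mul_assoc[symmetric])
  qed
  then show "0 < v \<bullet> (Y *v v)" using psd[of v] by simp
qed

lemma pos_def_msqrt: "pos_def X \<Longrightarrow> pos_def (msqrt X)"
  by (metis msqrt pos_def_imp_pos_semidef pos_semidef_pos_defI)

section \<open>One step of the Riccati recursion\<close>

lemmas matrix_vector_expand = matrix_vector_mul_assoc[symmetric] matrix_vector_right_distrib
  matrix_vector_mult_diff_distrib matrix_vector_mult_add_rdistrib matrix_vector_mult_diff_rdistrib

lemma matrix_vector_mult_uminus [simp]: "(- X) *v x = - (X *v (x :: real^_))"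
  using matrix_vector_mult_diff_rdistrib[of 0 X x] by simp

lemma matrix_vector_mult_uminus_right [simp]: "X *v (- x) = - (X *v (x :: real^_))"
  using matrix_vector_mult_diff_distrib[of X 0 x] by simp

text \<open>The Hessian in the control \<open>v\<close> of \<open>(1/2) v \<bullet> v + (1/2) x' \<bullet> P x'\<close>, where \<open>x' = Ab x + B v\<close> is the
  next state.\<close>

definition control_hessian :: "real^'m^'n \<Rightarrow> real^'n^'n \<Rightarrow> real^'m^'m" where
  "control_hessian B P = mat 1 + transpose B ** P ** B"

text \<open>The gain for the control \<open>v = u + S\<^sup>\<top> x\<close>.\<close>

definition feedback_gain :: "real^'n^'n \<Rightarrow> real^'m^'n \<Rightarrow> real^'n^'n \<Rightarrow> real^'n^'m" where
  "feedback_gain Ab B P = matrix_inv (control_hessian B P) ** transpose B ** P ** Ab"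

definition closed_loop :: "real^'n^'n \<Rightarrow> real^'m^'n \<Rightarrow> real^'n^'n \<Rightarrow> real^'n^'n" where
  "closed_loop Ab B P = Ab - B ** feedback_gain Ab B P"

lemma control_hessian_vector: "control_hessian B P *v w = w + transpose B *v (P *v (B *v w))"
  by (simp add: control_hessian_def matrix_vector_expand)

lemma closed_loop_vector: "closed_loop Ab B P *v x = Ab *v x - B *v (feedback_gain Ab B P *v x)"
  by (simp add: closed_loop_def matrix_vector_expand)

lemma symmetric_control_hessian:
  assumes "symmetric_matrix P"
  shows "symmetric_matrix (control_hessian B P)"
  unfolding symmetric_matrix_iff_self_adjoint
  by (simp add: control_hessian_vector inner_add inner_commute[of _ "transpose B *v _"]
      inner_matrix_transpose[symmetric]) (metis assms inner_commute inner_matrix_transpose self_adjointD)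

lemma control_hessian_gain:
  assumes "invertible (control_hessian B P)"
  shows "control_hessian B P *v (feedback_gain Ab B P *v x) = transpose B *v (P *v (Ab *v x))"
  by (simp add: feedback_gain_def matrix_vector_expand matrix_inv_vector_mul[OF assms])

text \<open>The optimal control is the costate feedback \<open>- B\<^sup>\<top> P x'\<close> at the next state \<open>x'\<close> of the closed loop.
  Hence the kernel of the closed loop is contained in that of \<open>Ab\<close>.\<close>

lemma feedback_gain_closed_loop:
  assumes "invertible (control_hessian B P)"
  shows "feedback_gain Ab B P *v x = transpose B *v (P *v (closed_loop Ab B P *v x))"
  using control_hessian_gain[OF assms, of Ab x]
  by (simp add: control_hessian_vector closed_loop_vector matrix_vector_expand algebra_simps)

lemma closed_loop_invertible:
  assumes "invertible (control_hessian B P)" "invertible Ab"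
  shows "invertible (closed_loop Ab B P)"
  unfolding invertible_iff_ker
proof (intro allI impI)
  fix x assume 0: "closed_loop Ab B P *v x = 0"
  then have "feedback_gain Ab B P *v x = 0"
    by (simp add: feedback_gain_closed_loop[OF assms(1)])
  with 0 have "Ab *v x = 0" by (simp add: closed_loop_vector)
  then show "x = 0" using assms(2) by (simp add: invertible_iff_ker)
qed

lemma riccati_step_vector:
  "riccati_step A B Q S k P *v x = Qbar Q S k *v x
     + transpose (Abar A B S k) *v (P *v (closed_loop (Abar A B S k) (B k) P *v x))"
  by (simp add: riccati_step_def Let_def closed_loop_def feedback_gain_def control_hessian_def
      matrix_vector_expand algebra_simps)

lemma symmetric_riccati_step:
  assumes P: "symmetric_matrix P" and q: "symmetric_matrix (Qbar Q S k)"
    and R: "invertible (control_hessian (B k) P)"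
  shows "symmetric_matrix (riccati_step A B Q S k P)"
  unfolding symmetric_matrix_iff_self_adjoint
proof (intro allI)
  fix x y
  let ?A = "Abar A B S k" and ?F = "feedback_gain (Abar A B S k) (B k) P"
  have expand: "x \<bullet> (riccati_step A B Q S k P *v y) = x \<bullet> (Qbar Q S k *v y)
      + (?A *v x) \<bullet> (P *v (?A *v y)) - (?F *v x) \<bullet> (control_hessian (B k) P *v (?F *v y))" for x y
  proof -
    have "(?A *v x) \<bullet> (P *v (B k *v (?F *v y)))
        = (transpose (B k) *v (P *v (?A *v x))) \<bullet> (?F *v y)"
      by (simp add: inner_matrix_transpose[symmetric] self_adjointD[OF P])
    also have "\<dots> = (?F *v x) \<bullet> (control_hessian (B k) P *v (?F *v y))"
      by (simp add: control_hessian_gain[OF R, symmetric]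
          self_adjointD[OF symmetric_control_hessian[OF P]])
    finally show ?thesis
      by (simp add: riccati_step_vector inner_add_right inner_matrix_transpose[symmetric]
          closed_loop_vector matrix_vector_expand inner_diff_right inner_commute[of x]
          inner_commute[of _ "?A *v x"])
  qed
  show "x \<bullet> (riccati_step A B Q S k P *v y) = (riccati_step A B Q S k P *v x) \<bullet> y"
    unfolding inner_commute[of _ y] expand
    using self_adjointD[OF P, of "?A *v x" "?A *v y"] self_adjointD[OF q, of x y]
      self_adjointD[OF symmetric_control_hessian[OF P], of "B k" "?F *v x" "?F *v y"]
    by (simp add: inner_commute)
qed

text \<open>Completing the square in the control: \<open>v = - F x\<close> minimises one stage plus the cost to go.\<close>

lemma riccati_step_complete_square:
  assumes P: "symmetric_matrix P" and R: "invertible (control_hessian (B k) P)"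
  shows "x \<bullet> (Qbar Q S k *v x) + v \<bullet> v
        + (Abar A B S k *v x + B k *v v) \<bullet> (P *v (Abar A B S k *v x + B k *v v))
      = x \<bullet> (riccati_step A B Q S k P *v x)
        + (v + feedback_gain (Abar A B S k) (B k) P *v x)
            \<bullet> (control_hessian (B k) P *v (v + feedback_gain (Abar A B S k) (B k) P *v x))"
proof -
  let ?a = "Abar A B S k *v x" and ?f = "feedback_gain (Abar A B S k) (B k) P *v x"
  let ?R = "control_hessian (B k) P"
  have Rf: "?R *v ?f = transpose (B k) *v (P *v ?a)"
    by (rule control_hessian_gain[OF R])
  have cross1: "v \<bullet> (?R *v ?f) = ?a \<bullet> (P *v (B k *v v))"
    by (metis Rf P inner_commute inner_matrix_transpose self_adjointD)
  have cross2: "?f \<bullet> (?R *v v) = v \<bullet> (?R *v ?f)"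
    by (metis P inner_commute self_adjointD symmetric_control_hessian)
  have cross3: "(B k *v v) \<bullet> (P *v ?a) = ?a \<bullet> (P *v (B k *v v))"
    by (metis P inner_commute self_adjointD)
  have ff: "?f \<bullet> (?R *v ?f) = ?a \<bullet> (P *v (B k *v ?f))"
    by (metis Rf P inner_commute inner_matrix_transpose self_adjointD)
  have vv: "v \<bullet> (?R *v v) = v \<bullet> v + (B k *v v) \<bullet> (P *v (B k *v v))"
    by (simp add: control_hessian_vector inner_add_right)
       (metis inner_commute inner_matrix_transpose)
  have rx: "x \<bullet> (riccati_step A B Q S k P *v x)
      = x \<bullet> (Qbar Q S k *v x) + ?a \<bullet> (P *v ?a) - ?a \<bullet> (P *v (B k *v ?f))"
    by (simp add: riccati_step_vector inner_add_right closed_loop_vector matrix_vector_expand inner_diff_right)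
       (metis inner_commute inner_matrix_transpose)
  show ?thesis
    by (simp add: rx matrix_vector_expand inner_add cross1 cross2 cross3 ff vv)
qed

section \<open>Block matrices and transition matrices\<close>

lemma sum_UNIV_sum:
  fixes f :: "'a::finite + 'b::finite \<Rightarrow> 'c::comm_monoid_add"
  shows "sum f UNIV = (\<Sum>i\<in>UNIV. f (Inl i)) + (\<Sum>j\<in>UNIV. f (Inr j))"
  by (simp add: UNIV_Plus_UNIV[symmetric] sum.Plus del: UNIV_Plus_UNIV)

lemma block_matrix_vector:
  "block_matrix X11 X12 X21 X22 *v block_vec x y
    = block_vec (X11 *v x + X12 *v y) (X21 *v x + X22 *v (y :: real^_))"
  by (auto simp: vec_eq_iff matrix_vector_mult_def block_matrix_def block_vec_def sum_UNIV_sum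
      split: sum.split)

lemma inner_block_vec: "block_vec a b \<bullet> block_vec c d = a \<bullet> c + b \<bullet> (d :: real^_)"
  by (simp add: inner_vec_def sum_UNIV_sum block_vec_def)

lemma block_vec_eq_iff: "block_vec a b = block_vec c d \<longleftrightarrow> a = c \<and> b = d"
proof
  assume "block_vec a b = block_vec c d"
  then have "block_vec a b $ Inl i = block_vec c d $ Inl i"
    "block_vec a b $ Inr j = block_vec c d $ Inr j" for i j by auto
  then show "a = c \<and> b = d" by (simp add: block_vec_def vec_eq_iff)
qed simp

lemma block_vec_exhaust: obtains x y where "z = block_vec x y"
proof
  show "z = block_vec (\<chi> i. z $ Inl i) (\<chi> j. z $ Inr j)"
    by (auto simp: vec_eq_iff block_vec_def split: sum.split)
qed

lemma block_vec_0 [simp]: "block_vec 0 0 = 0"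
  by (auto simp: vec_eq_iff block_vec_def split: sum.split)

lemma upper_block_vector:
  assumes "X *v block_vec x y = block_vec a (b :: real^_)"
  shows "a = block11 X *v x + block12 X *v y"
proof -
  have "a $ i = (X *v block_vec x y) $ Inl i" for i
    unfolding assms by (simp add: block_vec_def)
  then show ?thesis
    by (simp add: vec_eq_iff matrix_vector_mult_def sum_UNIV_sum block_vec_def block11_def block12_def)
qed

lemma transition_refl [simp]: "transition F k k = mat 1"
  by (simp add: transition.simps)

lemma transition_backward: "k < l \<Longrightarrow> transition F k l = matrix_inv (F k) ** transition F (Suc k) l"
  by (subst transition.simps) simp

lemma transition_forward: "l \<le> k \<Longrightarrow> transition F (Suc k) l = F k ** transition F k l"
  by (subst transition.simps) simp

lemma transition_peel_right: "l < k \<Longrightarrow> transition F k l = transition F k (Suc l) ** F l"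
proof (induction k)
  case (Suc k)
  show ?case
  proof (cases "l = k")
    case False
    with Suc show ?thesis
      by (simp add: transition_forward matrix_mul_assoc)
  qed (simp add: transition_forward)
qed simp


section \<open>The Hamiltonian system\<close>

locale linear_system =
  fixes A :: "nat \<Rightarrow> real^'n^'n" and B :: "nat \<Rightarrow> real^'m^'n"
    and Q :: "nat \<Rightarrow> real^'n^'n" and S :: "nat \<Rightarrow> real^'m^'n" and N :: nat
  assumes Qbar_psd: "\<And>k. k < N \<Longrightarrow> pos_semidef (Qbar Q S k)"
    and Abar_invertible: "\<And>k. k < N \<Longrightarrow> invertible (Abar A B S k)"
begin

abbreviation "Ab k \<equiv> Abar A B S k"
abbreviation "Qb k \<equiv> Qbar Q S k"
abbreviation "\<phi>11 \<equiv> block11 (transition (Mmat A B Q S) 0 N)"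
abbreviation "\<phi>12 \<equiv> block12 (transition (Mmat A B Q S) 0 N)"

text \<open>The recursion \<open>z\<^sub>k\<^sub>+\<^sub>1 = M\<^sub>k z\<^sub>k\<close> for \<open>z = (x, y)\<close> says that \<open>x\<close> is driven by the control
  \<open>- B\<^sup>\<top> y\<close> at the next costate, and that the costate obeys the adjoint equation backwards in time.\<close>

definition controlled :: "(nat \<Rightarrow> real^'n) \<Rightarrow> (nat \<Rightarrow> real^'m) \<Rightarrow> bool" where
  "controlled x u \<longleftrightarrow> (\<forall>k<N. x (Suc k) = Ab k *v x k + B k *v u k)"

definition costate :: "(nat \<Rightarrow> real^'n) \<Rightarrow> (nat \<Rightarrow> real^'n) \<Rightarrow> bool" where
  "costate x y \<longleftrightarrow> (\<forall>k<N. y k = Qb k *v x k + transpose (Ab k) *v y (Suc k))"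

definition hamiltonian :: "(nat \<Rightarrow> real^'n) \<Rightarrow> (nat \<Rightarrow> real^'n) \<Rightarrow> bool" where
  "hamiltonian x y \<longleftrightarrow> controlled x (\<lambda>k. - (transpose (B k) *v y (Suc k))) \<and> costate x y"

lemma Qb_psd: "k < N \<Longrightarrow> 0 \<le> x \<bullet> (Qb k *v x)"
  using Qbar_psd by (simp add: pos_semidef_def)

lemma Qb_sym: "k < N \<Longrightarrow> symmetric_matrix (Qb k)"
  using Qbar_psd by (simp add: pos_semidef_def)

lemma Mmat_vector:
  fixes x y :: "real^'n"
  defines "p \<equiv> \<lambda>k. transpose (matrix_inv (Ab k)) *v (y - Qb k *v x)"
  shows "Mmat A B Q S k *v block_vec x y
      = block_vec (Ab k *v x - B k *v (transpose (B k) *v p k)) (p k)"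
  by (simp add: Mmat_def Let_def block_matrix_vector matrix_vector_expand p_def Gmat_def algebra_simps)

lemma transpose_Ab_inv: "k < N \<Longrightarrow> transpose (Ab k) *v (transpose (matrix_inv (Ab k)) *v v) = v"
  using arg_cong[OF matrix_inv_mul(2)[OF Abar_invertible[of k]], of transpose]
  by (simp add: matrix_transpose_mul matrix_vector_mul_assoc)

lemma Mmat_invertible:
  assumes k: "k < N"
  shows "invertible (Mmat A B Q S k)"
  unfolding invertible_iff_ker
proof (intro allI impI)
  fix z assume 0: "Mmat A B Q S k *v z = 0"
  obtain x y where z: "z = block_vec x y" using block_vec_exhaust .
  define p where "p = transpose (matrix_inv (Ab k)) *v (y - Qb k *v x)"
  from 0 have "Ab k *v x - B k *v (transpose (B k) *v p) = 0" "p = 0"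
    unfolding z Mmat_vector p_def[symmetric] block_vec_0[symmetric] block_vec_eq_iff by auto
  then have x: "x = 0"
    using Abar_invertible[OF k] by (simp add: invertible_iff_ker)
  have "y - Qb k *v x = transpose (Ab k) *v p"
    by (simp add: p_def transpose_Ab_inv[OF k])
  then show "z = 0" using \<open>p = 0\<close> x z by simp
qed

text \<open>Trajectories are parametrised by their final value; the blocks \<open>\<phi>11\<close> and \<open>\<phi>12\<close> give the initial
  state.\<close>

lemma hamiltonian_exists:
  obtains x y where "hamiltonian x y" "x N = a" "y N = b" "x 0 = \<phi>11 *v a + \<phi>12 *v b"
proof -
  define z where "z k = transition (Mmat A B Q S) k N *v block_vec a b" for k
  define x where "x k = (SOME x. \<exists>y. z k = block_vec x y)" for k
  have "\<exists>y. z k = block_vec (x k) y" for k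
    unfolding x_def by (rule someI_ex) (metis block_vec_exhaust)
  then obtain y where z: "\<And>k. z k = block_vec (x k) (y k)" by metis
  have step: "z (Suc k) = Mmat A B Q S k *v z k" if "k < N" for k
    using that by (simp add: z_def transition_backward matrix_vector_expand
        matrix_inv_vector_mul[OF Mmat_invertible])
  have yk: "y (Suc k) = transpose (matrix_inv (Ab k)) *v (y k - Qb k *v x k)"
    and xk: "x (Suc k) = Ab k *v x k - B k *v (transpose (B k) *v y (Suc k))" if "k < N" for k
    using step[OF that] unfolding z Mmat_vector block_vec_eq_iff by auto
  have "costate x y"
    unfolding costate_def by (metis yk transpose_Ab_inv add.commute diff_add_cancel)
  moreover have "controlled x (\<lambda>k. - (transpose (B k) *v y (Suc k)))"
    unfolding controlled_def using xk by simp
  moreover have "block_vec (x N) (y N) = block_vec a b"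
    using z[of N] by (simp add: z_def)
  moreover have "x 0 = \<phi>11 *v a + \<phi>12 *v b"
    using z[of 0] by (intro upper_block_vector) (simp add: z_def)
  ultimately show ?thesis
    using that by (auto simp: hamiltonian_def block_vec_eq_iff)
qed

text \<open>Summation by parts. Its instances below express that the flow is symplectic and that the
  stage costs along a Hamiltonian trajectory telescope.\<close>

lemma controlled_costate_pairing:
  assumes x: "controlled x u" and y: "costate x' y"
  shows "x 0 \<bullet> y 0 = x N \<bullet> y N
           + (\<Sum>k<N. x k \<bullet> (Qb k *v x' k) - u k \<bullet> (transpose (B k) *v y (Suc k)))"
proof -
  have "x 0 \<bullet> y 0 = x j \<bullet> y j
           + (\<Sum>k<j. x k \<bullet> (Qb k *v x' k) - u k \<bullet> (transpose (B k) *v y (Suc k)))" if "j \<le> N" for j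
    using that
  proof (induction j)
    case (Suc j)
    have "x j \<bullet> y j = x j \<bullet> (Qb j *v x' j) + (Ab j *v x j) \<bullet> y (Suc j)"
      using y Suc.prems by (auto simp: costate_def inner_add_right inner_matrix_transpose[of _ "transpose _"])
    also have "Ab j *v x j = x (Suc j) - B j *v u j"
      using x Suc.prems by (auto simp: controlled_def)
    finally show ?case
      using Suc by (simp add: inner_diff_left inner_matrix_transpose[of _ "transpose _"])
  qed simp
  then show ?thesis by blast
qed

lemma reach_gramian_vector:
  "reach_gramian A B S k1 k0 *v v
    = (\<Sum>k = k0..<k1. transition Ab k1 (Suc k) *v (B k *v
          (transpose (B k) *v (transpose (transition Ab k1 (Suc k)) *v v))))"
proof -
  have sum_mv: "sum F I *v v = (\<Sum>i\<in>I. F i *v v)" for F :: "nat \<Rightarrow> real^'n^'n" and I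
    by (induction I rule: infinite_finite_induct) (simp_all add: matrix_vector_mult_add_rdistrib)
  show ?thesis
    by (simp add: reach_gramian_def sum_mv Gmat_def matrix_vector_expand)
qed

text \<open>A Hamiltonian trajectory that vanishes at both ends has zero cost. Hence its state and its
  control vanish, and its costate is transported by \<open>transpose (Ab k)\<close> inside the kernels of
  \<open>transpose (B k)\<close>; the Gramian annihilates the final costate.\<close>

lemma \<phi>12_invertible:
  assumes reach: "invertible (reach_gramian A B S N 0)"
  shows "invertible \<phi>12"
  unfolding invertible_iff_ker
proof (intro allI impI)
  fix b assume b: "\<phi>12 *v b = 0"
  obtain x y where h: "hamiltonian x y" and ends: "x N = 0" "y N = b" "x 0 = 0"
    by (rule hamiltonian_exists[of 0 b]) (use b in simp)
  have xu: "controlled x (\<lambda>k. - (transpose (B k) *v y (Suc k)))" and cy: "costate x y"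
    using h by (auto simp: hamiltonian_def)
  have "(\<Sum>k<N. x k \<bullet> (Qb k *v x k) + (transpose (B k) *v y (Suc k)) \<bullet> (transpose (B k) *v y (Suc k))) = 0"
    using controlled_costate_pairing[OF xu cy] ends by simp
  then have zero: "(transpose (B k) *v y (Suc k)) \<bullet> (transpose (B k) *v y (Suc k)) = 0" if "k < N" for k
    using that Qb_psd
    by (subst (asm) sum_nonneg_eq_0_iff) (auto intro: add_nonneg_nonneg simp: add_nonneg_eq_0_iff)
  then have By: "transpose (B k) *v y (Suc k) = 0" if "k < N" for k
    using that by simp
  have x0: "x k = 0" if "k \<le> N" for k
    using that by (induction k) (use xu By ends in \<open>auto simp: controlled_def\<close>)
  have y: "y k = transpose (transition Ab N k) *v b" if "k \<le> N" for k
    using that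
  proof (induction rule: inc_induct)
    case base
    then show ?case by (simp add: ends)
  next
    case (step k)
    then show ?case
      using cy x0[of k]
      by (simp add: costate_def transition_peel_right matrix_transpose_mul matrix_vector_expand)
  qed
  have "reach_gramian A B S N 0 *v b = 0"
    unfolding reach_gramian_vector using By y by (intro sum.neutral) auto
  then show "b = 0" using reach by (simp add: invertible_iff_ker)
qed

text \<open>The form \<open>a \<bullet> (min_energy *v a)\<close> is the cost of the Hamiltonian trajectory from \<open>0\<close> to \<open>a\<close>.\<close>

abbreviation "min_energy \<equiv> matrix_inv \<phi>12 ** \<phi>11"

lemma hamiltonian_from_zero:
  assumes "invertible \<phi>12"
  obtains x y where "hamiltonian x y" "x 0 = 0" "x N = a" "y N = - (min_energy *v a)"
  by (rule hamiltonian_exists[of a "- (min_energy *v a)"])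
    (use assms in \<open>simp add: matrix_vector_expand matrix_inv_vector_mul\<close>)

lemma symmetric_min_energy:
  assumes inv: "invertible \<phi>12"
  shows "symmetric_matrix min_energy"
  unfolding symmetric_matrix_iff_self_adjoint
proof (intro allI)
  fix a b
  obtain x y where h: "hamiltonian x y" and ends: "x 0 = 0" "x N = a" "y N = - (min_energy *v a)"
    using hamiltonian_from_zero[OF inv] .
  obtain x' y' where h': "hamiltonian x' y'" and ends': "x' 0 = 0" "x' N = b" "y' N = - (min_energy *v b)"
    using hamiltonian_from_zero[OF inv] .
  let ?c = "\<lambda>x y x' y'. \<Sum>k<N. x k \<bullet> (Qb k *v x' k)
     + (transpose (B k) *v y (Suc k)) \<bullet> (transpose (B k) *v y' (Suc k))"
  have "a \<bullet> (min_energy *v b) = ?c x y x' y'"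
    using controlled_costate_pairing[of x _ x' y'] h h' ends ends' unfolding hamiltonian_def by fastforce
  moreover have "b \<bullet> (min_energy *v a) = ?c x' y' x y"
    using controlled_costate_pairing[of x' _ x y] h h' ends ends' unfolding hamiltonian_def by fastforce
  moreover have "?c x' y' x y = ?c x y x' y'"
  proof (intro sum.cong refl)
    fix k assume "k \<in> {..<N}"
    then have "x' k \<bullet> (Qb k *v x k) = x k \<bullet> (Qb k *v x' k)"
      by (metis Qb_sym inner_commute lessThan_iff self_adjointD)
    then show "x' k \<bullet> (Qb k *v x k) + (transpose (B k) *v y' (Suc k)) \<bullet> (transpose (B k) *v y (Suc k))
        = x k \<bullet> (Qb k *v x' k) + (transpose (B k) *v y (Suc k)) \<bullet> (transpose (B k) *v y' (Suc k))"
      by (simp add: inner_commute)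
  qed
  ultimately show "a \<bullet> (min_energy *v b) = (min_energy *v a) \<bullet> b"
    by (simp add: inner_commute)
qed

text \<open>Among all trajectories from \<open>0\<close> to \<open>x N\<close>, the Hamiltonian one minimises the cost: expand
  the nonnegative cost of the difference of the two.\<close>

lemma min_energy_le:
  assumes inv: "invertible \<phi>12" and xu: "controlled x u" and x0: "x 0 = 0"
  shows "x N \<bullet> (min_energy *v x N) \<le> (\<Sum>k<N. x k \<bullet> (Qb k *v x k) + u k \<bullet> u k)"
proof -
  obtain x' y' where h: "hamiltonian x' y'"
    and ends: "x' 0 = 0" "x' N = x N" "y' N = - (min_energy *v x N)"
    using hamiltonian_from_zero[OF inv] .
  define u' where "u' k = - (transpose (B k) *v y' (Suc k))" for k
  have xu': "controlled x' u'" and cy: "costate x' y'"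
    using h unfolding hamiltonian_def u'_def by blast+
  have mixed: "x N \<bullet> (min_energy *v x N) = (\<Sum>k<N. x k \<bullet> (Qb k *v x' k) + u k \<bullet> u' k)"
    using controlled_costate_pairing[OF xu cy] ends x0 by (simp add: u'_def)
  have pure: "x N \<bullet> (min_energy *v x N) = (\<Sum>k<N. x' k \<bullet> (Qb k *v x' k) + u' k \<bullet> u' k)"
    using controlled_costate_pairing[OF xu' cy] ends by (simp add: u'_def)
  have "2 * (\<Sum>k<N. x k \<bullet> (Qb k *v x' k) + u k \<bullet> u' k)
      \<le> (\<Sum>k<N. x k \<bullet> (Qb k *v x k) + u k \<bullet> u k) + (\<Sum>k<N. x' k \<bullet> (Qb k *v x' k) + u' k \<bullet> u' k)"
    unfolding sum_distrib_left sum.distrib[symmetric]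
  proof (rule sum_mono)
    fix k assume "k \<in> {..<N}"
    then have k: "k < N" by simp
    have "0 \<le> (x k - x' k) \<bullet> (Qb k *v (x k - x' k)) + (u k - u' k) \<bullet> (u k - u' k)"
      by (simp add: Qb_psd[OF k])
    moreover have "x' k \<bullet> (Qb k *v x k) = x k \<bullet> (Qb k *v x' k)"
      by (metis Qb_sym[OF k] inner_commute self_adjointD)
    ultimately show "2 * (x k \<bullet> (Qb k *v x' k) + u k \<bullet> u' k)
      \<le> x k \<bullet> (Qb k *v x k) + u k \<bullet> u k + (x' k \<bullet> (Qb k *v x' k) + u' k \<bullet> u' k)"
      by (simp add: matrix_vector_expand inner_diff algebra_simps inner_commute[of "u' k" "u k"])
  qed
  then show ?thesis using mixed pure by linarith
qed

end

section \<open>The Riccati solution of the density control problem\<close>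

locale density_control = linear_system A B Q S N
  for A :: "nat \<Rightarrow> real^'n^'n" and B :: "nat \<Rightarrow> real^'m^'n"
    and Q :: "nat \<Rightarrow> real^'n^'n" and S :: "nat \<Rightarrow> real^'m^'n" and N :: nat +
  fixes \<Sigma>0 \<Sigma>N :: "real^'n^'n" and P :: "nat \<Rightarrow> real^'n^'n"
  assumes \<Sigma>0_pd: "pos_def \<Sigma>0" and \<Sigma>N_pd: "pos_def \<Sigma>N"
    and reachable: "invertible (reach_gramian A B S N 0)"
    and riccati: "\<And>k. k < N \<Longrightarrow> P k = riccati_step A B Q S k (P (Suc k))"
    and terminal: "P N = riccati_terminal A B Q S N \<Sigma>0 \<Sigma>N"
begin

abbreviation "R k \<equiv> control_hessian (B k) (P (Suc k))"
abbreviation "F k \<equiv> feedback_gain (Ab k) (B k) (P (Suc k))"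
abbreviation "T k \<equiv> closed_loop (Ab k) (B k) (P (Suc k))"

lemmas inv_\<phi>12 = \<phi>12_invertible[OF reachable]

text \<open>The square root in the terminal value enters only through this matrix \<open>Z\<close>, the positive
  semidefinite solution of \<open>Z \<Sigma>N Z = \<Sigma>N\<^sup>-\<^sup>1 / 4 + \<phi>12\<^sup>-\<^sup>1 \<Sigma>0 \<phi>12\<^sup>-\<^sup>\<top>\<close>.\<close>

lemma terminal_root:
  obtains Z where "P N = - min_energy + Z + (1/2) *\<^sub>R matrix_inv \<Sigma>N" "pos_semidef Z"
    "\<And>v. Z *v (\<Sigma>N *v (Z *v v)) = (1/4) *\<^sub>R (matrix_inv \<Sigma>N *v v)
        + matrix_inv \<phi>12 *v (\<Sigma>0 *v (transpose (matrix_inv \<phi>12) *v v))"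
proof -
  define H where "H = msqrt \<Sigma>N"
  define Hi where "Hi = matrix_inv H"
  define Y where "Y = transpose (matrix_inv \<phi>12) ** H"
  define D where "D = (1/4) *\<^sub>R mat 1
       + H ** matrix_inv \<phi>12 ** \<Sigma>0 ** transpose (matrix_inv \<phi>12) ** H"
  define Z where "Z = Hi ** msqrt D ** Hi"
  have H: "pos_def H" "H ** H = \<Sigma>N"
    using \<Sigma>N_pd by (auto simp: H_def intro: pos_def_msqrt msqrt pos_def_imp_pos_semidef)
  have iH: "invertible H" using H(1) by (rule pos_def_invertible)
  have Hsym: "(H *v x) \<bullet> y = x \<bullet> (H *v y)" for x y
    using H(1) by (simp add: pos_def_def self_adjointD)
  have Hi_sym: "(Hi *v x) \<bullet> y = x \<bullet> (Hi *v y)" for x y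
    using symmetric_matrix_inv[OF iH] H(1) by (simp add: Hi_def pos_def_def self_adjointD)
  have HHi: "H *v (Hi *v x) = x" "Hi *v (H *v x) = x" for x
    by (simp_all add: Hi_def matrix_inv_vector_mul[OF iH])
  have \<Sigma>Ni: "matrix_inv \<Sigma>N *v x = Hi *v (Hi *v x)" for x
  proof -
    have "\<Sigma>N ** (Hi ** Hi) = mat 1"
      by (simp add: matrix_eq H(2)[symmetric] matrix_vector_expand HHi)
    then show ?thesis
      using matrix_inv_eqI by (metis matrix_vector_mul_assoc)
  qed
  have D: "D *v x = (1/4) *\<^sub>R x + H *v (matrix_inv \<phi>12 *v (\<Sigma>0 *v (Y *v x)))" for x
    by (simp add: D_def Y_def matrix_vector_expand scaleR_matrix_vector_assoc[symmetric])
  have xDy: "x \<bullet> (D *v y) = (1/4) * (x \<bullet> y) + (Y *v x) \<bullet> (\<Sigma>0 *v (Y *v y))" for x y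
    by (simp add: D inner_add_right Hsym[symmetric] inner_matrix_transpose[of "H *v x"] Y_def matrix_vector_expand)
  have "pos_semidef D"
    unfolding pos_semidef_def symmetric_matrix_iff_self_adjoint
  proof (intro conjI allI)
    fix x y
    show "x \<bullet> (D *v y) = (D *v x) \<bullet> y"
    proof -
      have "(Y *v x) \<bullet> (\<Sigma>0 *v (Y *v y)) = (Y *v y) \<bullet> (\<Sigma>0 *v (Y *v x))"
        by (metis \<Sigma>0_pd inner_commute pos_def_def self_adjointD)
      then show ?thesis
        unfolding inner_commute[of "D *v x"] xDy inner_commute[of x y] by simp
    qed
    show "0 \<le> x \<bullet> (D *v x)"
      using pos_def_imp_pos_semidef[OF \<Sigma>0_pd] by (simp add: xDy pos_semidef_def)
  qed
  then have rD: "pos_semidef (msqrt D)" "msqrt D ** msqrt D = D"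
    by (rule msqrt)+
  have "pos_semidef Z"
    unfolding pos_semidef_def symmetric_matrix_iff_self_adjoint
  proof (intro conjI allI)
    fix x y
    have Zxy: "x \<bullet> (Z *v y) = (Hi *v x) \<bullet> (msqrt D *v (Hi *v y))" for x y
      by (simp add: Z_def matrix_vector_expand Hi_sym)
    show "x \<bullet> (Z *v y) = (Z *v x) \<bullet> y"
      unfolding inner_commute[of "Z *v x"] Zxy
      using rD(1) by (metis inner_commute pos_semidef_def self_adjointD)
    show "0 \<le> x \<bullet> (Z *v x)"
      unfolding Zxy using rD(1) by (simp add: pos_semidef_def)
  qed
  moreover have "Z *v (\<Sigma>N *v (Z *v v)) = (1/4) *\<^sub>R (matrix_inv \<Sigma>N *v v)
        + matrix_inv \<phi>12 *v (\<Sigma>0 *v (transpose (matrix_inv \<phi>12) *v v))" for v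
  proof -
    have "Z *v (\<Sigma>N *v (Z *v v)) = Hi *v (D *v (Hi *v v))"
    proof -
      have "msqrt D *v (msqrt D *v w) = D *v w" for w
        by (simp only: matrix_vector_mul_assoc rD(2))
      then show ?thesis
        by (simp add: Z_def H(2)[symmetric] matrix_vector_expand HHi)
    qed
    then show ?thesis
      by (simp add: D matrix_vector_expand \<Sigma>Ni Y_def HHi matrix_vector_mult_scaleR)
  qed
  moreover have "P N = - min_energy + Z + (1/2) *\<^sub>R matrix_inv \<Sigma>N"
    by (simp add: terminal riccati_terminal_def Let_def Z_def Hi_def D_def H_def)
  ultimately show ?thesis using that by blast
qed

text \<open>The matrix \<open>P N + min_energy\<close> is the \<open>W = Z + \<Sigma>N\<^sup>-\<^sup>1 / 2\<close> of the introductory text.\<close>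

lemma terminal_sum_pos_def: "pos_def (P N + min_energy)"
proof -
  obtain Z where Z: "P N = - min_energy + Z + (1/2) *\<^sub>R matrix_inv \<Sigma>N" "pos_semidef Z"
    using terminal_root by metis
  have eq: "P N + min_energy = Z + (1/2) *\<^sub>R matrix_inv \<Sigma>N" by (simp add: Z(1))
  show ?thesis
    unfolding pos_def_def symmetric_matrix_iff_self_adjoint
  proof (intro conjI allI impI)
    have Wxy: "x \<bullet> ((P N + min_energy) *v y) = x \<bullet> (Z *v y) + (1/2) * (x \<bullet> (matrix_inv \<Sigma>N *v y))" for x y
      by (simp add: eq matrix_vector_mult_add_rdistrib scaleR_matrix_vector_assoc[symmetric] inner_add_right)
    fix x y :: "real^'n"
    have "x \<bullet> (Z *v y) = y \<bullet> (Z *v x)" "x \<bullet> (matrix_inv \<Sigma>N *v y) = y \<bullet> (matrix_inv \<Sigma>N *v x)"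
      using Z(2) pos_def_matrix_inv[OF \<Sigma>N_pd]
      by (metis inner_commute pos_semidef_def self_adjointD, metis inner_commute pos_def_def self_adjointD)
    then show "x \<bullet> ((P N + min_energy) *v y) = ((P N + min_energy) *v x) \<bullet> y"
      unfolding inner_commute[of _ y] Wxy by simp
    assume "x \<noteq> 0"
    then show "0 < x \<bullet> ((P N + min_energy) *v x)"
      unfolding Wxy using Z(2) pos_def_matrix_inv[OF \<Sigma>N_pd]
      by (intro add_nonneg_pos) (auto simp: pos_semidef_def pos_def_def)
  qed
qed

lemma symmetric_PN: "symmetric_matrix (P N)"
proof -
  have "x \<bullet> ((P N + min_energy) *v y) = ((P N + min_energy) *v x) \<bullet> y"
    "x \<bullet> (min_energy *v y) = (min_energy *v x) \<bullet> y" for x y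
    using terminal_sum_pos_def symmetric_min_energy[OF inv_\<phi>12]
    by (simp_all only: pos_def_def symmetric_matrix_iff_self_adjoint)
  then have "x \<bullet> (P N *v y) = (P N *v x) \<bullet> y" for x y
    unfolding matrix_vector_mult_add_rdistrib inner_add_left inner_add_right by (metis add_right_imp_eq)
  then show ?thesis
    by (simp add: symmetric_matrix_iff_self_adjoint)
qed

text \<open>Since \<open>(Z - \<Sigma>N\<^sup>-\<^sup>1 / 2) \<Sigma>N (Z + \<Sigma>N\<^sup>-\<^sup>1 / 2) = Z \<Sigma>N Z - \<Sigma>N\<^sup>-\<^sup>1 / 4\<close>, the equation for \<open>Z\<close>
  is a factorisation of \<open>\<Sigma>0\<close>.\<close>

lemma terminal_factorization:
  "\<phi>12 *v ((P N + min_energy - matrix_inv \<Sigma>N) *v (\<Sigma>N *v ((P N + min_energy)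
      *v (transpose \<phi>12 *v v)))) = \<Sigma>0 *v v"
proof -
  obtain Z where Z: "P N = - min_energy + Z + (1/2) *\<^sub>R matrix_inv \<Sigma>N"
    and ZZ: "\<And>v. Z *v (\<Sigma>N *v (Z *v v)) = (1/4) *\<^sub>R (matrix_inv \<Sigma>N *v v)
        + matrix_inv \<phi>12 *v (\<Sigma>0 *v (transpose (matrix_inv \<phi>12) *v v))"
    using terminal_root by metis
  note i = matrix_inv_vector_mul[OF pos_def_invertible[OF \<Sigma>N_pd]]
  have eq: "P N + min_energy = Z + (1/2) *\<^sub>R matrix_inv \<Sigma>N" by (simp add: Z)
  have eq': "P N + min_energy - matrix_inv \<Sigma>N = Z - (1/2) *\<^sub>R matrix_inv \<Sigma>N"
    unfolding eq using scaleR_add_left[of "1/2" "1/2" "matrix_inv \<Sigma>N"] by (simp add: algebra_simps)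
  have "(Z - (1/2) *\<^sub>R matrix_inv \<Sigma>N) *v (\<Sigma>N *v ((Z + (1/2) *\<^sub>R matrix_inv \<Sigma>N) *v v))
      = matrix_inv \<phi>12 *v (\<Sigma>0 *v (transpose (matrix_inv \<phi>12) *v v))" for v
    by (simp add: matrix_vector_expand scaleR_matrix_vector_assoc[symmetric] matrix_vector_mult_scaleR i ZZ scaleR_right_diff_distrib)
  moreover have "transpose (matrix_inv \<phi>12) *v (transpose \<phi>12 *v v) = v"
    using arg_cong[OF matrix_inv_mul(1)[OF inv_\<phi>12], of transpose]
    by (simp add: matrix_transpose_mul matrix_vector_mul_assoc)
  ultimately show ?thesis
    unfolding eq' unfolding eq by (simp add: matrix_inv_vector_mul[OF inv_\<phi>12])
qed

text \<open>The value \<open>w \<bullet> (R k *v w)\<close> is the total cost of the trajectory that rests at \<open>0\<close> up to time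
  \<open>k\<close>, then applies \<open>w\<close>, then the optimal feedback. By the bound on the energy from \<open>0\<close> to its
  endpoint \<open>a\<close>, this cost is at least \<open>a \<bullet> ((P N + min_energy) *v a)\<close>; if \<open>a = 0\<close>, it is at least
  \<open>w \<bullet> w\<close>.\<close>

lemma control_hessian_step:
  assumes k: "k < N"
    and sym: "\<And>j. j \<in> {Suc k..N} \<Longrightarrow> symmetric_matrix (P j)"
    and inv: "\<And>j. j \<in> {Suc k..<N} \<Longrightarrow> invertible (R j)"
  shows "pos_def (R k)"
  unfolding pos_def_def
proof (intro conjI allI impI)
  show "symmetric_matrix (R k)"
    using k by (intro symmetric_control_hessian sym) auto
  fix w :: "real^'m" assume w: "w \<noteq> 0"
  \<comment> \<open>before time \<open>k\<close> the feedback acts on the state \<open>0\<close>, so that the control vanishes\<close>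
  define g where "g j x = (if j = k then w else - (F j *v x))" for j x
  define x where "x = rec_nat 0 (\<lambda>j x. Ab j *v x + B j *v g j x)"
  define u where "u j = g j (x j)" for j
  define c where "c j = x j \<bullet> (Qb j *v x j) + u j \<bullet> u j" for j
  have x0: "x 0 = 0" and xS: "x (Suc j) = Ab j *v x j + B j *v u j" for j
    by (simp_all add: x_def u_def)
  have c0: "0 \<le> c j" if "j < N" for j
    using that by (simp add: c_def Qb_psd)
  have rest: "x j = 0" if "j \<le> k" for j
    using that by (induction j) (simp_all add: x0 xS u_def g_def)
  have uk: "u k = w" by (simp add: u_def g_def)
  have ck: "c k = w \<bullet> w" by (simp add: c_def rest uk)
  have total: "(\<Sum>i<j. c i) + x j \<bullet> (P j *v x j) = w \<bullet> (R k *v w)" if "Suc k \<le> j" "j \<le> N" for j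
    using that
  proof (induction j rule: dec_induct)
    case base
    have "(\<Sum>i<k. c i) = 0"
      by (intro sum.neutral) (auto simp: c_def rest u_def g_def)
    then show ?case
      using k by (simp add: ck xS rest uk control_hessian_vector inner_add_right
          inner_matrix_transpose[of w "transpose _"])
  next
    case (step j)
    have "j < N" using step.prems by simp
    have "c j + x (Suc j) \<bullet> (P (Suc j) *v x (Suc j)) = x j \<bullet> (riccati_step A B Q S j (P (Suc j)) *v x j)"
      using riccati_step_complete_square[of "P (Suc j)" B j "x j" Q S "u j" A]
        sym[of "Suc j"] inv[of j] step.hyps step.prems
      by (simp add: c_def xS u_def g_def)
    then show ?case
      using step riccati[OF \<open>j < N\<close>] by simp
  qed
  have "controlled x u" by (simp add: controlled_def xS)
  from min_energy_le[OF inv_\<phi>12 this x0]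
  have "x N \<bullet> (min_energy *v x N) \<le> (\<Sum>i<N. c i)" by (simp add: c_def)
  then have lower: "x N \<bullet> ((P N + min_energy) *v x N) \<le> w \<bullet> (R k *v w)"
    using total[of N] k by (simp add: matrix_vector_expand inner_add_right)
  show "0 < w \<bullet> (R k *v w)"
  proof (cases "x N = 0")
    case True
    have "c k \<le> (\<Sum>i<N. c i)"
      using k c0 by (intro member_le_sum) auto
    moreover have "(\<Sum>i<N. c i) = w \<bullet> (R k *v w)"
      using total[of N] k True by simp
    moreover have "0 < w \<bullet> w" using w by simp
    ultimately show ?thesis using ck by linarith
  next
    case False
    then have "0 < x N \<bullet> ((P N + min_energy) *v x N)"
      using terminal_sum_pos_def unfolding pos_def_def by blast
    then show ?thesis using lower by linarith
  qed
qed

text \<open>Symmetry and definiteness go backwards in time together: the test trajectory at time \<open>k\<close> uses the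
  feedback at all later times.\<close>

lemma symmetric_and_hessian_pos_def:
  assumes "k \<le> N"
  shows "(\<forall>j\<in>{k..N}. symmetric_matrix (P j)) \<and> (\<forall>j\<in>{k..<N}. pos_def (R j))"
  using assms
proof (induction rule: inc_induct)
  case base
  then show ?case using symmetric_PN by simp
next
  case (step k)
  have k: "k < N" by fact
  have R: "pos_def (R k)"
    using step by (intro control_hessian_step) (auto intro: pos_def_invertible)
  have "symmetric_matrix (P (Suc k))" using step by auto
  then have "symmetric_matrix (P k)"
    unfolding riccati[OF k] using k R
    by (intro symmetric_riccati_step Qb_sym pos_def_invertible)
  moreover have "{k..N} = insert k {Suc k..N}" "{k..<N} = insert k {Suc k..<N}"
    using k by auto
  ultimately show ?case using step.IH R by auto
qed

lemma symmetric_P: "k \<le> N \<Longrightarrow> symmetric_matrix (P k)"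
  using symmetric_and_hessian_pos_def[of k] by auto

lemma R_pos_def: "k < N \<Longrightarrow> pos_def (R k)"
  using symmetric_and_hessian_pos_def[of k] by auto

lemma R_invertible: "k < N \<Longrightarrow> invertible (R k)"
  by (rule pos_def_invertible[OF R_pos_def])

lemma T_invertible: "k < N \<Longrightarrow> invertible (T k)"
  by (intro closed_loop_invertible R_invertible Abar_invertible)


section \<open>The covariance of the closed loop\<close>

primrec closed_loop_cov :: "nat \<Rightarrow> real^'n^'n" where
  "closed_loop_cov 0 = \<Sigma>0"
| "closed_loop_cov (Suc k) = T k ** closed_loop_cov k ** transpose (T k)
     + B k ** matrix_inv (R k) ** transpose (B k)"

text \<open>Along a Hamiltonian trajectory, the defect \<open>P k *v x k - y k\<close> of the feedback law is
  transported by the adjoint of the closed loop and drives the state.\<close>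

lemma hamiltonian_defect:
  assumes h: "hamiltonian x y" and k: "k < N"
  defines "s \<equiv> \<lambda>k. P k *v x k - y k"
  shows "s k = transpose (T k) *v s (Suc k)"
    and "x (Suc k) = T k *v x k + B k *v (matrix_inv (R k) *v (transpose (B k) *v s (Suc k)))"
proof -
  note R = R_invertible[OF k]
  have symP: "symmetric_matrix (P (Suc k))" using k by (simp add: symmetric_P)
  have x: "x (Suc k) = Ab k *v x k - B k *v (transpose (B k) *v y (Suc k))"
    and y: "y k = Qb k *v x k + transpose (Ab k) *v y (Suc k)"
    using h k by (auto simp: hamiltonian_def controlled_def costate_def)
  let ?r = "matrix_inv (R k) *v (transpose (B k) *v s (Suc k))"
  let ?e = "F k *v x k - transpose (B k) *v y (Suc k)"
  have "R k *v ?e = transpose (B k) *v s (Suc k)"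
    unfolding matrix_vector_mult_diff_distrib control_hessian_gain[OF R] s_def x
    by (simp add: control_hessian_vector matrix_vector_expand)
  then have e: "?r = ?e"
    using matrix_inv_vector_mul(2)[OF R, of ?e] by simp
  show x': "x (Suc k) = T k *v x k + B k *v ?r"
    unfolding e by (simp add: x closed_loop_vector matrix_vector_expand)
  have FT: "transpose (F k) *v (transpose (B k) *v v)
      = transpose (Ab k) *v (P (Suc k) *v (B k *v (matrix_inv (R k) *v (transpose (B k) *v v))))" for v
  proof -
    have "z \<bullet> (transpose (F k) *v (transpose (B k) *v v))
      = z \<bullet> (transpose (Ab k) *v (P (Suc k) *v (B k *v (matrix_inv (R k) *v (transpose (B k) *v v)))))" for z
    proof -
      have "z \<bullet> (transpose (F k) *v (transpose (B k) *v v)) = (F k *v z) \<bullet> (transpose (B k) *v v)"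
        by (simp add: inner_matrix_transpose[of z])
      also have "\<dots> = (transpose (B k) *v (P (Suc k) *v (Ab k *v z))) \<bullet> (matrix_inv (R k) *v (transpose (B k) *v v))"
        using self_adjointD[OF symmetric_matrix_inv[OF R symmetric_control_hessian[OF symP]]]
        by (simp add: feedback_gain_def matrix_vector_expand)
      also have "\<dots> = z \<bullet> (transpose (Ab k) *v (P (Suc k) *v (B k *v (matrix_inv (R k) *v (transpose (B k) *v v)))))"
        by (simp add: inner_matrix_transpose[of z] inner_matrix_transpose[of _ "B k"]
            self_adjointD[OF symP, symmetric])
      finally show ?thesis .
    qed
    then show ?thesis by (metis vector_eq_ldot)
  qed
  have TT: "transpose (T k) *v v = transpose (Ab k) *v v - transpose (F k) *v (transpose (B k) *v v)" for v
  proof -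
    have "z \<bullet> (transpose (T k) *v v) = z \<bullet> (transpose (Ab k) *v v - transpose (F k) *v (transpose (B k) *v v))" for z
      by (simp add: inner_matrix_transpose[of z] inner_diff_right closed_loop_vector inner_diff_left
          inner_matrix_transpose[of _ "transpose (B k)"])
    then show ?thesis by (metis vector_eq_ldot)
  qed
  have "s k = transpose (Ab k) *v (P (Suc k) *v (T k *v x k) - y (Suc k))"
    by (simp add: s_def riccati[OF k] riccati_step_vector y matrix_vector_expand)
  also have "T k *v x k = x (Suc k) - B k *v ?r"
    by (simp add: x')
  finally show "s k = transpose (T k) *v s (Suc k)"
    by (simp add: TT FT) (simp add: s_def matrix_vector_expand)
qed

text \<open>The trajectories with \<open>y N = P N *v x N\<close> have no defect, so they follow the closed loop, and their
  initial states are \<open>\<phi>12 W c\<close> for arbitrary final states \<open>c\<close>. Pairing them with the given trajectory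
  determines its initial defect.\<close>

lemma defect_initial:
  assumes h: "hamiltonian x y" and yN: "y N = P N *v x N - matrix_inv \<Sigma>N *v x N"
    and x0: "x 0 = \<phi>11 *v x N + \<phi>12 *v y N"
  shows "\<Sigma>0 *v (P 0 *v x 0 - y 0) = x 0"
proof -
  define s where "s k = P k *v x k - y k" for k
  let ?W = "P N + min_energy"
  have W: "(?W *v a) \<bullet> b = a \<bullet> (?W *v b)" for a b
    using terminal_sum_pos_def by (simp add: pos_def_def self_adjointD)
  have \<phi>: "\<phi>11 *v c = \<phi>12 *v (min_energy *v c)" for c
    by (simp add: matrix_vector_expand matrix_inv_vector_mul[OF inv_\<phi>12])
  have "c \<bullet> (?W *v (transpose \<phi>12 *v s 0)) = c \<bullet> s N" for c
  proof -
    obtain x' y' where h': "hamiltonian x' y'" and ends: "x' N = c" "y' N = P N *v c"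
      "x' 0 = \<phi>11 *v c + \<phi>12 *v (P N *v c)"
      by (rule hamiltonian_exists)
    have zero: "P k *v x' k - y' k = 0" if "k \<le> N" for k
      using that
    proof (induction rule: inc_induct)
      case (step k)
      then show ?case using hamiltonian_defect(1)[OF h', of k] by simp
    qed (simp add: ends)
    have T: "x' (Suc k) = T k *v x' k" if "k < N" for k
      using hamiltonian_defect(2)[OF h' that] zero[of "Suc k"] that by simp
    have "x' 0 \<bullet> s 0 = x' k \<bullet> s k" if "k \<le> N" for k
      using that
    proof (induction k)
      case (Suc k)
      then have k: "k < N" by simp
      then show ?case
        using Suc hamiltonian_defect(1)[OF h k]
        by (simp add: T s_def inner_matrix_transpose[of "x' k"])
    qed simp
    moreover have "x' 0 = \<phi>12 *v (?W *v c)"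
      by (simp only: ends \<phi> matrix_vector_right_distrib matrix_vector_mult_add_rdistrib add.commute)
    moreover have "(\<phi>12 *v (?W *v c)) \<bullet> s 0 = c \<bullet> (?W *v (transpose \<phi>12 *v s 0))"
      by (simp only: W[symmetric] inner_matrix_transpose[of _ "transpose _"] transpose_transpose)
    ultimately show ?thesis by (metis ends(1) order_refl)
  qed
  then have "?W *v (transpose \<phi>12 *v s 0) = s N" by (metis vector_eq_ldot)
  also have "\<dots> = matrix_inv \<Sigma>N *v x N" by (simp add: s_def yN)
  finally have "\<Sigma>0 *v s 0 = \<phi>12 *v ((?W - matrix_inv \<Sigma>N) *v x N)"
    using terminal_factorization[of "s 0"]
    by (simp add: matrix_inv_vector_mul[OF pos_def_invertible[OF \<Sigma>N_pd]])
  also have "\<dots> = x 0"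
    unfolding x0 yN \<phi> matrix_vector_right_distrib[symmetric]
    by (simp only: matrix_vector_mult_add_rdistrib matrix_vector_mult_diff_rdistrib)
      (simp only: algebra_simps)
  finally show ?thesis by (simp add: s_def)
qed

text \<open>For the trajectories that end with defect \<open>matrix_inv \<Sigma>N *v x N\<close>, the covariance maps the
  defect to the state at time \<open>0\<close>, hence at all times, in particular at time \<open>N\<close>.\<close>

theorem closed_loop_cov_final: "closed_loop_cov N = \<Sigma>N"
proof -
  note i = matrix_inv_vector_mul[OF pos_def_invertible[OF \<Sigma>N_pd]]
  have "closed_loop_cov N *v (matrix_inv \<Sigma>N *v a) = a" for a
  proof -
    obtain x y where h: "hamiltonian x y" and ends: "x N = a" "y N = P N *v a - matrix_inv \<Sigma>N *v a"
      "x 0 = \<phi>11 *v a + \<phi>12 *v (P N *v a - matrix_inv \<Sigma>N *v a)"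
      by (rule hamiltonian_exists)
    have "closed_loop_cov k *v (P k *v x k - y k) = x k" if "k \<le> N" for k
      using that
    proof (induction k)
      case 0
      then show ?case using defect_initial[OF h] ends by simp
    next
      case (Suc k)
      then have k: "k < N" by simp
      let ?s = "P (Suc k) *v x (Suc k) - y (Suc k)"
      have "closed_loop_cov (Suc k) *v ?s = T k *v (closed_loop_cov k *v (transpose (T k) *v ?s))
          + B k *v (matrix_inv (R k) *v (transpose (B k) *v ?s))"
        by (simp only: closed_loop_cov.simps matrix_vector_mult_add_rdistrib matrix_vector_mul_assoc matrix_mul_assoc)
      also have "transpose (T k) *v ?s = P k *v x k - y k"
        using hamiltonian_defect(1)[OF h k] by simp
      finally show ?case
        using Suc hamiltonian_defect(2)[OF h k] by simp
    qed
    from this[of N] show ?thesis by (simp add: ends)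
  qed
  from this[of "\<Sigma>N *v _"] show ?thesis by (simp add: matrix_eq i)
qed

lemma closed_loop_cov_pos_def: "k \<le> N \<Longrightarrow> pos_def (closed_loop_cov k)"
proof (induction k)
  case 0
  then show ?case by (simp add: \<Sigma>0_pd)
next
  case (Suc k)
  then have C: "pos_def (closed_loop_cov k)" and k: "k < N" by auto
  have Ri: "pos_def (matrix_inv (R k))"
    by (intro pos_def_matrix_inv R_pos_def k)
  have form: "v \<bullet> (closed_loop_cov (Suc k) *v w)
      = (transpose (T k) *v v) \<bullet> (closed_loop_cov k *v (transpose (T k) *v w))
        + (transpose (B k) *v v) \<bullet> (matrix_inv (R k) *v (transpose (B k) *v w))" for v w
  proof -
    have "closed_loop_cov (Suc k) *v w = T k *v (closed_loop_cov k *v (transpose (T k) *v w))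
          + B k *v (matrix_inv (R k) *v (transpose (B k) *v w))"
      by (simp only: closed_loop_cov.simps matrix_vector_mult_add_rdistrib matrix_vector_mul_assoc matrix_mul_assoc)
    then show ?thesis by (simp only: inner_add_right inner_matrix_transpose[of v])
  qed
  show ?case
    unfolding pos_def_def symmetric_matrix_iff_self_adjoint
  proof (intro conjI allI impI)
    fix v w :: "real^'n"
    have "(transpose (T k) *v v) \<bullet> (closed_loop_cov k *v (transpose (T k) *v w))
        = (transpose (T k) *v w) \<bullet> (closed_loop_cov k *v (transpose (T k) *v v))"
      "(transpose (B k) *v v) \<bullet> (matrix_inv (R k) *v (transpose (B k) *v w))
        = (transpose (B k) *v w) \<bullet> (matrix_inv (R k) *v (transpose (B k) *v v))"
      using C Ri by (metis inner_commute pos_def_def self_adjointD)+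
    then show "v \<bullet> (closed_loop_cov (Suc k) *v w) = (closed_loop_cov (Suc k) *v v) \<bullet> w"
      unfolding inner_commute[of _ w] form by simp
    assume v: "v \<noteq> 0"
    have "invertible (transpose (T k))"
      using T_invertible[OF k] by (simp add: invertible_det_nz)
    then have "transpose (T k) *v v \<noteq> 0"
      using v by (auto simp: invertible_iff_ker)
    then show "0 < v \<bullet> (closed_loop_cov (Suc k) *v v)"
      unfolding form using C pos_def_imp_pos_semidef[OF Ri]
      by (intro add_pos_nonneg) (auto simp: pos_semidef_def pos_def_def)
  qed
qed

end

section \<open>Linear changes of variables\<close>

lemma nn_integral_lborel_translate:
  fixes c :: "'a::euclidean_space"
  assumes [measurable]: "f \<in> borel_measurable borel"
  shows "(\<integral>\<^sup>+x. f (c + x) \<partial>lborel) = (\<integral>\<^sup>+x. f x \<partial>lborel)"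
  by (subst (2) lborel_distr_plus[of c, symmetric]) (simp add: nn_integral_distr)

lemma borel_measurable_matrix_vector [measurable (raw)]:
  assumes "f \<in> borel_measurable M"
  shows "(\<lambda>x. X *v (f x :: real^'n)) \<in> borel_measurable M"
proof -
  have "(*v) X \<in> borel_measurable borel"
    by (intro borel_measurable_continuous_onI matrix_vector_mult_linear_continuous_on)
  from measurable_compose[OF assms this] show ?thesis .
qed

lemma prod_Basis_cart:
  fixes f :: "real^'n \<Rightarrow> 'b::comm_monoid_mult"
  shows "(\<Prod>b\<in>Basis. f b) = (\<Prod>i\<in>UNIV. f (axis i 1))"
proof -
  have "Basis = range (\<lambda>i. axis i 1 :: real^'n)"
    by (auto simp: Basis_vec_def)
  moreover have "inj (\<lambda>i. axis i 1 :: real^'n)"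
    by (auto simp: inj_on_def axis_eq_axis)
  ultimately show ?thesis by (metis (no_types, lifting) comp_apply prod.cong prod.reindex)
qed

text \<open>A shear translates the coordinate \<open>m\<close> by an amount that does not depend on it.\<close>

lemma nn_integral_lborel_shear:
  fixes f :: "real^'n \<Rightarrow> ennreal"
  assumes [measurable]: "f \<in> borel_measurable borel" and mn: "m \<noteq> n"
  shows "(\<integral>\<^sup>+x. f (x + (x $ n) *\<^sub>R axis m 1) \<partial>lborel) = (\<integral>\<^sup>+x. f x \<partial>lborel)"
proof -
  interpret product_sigma_finite "\<lambda>_::real^'n. lborel :: real measure"
    by standard
  define b :: "real^'n" where "b = axis m 1"
  define r :: "(real^'n \<Rightarrow> real) \<Rightarrow> real^'n" where "r x = (\<Sum>j\<in>Basis - {b}. x j *\<^sub>R j)" for x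
  have b: "b \<in> Basis" by (simp add: b_def)
  have Basis: "Basis = insert b (Basis - {b})" using b by auto
  have upd: "(\<Sum>j\<in>Basis. (x(b := y)) j *\<^sub>R j) = y *\<^sub>R b + r x" for x y
    by (subst sum.remove[OF _ b]) (auto simp: r_def intro!: sum.cong)
  have iter: "(\<integral>\<^sup>+x. g x \<partial>lborel) = (\<integral>\<^sup>+x. \<integral>\<^sup>+y. g (y *\<^sub>R b + r x) \<partial>lborel \<partial>PiM (Basis - {b}) (\<lambda>_. lborel))"
    if [measurable]: "g \<in> borel_measurable borel" for g :: "real^'n \<Rightarrow> ennreal"
  proof -
    have "(\<integral>\<^sup>+x. g x \<partial>lborel) = (\<integral>\<^sup>+x. g (\<Sum>j\<in>Basis. x j *\<^sub>R j) \<partial>PiM Basis (\<lambda>_. lborel))"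
      by (subst lborel_def) (simp add: lborel_eq_real[symmetric] nn_integral_distr)
    also have "\<dots> = (\<integral>\<^sup>+x. g (\<Sum>j\<in>Basis. x j *\<^sub>R j) \<partial>PiM (insert b (Basis - {b})) (\<lambda>_. lborel))"
      using Basis by simp
    also have "\<dots> = (\<integral>\<^sup>+x. \<integral>\<^sup>+y. g (\<Sum>j\<in>Basis. (x(b := y)) j *\<^sub>R j) \<partial>lborel \<partial>PiM (Basis - {b}) (\<lambda>_. lborel))"
      by (rule product_nn_integral_insert) (auto simp flip: Basis)
    finally show ?thesis by (simp only: upd)
  qed
  have bn: "b $ n = 0" using mn by (simp add: b_def axis_def)
  have "(\<integral>\<^sup>+x. f (x + (x $ n) *\<^sub>R b) \<partial>lborel)
      = (\<integral>\<^sup>+x. \<integral>\<^sup>+y. f ((y *\<^sub>R b + r x) + ((y *\<^sub>R b + r x) $ n) *\<^sub>R b) \<partial>lborel \<partial>PiM (Basis - {b}) (\<lambda>_. lborel))"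
    by (rule iter) simp
  also have "\<dots> = (\<integral>\<^sup>+x. \<integral>\<^sup>+y. f ((r x $ n + y) *\<^sub>R b + r x) \<partial>lborel \<partial>PiM (Basis - {b}) (\<lambda>_. lborel))"
    by (simp add: bn algebra_simps)
  also have "\<dots> = (\<integral>\<^sup>+x. \<integral>\<^sup>+y. f (y *\<^sub>R b + r x) \<partial>lborel \<partial>PiM (Basis - {b}) (\<lambda>_. lborel))"
    using nn_integral_lborel_translate[of "\<lambda>y. f (y *\<^sub>R b + r _)"] by simp
  finally show ?thesis by (simp add: iter b_def[symmetric])
qed

lemma nn_integral_lborel_swap:
  fixes f :: "real^'n \<Rightarrow> ennreal"
  assumes [measurable]: "f \<in> borel_measurable borel"
  shows "(\<integral>\<^sup>+x. f (\<chi> i. x $ Transposition.transpose m n i) \<partial>lborel) = (\<integral>\<^sup>+x. f x \<partial>lborel)"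
proof -
  let ?t = "Transposition.transpose m n" and ?T = "\<lambda>x::real^'n. \<chi> i. x $ Transposition.transpose m n i"
  have "continuous_on UNIV ?T"
    by (intro continuous_intros)
  then have [measurable]: "?T \<in> borel_measurable borel"
    by (rule borel_measurable_continuous_onI)
  have "lborel = distr lborel borel ?T"
  proof (rule lborel_eqI)
    fix l u :: "real^'n" assume le: "\<And>b. b \<in> Basis \<Longrightarrow> l \<bullet> b \<le> u \<bullet> b"
    then have le': "l $ i \<le> u $ i" for i
      using le[of "axis i 1"] by (simp add: inner_axis)
    have "?T -` box l u = box (?T l) (?T u)"
      by (auto simp: mem_box_cart) (metis transpose_involutory)+
    then have "emeasure (distr lborel borel ?T) (box l u) = emeasure lborel (box (?T l) (?T u))"
      by (simp add: emeasure_distr)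
    also have "\<dots> = ennreal (\<Prod>i\<in>UNIV. (u - l) $ ?t i)"
    proof -
      have "?T l \<bullet> b \<le> ?T u \<bullet> b" if "b \<in> Basis" for b
        using that le' by (auto simp: Basis_vec_def inner_axis)
      then show ?thesis
        by (subst emeasure_lborel_box) (auto simp: prod_Basis_cart inner_axis)
    qed
    also have "(\<Prod>i\<in>UNIV. (u - l) $ ?t i) = (\<Prod>i\<in>UNIV. (u - l) $ i)"
      by (rule prod.reindex_bij_betw) simp
    finally show "emeasure (distr lborel borel ?T) (box l u) = (\<Prod>b\<in>Basis. (u - l) \<bullet> b)"
      by (simp add: prod_Basis_cart inner_axis)
  qed simp
  then have "(\<integral>\<^sup>+x. f x \<partial>lborel) = (\<integral>\<^sup>+x. f x \<partial>distr lborel borel ?T)" by simp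
  then show ?thesis by (simp add: nn_integral_distr)
qed

text \<open>The formula is multiplicative in \<open>A\<close>, so elementary matrices suffice. The determinants of swaps
  and shears come from \<open>E\<^sup>2 = I\<close> and from row operations.\<close>

theorem nn_integral_lborel_linear:
  fixes f :: "real^'n \<Rightarrow> ennreal"
  assumes "f \<in> borel_measurable borel" and "det A \<noteq> 0"
  shows "ennreal \<bar>det A\<bar> * (\<integral>\<^sup>+x. f (A *v x) \<partial>lborel) = (\<integral>\<^sup>+x. f x \<partial>lborel)"
proof -
  have "det A \<noteq> 0 \<longrightarrow> (\<forall>f\<in>borel_measurable borel.
      ennreal \<bar>det A\<bar> * (\<integral>\<^sup>+x. f (A *v x) \<partial>lborel) = (\<integral>\<^sup>+x. f x \<partial>(lborel::(real^'n) measure)))"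
    (is "?P A")
  proof (rule induct_matrix_elementary_alt)
    fix A A' :: "real^'n^'n" assume "?P A" "?P A'"
    show "?P (A ** A')"
    proof (intro impI ballI)
      fix f :: "real^'n \<Rightarrow> ennreal" assume det: "det (A ** A') \<noteq> 0" and f[measurable]: "f \<in> borel_measurable borel"
      have "(\<lambda>x. f (A *v x)) \<in> borel_measurable borel" by measurable
      then have "ennreal \<bar>det A'\<bar> * (\<integral>\<^sup>+x. f (A *v (A' *v x)) \<partial>lborel) = (\<integral>\<^sup>+x. f (A *v x) \<partial>lborel)"
        using \<open>?P A'\<close> det by (auto simp: det_mul)
      moreover have "ennreal \<bar>det A\<bar> * (\<integral>\<^sup>+x. f (A *v x) \<partial>lborel) = (\<integral>\<^sup>+x. f x \<partial>lborel)"
        using \<open>?P A\<close> det f by (auto simp: det_mul)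
      ultimately show "ennreal \<bar>det (A ** A')\<bar> * (\<integral>\<^sup>+x. f (A ** A' *v x) \<partial>lborel) = (\<integral>\<^sup>+x. f x \<partial>lborel)"
        by (simp add: det_mul abs_mult ennreal_mult matrix_vector_mul_assoc[symmetric] mult.assoc)
    qed
  next
    fix A :: "real^'n^'n" and i assume "row i A = 0"
    then show "?P A" using det_zero_row(2) by blast
  next
    fix A :: "real^'n^'n" assume diag: "\<And>i j. i \<noteq> j \<Longrightarrow> A $ i $ j = 0"
    show "?P A"
    proof (intro impI ballI)
      fix f :: "real^'n \<Rightarrow> ennreal" assume det: "det A \<noteq> 0" and [measurable]: "f \<in> borel_measurable borel"
      have detA: "det A = (\<Prod>i\<in>UNIV. A $ i $ i)" by (rule det_diagonal) (rule diag)
      define c where "c b = b \<bullet> (A *v b)" for b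
      have Aaxis: "A *v axis j 1 = A $ j $ j *\<^sub>R axis j 1" for j
      proof -
        have "(A *v axis j 1) $ i = A $ i $ j" for i
          by (simp add: matrix_vector_mult_def axis_def if_distrib cong: if_cong)
        then show ?thesis
          using diag by (auto simp: vec_eq_iff axis_def)
      qed
      then have caxis: "c (axis i 1) = A $ i $ i" for i
        by (simp add: c_def inner_axis_axis)
      have c: "c b \<noteq> 0" if "b \<in> Basis" for b
        using that det by (auto simp: Basis_vec_def caxis detA)
      have T: "(\<Sum>b\<in>Basis. (c b * (x \<bullet> b)) *\<^sub>R b) = A *v x" for x
      proof -
        have "A *v x = A *v (\<Sum>b\<in>Basis. (x \<bullet> b) *\<^sub>R b)" by (simp add: euclidean_representation)
        also have "\<dots> = (\<Sum>b\<in>Basis. (x \<bullet> b) *\<^sub>R (A *v b))"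
          by (simp add: linear_sum[OF matrix_vector_mul_linear] linear_scale[OF matrix_vector_mul_linear])
        also have "\<dots> = (\<Sum>b\<in>Basis. (c b * (x \<bullet> b)) *\<^sub>R b)"
          by (intro sum.cong) (auto simp: Basis_vec_def Aaxis caxis)
        finally show ?thesis ..
      qed
      have "lborel = density (distr lborel borel ((*v) A)) (\<lambda>_. (\<Prod>b\<in>Basis. \<bar>c b\<bar>))"
        using lborel_affine_euclidean[of c 0] c by (simp add: T)
      then have "(\<integral>\<^sup>+x. f x \<partial>lborel)
          = (\<integral>\<^sup>+x. f x \<partial>density (distr lborel borel ((*v) A)) (\<lambda>_. (\<Prod>b\<in>Basis. \<bar>c b\<bar>)))"
        by simp
      then show "ennreal \<bar>det A\<bar> * (\<integral>\<^sup>+x. f (A *v x) \<partial>lborel) = (\<integral>\<^sup>+x. f x \<partial>lborel)"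
        by (simp add: nn_integral_density nn_integral_cmult nn_integral_distr prod_Basis_cart caxis detA abs_prod)
    qed
  next
    fix m n :: 'n assume "m \<noteq> n"
    let ?E = "(\<chi> i j. mat 1 $ i $ Transposition.transpose m n j) :: real^'n^'n"
    have E: "?E *v x = (\<chi> i. x $ Transposition.transpose m n i)" for x
    proof -
      have "(\<Sum>j\<in>UNIV. mat 1 $ i $ Transposition.transpose m n j * x $ j)
          = (\<Sum>j\<in>UNIV. mat 1 $ i $ j * x $ Transposition.transpose m n j)" for i
        by (rule sum.reindex_bij_witness[of _ "Transposition.transpose m n" "Transposition.transpose m n"]) auto
      then show ?thesis
        by (simp add: vec_eq_iff matrix_vector_mult_def mat_def if_distrib[of "\<lambda>x. x * y" for y] cong: if_cong)
    qed
    have "?E ** ?E = mat 1"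
      by (simp add: matrix_eq matrix_vector_mul_assoc[symmetric] E)
    then have "det ?E * det ?E = 1"
      by (metis det_I det_mul)
    then have "\<bar>det ?E\<bar> = 1"
      unfolding abs_square_eq_1[symmetric] power2_eq_square .
    note abs_det = this
    show "?P ?E"
    proof (intro impI ballI)
      fix f :: "real^'n \<Rightarrow> ennreal" assume "f \<in> borel_measurable borel"
      from nn_integral_lborel_swap[OF this]
      show "ennreal \<bar>det ?E\<bar> * (\<integral>\<^sup>+x. f (?E *v x) \<partial>lborel) = (\<integral>\<^sup>+x. f x \<partial>lborel)"
        unfolding E abs_det by simp
    qed
  next
    fix m n :: 'n assume mn: "m \<noteq> n"
    let ?E = "(\<chi> i j. of_bool (i = m \<and> j = n \<or> i = j)) :: real^'n^'n"
    have E: "?E *v x = x + (x $ n) *\<^sub>R axis m 1" for x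
    proof -
      have "(?E *v x) $ i = (x + (x $ n) *\<^sub>R axis m 1) $ i" for i
      proof -
        have "(?E *v x) $ i = (\<Sum>j\<in>UNIV. of_bool (i = m \<and> j = n \<or> i = j) * x $ j)"
          by (simp only: matrix_vector_mult_def vec_lambda_beta)
        also have "\<dots> = (\<Sum>j\<in>UNIV. (if j = n then if i = m then x $ n else 0 else 0) + (if i = j then x $ i else 0))"
          using mn by (intro sum.cong refl) (simp only: of_bool_def; auto)
        also have "\<dots> = (x + (x $ n) *\<^sub>R axis m 1) $ i"
          by (simp add: sum.distrib axis_def)
        finally show ?thesis .
      qed
      then show ?thesis by (simp only: vec_eq_iff) blast
    qed
    have "?E = (\<chi> k. if k = m then row m (mat 1) + 1 *s row n (mat 1) else row k (mat 1))"
      using mn by (auto simp: vec_eq_iff row_def mat_def)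
    then have det: "det ?E = 1"
      by (simp only: det_row_operation[OF mn] det_I)
    show "?P ?E"
    proof (intro impI ballI)
      fix f :: "real^'n \<Rightarrow> ennreal" assume "f \<in> borel_measurable borel"
      from nn_integral_lborel_shear[OF this mn]
      show "ennreal \<bar>det ?E\<bar> * (\<integral>\<^sup>+x. f (?E *v x) \<partial>lborel) = (\<integral>\<^sup>+x. f x \<partial>lborel)"
        unfolding E det by simp
    qed
  qed
  from mp[OF this assms(2), rule_format, OF assms(1)] show ?thesis .
qed

section \<open>Gaussian densities\<close>

lemma std_gaussian_integral:
  "(\<integral>\<^sup>+v. ennreal (exp (- (1/2) * (v \<bullet> v))) \<partial>(lborel :: (real^'n) measure))
    = ennreal (sqrt ((2 * pi) ^ CARD('n)))"
proof -
  have "(\<integral>\<^sup>+x. ennreal (std_normal_density x) \<partial>lborel) = 1"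
    by (simp add: nn_integral_eq_integral normal_density_nonneg)
  moreover have "ennreal (exp (- (1/2) * x\<^sup>2)) = ennreal (sqrt (2 * pi)) * ennreal (std_normal_density x)" for x
    by (simp add: std_normal_density_def ennreal_mult[symmetric])
  ultimately have one: "(\<integral>\<^sup>+x. ennreal (exp (- (1/2) * x\<^sup>2)) \<partial>lborel) = ennreal (sqrt (2 * pi))"
    by (simp add: nn_integral_cmult)
  have "ennreal (exp (- (1/2) * (v \<bullet> v))) = (\<Prod>b\<in>Basis. ennreal (exp (- (1/2) * (v \<bullet> b)\<^sup>2)))" for v :: "real^'n"
  proof -
    have "v \<bullet> v = (\<Sum>b\<in>Basis. (v \<bullet> b)\<^sup>2)"
      by (subst euclidean_inner) (simp add: power2_eq_square)
    then show ?thesis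
      by (simp add: prod_ennreal exp_sum sum_distrib_left)
  qed
  then have "(\<integral>\<^sup>+v. ennreal (exp (- (1/2) * (v \<bullet> v))) \<partial>(lborel :: (real^'n) measure))
      = (\<Prod>b\<in>(Basis :: (real^'n) set). \<integral>\<^sup>+x. ennreal (exp (- (1/2) * x\<^sup>2)) \<partial>lborel)"
    by (simp only:) (rule nn_integral_lborel_prod; simp)
  also have "\<dots> = ennreal (sqrt (2 * pi)) ^ CARD('n)"
    unfolding one by simp
  also have "\<dots> = ennreal (sqrt ((2 * pi) ^ CARD('n)))"
    unfolding real_sqrt_power by (rule ennreal_power) simp
  finally show ?thesis .
qed

lemma pos_def_det_pos: "pos_def X \<Longrightarrow> 0 < det X"
proof -
  assume X: "pos_def X"
  then have "det X = (det (msqrt X))\<^sup>2"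
    by (metis det_mul msqrt(2) pos_def_imp_pos_semidef power2_eq_square)
  moreover have "det X \<noteq> 0"
    using pos_def_invertible[OF X] by (simp add: invertible_det_nz)
  ultimately show "0 < det X" by simp
qed

lemma pos_def_quadratic_msqrt:
  assumes "pos_def X"
  shows "(msqrt X *v w) \<bullet> (matrix_inv X *v (msqrt X *v w)) = w \<bullet> w"
proof -
  define H where "H = msqrt X"
  have H: "pos_def H" "H ** H = X"
    using assms by (auto simp: H_def intro: pos_def_msqrt msqrt pos_def_imp_pos_semidef)
  note iH = matrix_inv_vector_mul[OF pos_def_invertible[OF H(1)]]
  have "X *v (matrix_inv H *v w) = H *v w"
    by (simp add: H(2)[symmetric] matrix_vector_mul_assoc[symmetric] iH)
  then have "matrix_inv X *v (H *v w) = matrix_inv H *v w"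
    by (metis assms matrix_inv_vector_mul(2) pos_def_invertible)
  then show ?thesis
    using H(1) self_adjointD[of H w "matrix_inv H *v w"]
    by (simp add: pos_def_def iH H_def[symmetric])
qed

text \<open>The substitution \<open>v = msqrt X *v w\<close> reduces the integral to the standard Gaussian.\<close>

lemma gaussian_integral:
  assumes X: "pos_def (X :: real^'n^'n)"
  shows "(\<integral>\<^sup>+v. ennreal (exp (- (1/2) * (v \<bullet> (matrix_inv X *v v)))) \<partial>lborel)
    = ennreal (sqrt ((2 * pi) ^ CARD('n) * det X))"
proof -
  let ?H = "msqrt X"
  have det: "det X = (det ?H)\<^sup>2"
    using X by (metis det_mul msqrt(2) pos_def_imp_pos_semidef power2_eq_square)
  then have "det ?H \<noteq> 0" using pos_def_det_pos[OF X] by auto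
  then have "(\<integral>\<^sup>+v. ennreal (exp (- (1/2) * (v \<bullet> (matrix_inv X *v v)))) \<partial>lborel)
      = ennreal \<bar>det ?H\<bar> * (\<integral>\<^sup>+w. ennreal (exp (- (1/2) * ((?H *v w) \<bullet> (matrix_inv X *v (?H *v w))))) \<partial>lborel)"
    by (intro nn_integral_lborel_linear[symmetric]) auto
  also have "\<dots> = ennreal \<bar>det ?H\<bar> * ennreal (sqrt ((2 * pi) ^ CARD('n)))"
    unfolding pos_def_quadratic_msqrt[OF X] std_gaussian_integral ..
  also have "\<dots> = ennreal (sqrt ((2 * pi) ^ CARD('n) * det X))"
    by (simp add: ennreal_mult[symmetric] det real_sqrt_mult mult.commute)
  finally show ?thesis .
qed

lemma gaussian_density_pos: "pos_def X \<Longrightarrow> 0 < gaussian_density \<mu> X v"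
  by (simp add: gaussian_density_def pos_def_det_pos)

lemma borel_measurable_gaussian_density [measurable (raw)]:
  assumes [measurable]: "f \<in> borel_measurable M" "g \<in> borel_measurable M"
  shows "(\<lambda>x. gaussian_density (f x) X (g x :: real^'n)) \<in> borel_measurable M"
  unfolding gaussian_density_def by measurable

lemma gaussian_density_shift: "gaussian_density \<mu> X (\<mu> + v) = gaussian_density 0 X v"
  by (simp add: gaussian_density_def)

lemma ln_gaussian_density:
  assumes "pos_def (X :: real^'n^'n)"
  shows "ln (gaussian_density \<mu> X v)
    = - (1/2) * ((v - \<mu>) \<bullet> (matrix_inv X *v (v - \<mu>))) - (1/2) * ln ((2 * pi) ^ CARD('n) * det X)"
  using pos_def_det_pos[OF assms]
  by (simp add: gaussian_density_def ln_div ln_sqrt)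

lemma nn_integral_gaussian_density:
  assumes X: "pos_def (X :: real^'n^'n)"
  shows "(\<integral>\<^sup>+v. ennreal (gaussian_density \<mu> X v) \<partial>lborel) = 1"
proof -
  let ?Z = "sqrt ((2 * pi) ^ CARD('n) * det X)"
  have Z: "0 < ?Z" using pos_def_det_pos[OF X] by simp
  have "(\<integral>\<^sup>+v. ennreal (gaussian_density \<mu> X v) \<partial>lborel) = (\<integral>\<^sup>+v. ennreal (gaussian_density 0 X v) \<partial>lborel)"
    using nn_integral_lborel_translate[of "\<lambda>v. ennreal (gaussian_density \<mu> X v)" \<mu>]
    by (simp add: gaussian_density_shift)
  also have "\<dots> = (\<integral>\<^sup>+v. ennreal (1 / ?Z) * ennreal (exp (- (1/2) * (v \<bullet> (matrix_inv X *v v)))) \<partial>lborel)"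
    using Z by (intro nn_integral_cong) (simp add: gaussian_density_def ennreal_mult[symmetric])
  also have "\<dots> = ennreal (1 / ?Z) * ennreal ?Z"
    by (subst nn_integral_cmult) (simp_all only: gaussian_integral[OF X], measurable)
  also have "\<dots> = 1"
    using Z pos_def_det_pos[OF X] by (simp add: ennreal_mult[symmetric])
  finally show ?thesis .
qed

lemma prob_space_gaussian_density:
  "pos_def X \<Longrightarrow> prob_space (density lborel (\<lambda>v. ennreal (gaussian_density \<mu> X v)))"
  by (intro prob_spaceI) (simp add: emeasure_density nn_integral_gaussian_density)

lemma quadratic_form_bound:
  fixes X :: "real^'n^'m"
  obtains c where "0 \<le> c" "\<And>v w. \<bar>v \<bullet> (X *v w)\<bar> \<le> c * (norm v * norm w)"
proof
  have bl: "bounded_linear ((*v) X)" by simp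
  show "0 \<le> onorm ((*v) X)" by (rule onorm_pos_le[OF bl])
  fix v w
  have "\<bar>v \<bullet> (X *v w)\<bar> \<le> norm v * norm (X *v w)" by (rule Cauchy_Schwarz_ineq2)
  also have "\<dots> \<le> norm v * (onorm ((*v) X) * norm w)"
    by (intro mult_left_mono onorm[OF bl]) auto
  finally show "\<bar>v \<bullet> (X *v w)\<bar> \<le> onorm ((*v) X) * (norm v * norm w)"
    by (simp add: mult_ac)
qed

text \<open>With \<open>q v = v \<bullet> (matrix_inv X *v v)\<close>, both \<open>v \<bullet> v\<close> and \<open>q v\<close> are bounded by multiples of
  \<open>exp (q v / 4)\<close>, and \<open>exp (- q v / 4)\<close> is again a Gaussian up to normalisation.\<close>

lemma gaussian_second_moment:
  assumes X: "pos_def (X :: real^'n^'n)"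
  shows "(\<integral>\<^sup>+v. ennreal (gaussian_density 0 X v * (v \<bullet> v)) \<partial>lborel) < \<infinity>"
proof -
  define q where "q v = v \<bullet> (matrix_inv X *v v)" for v
  let ?H = "msqrt X" and ?Z = "sqrt ((2 * pi) ^ CARD('n) * det X)"
  have Z: "0 < ?Z" using pos_def_det_pos[OF X] by simp
  have iH: "invertible ?H" using X by (intro pos_def_invertible pos_def_msqrt)
  have Xq: "0 \<le> q v" for v
    using pos_def_imp_pos_semidef[OF pos_def_matrix_inv[OF X]] by (simp add: q_def pos_semidef_def)
  define c where "c = (onorm ((*v) ?H))\<^sup>2"
  have c: "v \<bullet> v \<le> c * q v" for v
  proof -
    define w where "w = matrix_inv ?H *v v"
    have v: "v = ?H *v w" by (simp add: w_def matrix_inv_vector_mul[OF iH])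
    have "norm v \<le> onorm ((*v) ?H) * norm w"
      unfolding v by (intro onorm) simp
    then have "(norm v)\<^sup>2 \<le> c * (norm w)\<^sup>2"
      by (metis c_def norm_ge_zero power_mono power_mult_distrib)
    then show ?thesis
      unfolding q_def v pos_def_quadratic_msqrt[OF X] by (simp add: power2_norm_eq_inner)
  qed
  have exp4: "q v * exp (- q v / 2) \<le> 4 * exp (- q v / 4)" for v
  proof -
    have "q v / 4 \<le> exp (q v / 4)"
      using exp_ge_add_one_self[of "q v / 4"] by linarith
    then have "q v * exp (- q v / 2) \<le> (4 * exp (q v / 4)) * exp (- q v / 2)"
      by (intro mult_right_mono) auto
    also have "\<dots> = 4 * exp (- q v / 4)"
      by (simp add: exp_add[symmetric])
    finally show ?thesis .
  qed
  have "gaussian_density 0 X v * (v \<bullet> v) \<le> (4 * c / ?Z) * exp (- q v / 4)" for v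
  proof -
    have "exp (- q v / 2) * (v \<bullet> v) \<le> exp (- q v / 2) * (c * q v)"
      by (intro mult_left_mono c) simp
    also have "\<dots> = c * (q v * exp (- q v / 2))" by simp
    also have "\<dots> \<le> c * (4 * exp (- q v / 4))"
      by (intro mult_left_mono exp4) (simp add: c_def)
    finally have "(exp (- q v / 2) * (v \<bullet> v)) / ?Z \<le> (c * (4 * exp (- q v / 4))) / ?Z"
      using Z by (intro divide_right_mono) auto
    then show ?thesis by (simp add: gaussian_density_def q_def mult_ac)
  qed
  then have "(\<integral>\<^sup>+v. ennreal (gaussian_density 0 X v * (v \<bullet> v)) \<partial>lborel)
      \<le> (\<integral>\<^sup>+v. ennreal (4 * c / ?Z) * ennreal (exp (- q v / 4)) \<partial>lborel)"
    using Z by (intro nn_integral_mono) (simp add: ennreal_mult[symmetric] c_def ennreal_leI)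
  also have "\<dots> = ennreal (4 * c / ?Z) * (\<integral>\<^sup>+v. ennreal (exp (- q v / 4)) \<partial>lborel)"
    by (rule nn_integral_cmult) (simp add: q_def)
  also have "(\<integral>\<^sup>+v. ennreal (exp (- q v / 4)) \<partial>lborel) < \<infinity>"
  proof -
    have inv2: "matrix_inv (2 *\<^sub>R X) = (1/2) *\<^sub>R matrix_inv X"
      by (rule matrix_inv_eqI)
        (simp add: scalar_matrix_assoc[symmetric] matrix_scalar_ac matrix_inv_mul[OF pos_def_invertible[OF X]])
    have "pos_def (2 *\<^sub>R X)"
      using X unfolding pos_def_def symmetric_matrix_iff_self_adjoint scaleR_matrix_vector_assoc[symmetric]
        inner_scaleR_left inner_scaleR_right by auto
    from gaussian_integral[OF this] show ?thesis
      by (simp add: inv2 q_def scaleR_matrix_vector_assoc[symmetric])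
  qed
  then have "ennreal (4 * c / ?Z) * (\<integral>\<^sup>+v. ennreal (exp (- q v / 4)) \<partial>lborel) < \<infinity>"
    by (simp add: ennreal_mult_less_top)
  finally show ?thesis .
qed

section \<open>Gaussian transition kernels\<close>

lemma gaussian_density_linear_image:
  fixes T :: "real^'n^'n"
  assumes C: "pos_def C" and T: "invertible T" and D: "D = T ** C ** transpose T"
  shows "gaussian_density 0 C x = \<bar>det T\<bar> * gaussian_density 0 D (T *v x)"
proof -
  have Tt: "invertible (transpose T)" using T by (simp add: invertible_det_nz)
  have iD: "invertible D"
    unfolding D by (intro invertible_mult T Tt pos_def_invertible C)
  have "D *v (matrix_inv (transpose T) *v (matrix_inv C *v x)) = T *v x"
    by (simp add: D matrix_vector_mul_assoc[symmetric] matrix_inv_vector_mul[OF Tt]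
        matrix_inv_vector_mul[OF pos_def_invertible[OF C]])
  then have "matrix_inv D *v (T *v x) = matrix_inv (transpose T) *v (matrix_inv C *v x)"
    by (metis iD matrix_inv_vector_mul(2))
  then have q: "(T *v x) \<bullet> (matrix_inv D *v (T *v x)) = x \<bullet> (matrix_inv C *v x)"
    by (metis Tt inner_commute inner_matrix_transpose matrix_inv_vector_mul(1))
  have "det D = (det T)\<^sup>2 * det C"
    by (simp add: D det_mul power2_eq_square)
  then have "sqrt ((2 * pi) ^ CARD('n) * det D) = \<bar>det T\<bar> * sqrt ((2 * pi) ^ CARD('n) * det C)"
    by (simp add: real_sqrt_mult)
  moreover have "det T \<noteq> 0" using T by (simp add: invertible_det_nz)
  ultimately show ?thesis
    by (simp add: gaussian_density_def q)
qed

text \<open>The exponent of the joint density of \<open>w\<close> and \<open>z = x + B w\<close>, with the square completed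
  in \<open>w\<close> around its conditional mean \<open>V B\<^sup>\<top> E\<^sup>-\<^sup>1 z\<close>.\<close>

lemma gaussian_complete_square:
  fixes B :: "real^'m^'n" and z :: "real^'n" and e :: "real^'m"
  assumes D: "pos_def D" and V: "pos_def V" and E: "pos_def E" "E = D + B ** V ** transpose B"
  defines "w \<equiv> V *v (transpose B *v (matrix_inv E *v z)) + e"
  shows "w \<bullet> (matrix_inv V *v w) + (z - B *v w) \<bullet> (matrix_inv D *v (z - B *v w))
    = z \<bullet> (matrix_inv E *v z) + (e \<bullet> (matrix_inv V *v e) + (B *v e) \<bullet> (matrix_inv D *v (B *v e)))"
proof -
  define a where "a = matrix_inv E *v z"
  note iD = matrix_inv_vector_mul[OF pos_def_invertible[OF D]]
  note iV = matrix_inv_vector_mul[OF pos_def_invertible[OF V]]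
  have z: "z = D *v a + B *v (V *v (transpose B *v a))"
    using matrix_inv_vector_mul(1)[OF pos_def_invertible[OF E(1)], of z]
    by (simp add: E(2) a_def matrix_vector_expand)
  have w: "w = V *v (transpose B *v a) + e" by (simp add: w_def a_def)
  have zw: "z - B *v w = D *v a - B *v e"
    unfolding w by (subst z) (simp add: matrix_vector_expand)
  have symV: "(matrix_inv V *v x) \<bullet> y = x \<bullet> (matrix_inv V *v y)" for x y
    using pos_def_matrix_inv[OF V] by (simp add: pos_def_def self_adjointD)
  have symD: "(matrix_inv D *v x) \<bullet> y = x \<bullet> (matrix_inv D *v y)" for x y
    using pos_def_matrix_inv[OF D] by (simp add: pos_def_def self_adjointD)
  have 1: "w \<bullet> (matrix_inv V *v w) = (V *v (transpose B *v a)) \<bullet> (transpose B *v a)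
      + 2 * ((B *v e) \<bullet> a) + e \<bullet> (matrix_inv V *v e)"
  proof -
    have "e \<bullet> (transpose B *v a) = (B *v e) \<bullet> a"
      by (simp add: inner_matrix_transpose[of e "transpose B"])
    moreover have "(V *v (transpose B *v a)) \<bullet> (matrix_inv V *v e) = e \<bullet> (transpose B *v a)"
      by (metis iV(2) inner_commute symV)
    ultimately show ?thesis
      by (simp add: w matrix_vector_expand iV inner_add)
  qed
  have 2: "(z - B *v w) \<bullet> (matrix_inv D *v (z - B *v w))
      = (D *v a) \<bullet> a - 2 * ((B *v e) \<bullet> a) + (B *v e) \<bullet> (matrix_inv D *v (B *v e))"
  proof -
    have "(D *v a) \<bullet> (matrix_inv D *v (B *v e)) = (B *v e) \<bullet> a"
      by (metis iD(2) inner_commute symD)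
    then show ?thesis
      by (simp add: zw matrix_vector_expand iD inner_diff)
  qed
  have 3: "z \<bullet> (matrix_inv E *v z) = (D *v a) \<bullet> a + (V *v (transpose B *v a)) \<bullet> (transpose B *v a)"
  proof -
    have "z \<bullet> a = (D *v a) \<bullet> a + (B *v (V *v (transpose B *v a))) \<bullet> a"
      by (subst z) (simp add: inner_add_left)
    then show ?thesis
      by (simp add: a_def[symmetric] inner_matrix_transpose[of _ "transpose B"])
  qed
  show ?thesis using 1 2 3 by linarith
qed

text \<open>If \<open>x\<close> and \<open>w\<close> are independent centred Gaussians, then so is \<open>T x + B w\<close>. The normalising
  constant need not be computed: both sides are probability densities.\<close>

theorem gaussian_affine_kernel:
  fixes T :: "real^'n^'n" and B :: "real^'m^'n" and f :: "real^'n \<Rightarrow> ennreal"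
  assumes C: "pos_def C" and V: "pos_def V" and T: "invertible T"
    and E: "pos_def E" "E = T ** C ** transpose T + B ** V ** transpose B"
    and f: "f \<in> borel_measurable borel"
  shows "(\<integral>\<^sup>+x. \<integral>\<^sup>+w. ennreal (gaussian_density 0 C x) * (ennreal (gaussian_density 0 V w) * f (T *v x + B *v w)) \<partial>lborel \<partial>lborel)
    = (\<integral>\<^sup>+z. ennreal (gaussian_density 0 E z) * f z \<partial>lborel)"
proof -
  define D where "D = T ** C ** transpose T"
  have Tt: "invertible (transpose T)" using T by (simp add: invertible_det_nz)
  have D: "pos_def D"
    unfolding pos_def_def symmetric_matrix_iff_self_adjoint
  proof (intro conjI allI impI)
    have Dvw: "v \<bullet> (D *v w) = (transpose T *v v) \<bullet> (C *v (transpose T *v w))" for v w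
      by (simp add: D_def matrix_vector_mul_assoc[symmetric] inner_matrix_transpose[of v T])
    fix v w :: "real^'n"
    show "v \<bullet> (D *v w) = (D *v v) \<bullet> w"
      unfolding inner_commute[of _ w] Dvw using C by (metis inner_commute pos_def_def self_adjointD)
    assume "v \<noteq> 0"
    then have "transpose T *v v \<noteq> 0" using Tt by (auto simp: invertible_iff_ker)
    then show "0 < v \<bullet> (D *v v)" unfolding Dvw using C by (simp add: pos_def_def)
  qed
  have ED: "E = D + B ** V ** transpose B" by (simp add: E(2) D_def)
  let ?L = "\<lambda>z. V *v (transpose B *v (matrix_inv E *v z))"
  define c where "c = sqrt ((2 * pi) ^ CARD('n) * det E)
      / (sqrt ((2 * pi) ^ CARD('m) * det V) * sqrt ((2 * pi) ^ CARD('n) * det D))"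
  define K where "K = (\<integral>\<^sup>+e. ennreal (c * exp (- (1/2) * (e \<bullet> (matrix_inv V *v e) + (B *v e) \<bullet> (matrix_inv D *v (B *v e))))) \<partial>lborel)"
  note dets = pos_def_det_pos[OF D] pos_def_det_pos[OF V] pos_def_det_pos[OF E(1)]
  have joint: "gaussian_density 0 V (?L z + e) * gaussian_density 0 D (z - B *v (?L z + e))
      = gaussian_density 0 E z * (c * exp (- (1/2) * (e \<bullet> (matrix_inv V *v e) + (B *v e) \<bullet> (matrix_inv D *v (B *v e)))))" for z e
  proof -
    let ?w = "?L z + e"
    have "exp (- (1/2) * (?w \<bullet> (matrix_inv V *v ?w))) * exp (- (1/2) * ((z - B *v ?w) \<bullet> (matrix_inv D *v (z - B *v ?w))))
      = exp (- (1/2) * (z \<bullet> (matrix_inv E *v z)))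
        * exp (- (1/2) * (e \<bullet> (matrix_inv V *v e) + (B *v e) \<bullet> (matrix_inv D *v (B *v e))))"
      unfolding exp_add[symmetric] distrib_left[symmetric]
      by (simp only: gaussian_complete_square[OF D V E(1) ED])
    then show ?thesis
      using dets by (simp add: gaussian_density_def c_def)
  qed
  have marginal: "(\<integral>\<^sup>+w. ennreal (gaussian_density 0 V w) * ennreal (gaussian_density 0 D (z - B *v w)) \<partial>lborel)
      = ennreal (gaussian_density 0 E z) * K" for z
  proof -
    have "(\<integral>\<^sup>+w. ennreal (gaussian_density 0 V w) * ennreal (gaussian_density 0 D (z - B *v w)) \<partial>lborel)
      = (\<integral>\<^sup>+e. ennreal (gaussian_density 0 V (?L z + e)) * ennreal (gaussian_density 0 D (z - B *v (?L z + e))) \<partial>lborel)"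
      by (rule nn_integral_lborel_translate[symmetric]) measurable
    also have "\<dots> = (\<integral>\<^sup>+e. ennreal (gaussian_density 0 E z) * ennreal (c * exp (- (1/2) * (e \<bullet> (matrix_inv V *v e) + (B *v e) \<bullet> (matrix_inv D *v (B *v e))))) \<partial>lborel)"
      using gaussian_density_pos[OF V] gaussian_density_pos[OF D] gaussian_density_pos[OF E(1)] dets
      by (intro nn_integral_cong) (simp add: ennreal_mult[symmetric] joint c_def less_imp_le)
    also have "\<dots> = ennreal (gaussian_density 0 E z) * K"
      unfolding K_def by (rule nn_integral_cmult) measurable
    finally show ?thesis .
  qed
  have main: "(\<integral>\<^sup>+x. \<integral>\<^sup>+w. ennreal (gaussian_density 0 C x) * (ennreal (gaussian_density 0 V w) * g (T *v x + B *v w)) \<partial>lborel \<partial>lborel)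
      = (\<integral>\<^sup>+z. ennreal (gaussian_density 0 E z) * K * g z \<partial>lborel)"
    if [measurable]: "g \<in> borel_measurable borel" for g :: "real^'n \<Rightarrow> ennreal"
  proof -
    let ?h = "\<lambda>z. \<integral>\<^sup>+w. ennreal (gaussian_density 0 D z) * (ennreal (gaussian_density 0 V w) * g (z + B *v w)) \<partial>lborel"
    have h[measurable]: "?h \<in> borel_measurable borel"
      by measurable
    have "(\<integral>\<^sup>+x. \<integral>\<^sup>+w. ennreal (gaussian_density 0 C x) * (ennreal (gaussian_density 0 V w) * g (T *v x + B *v w)) \<partial>lborel \<partial>lborel)
        = (\<integral>\<^sup>+x. ennreal \<bar>det T\<bar> * ?h (T *v x) \<partial>lborel)"
    proof (intro nn_integral_cong)
      fix x
      have "(\<integral>\<^sup>+w. ennreal (gaussian_density 0 C x) * (ennreal (gaussian_density 0 V w) * g (T *v x + B *v w)) \<partial>lborel)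
        = (\<integral>\<^sup>+w. ennreal \<bar>det T\<bar> * (ennreal (gaussian_density 0 D (T *v x)) * (ennreal (gaussian_density 0 V w) * g (T *v x + B *v w))) \<partial>lborel)"
        unfolding gaussian_density_linear_image[OF C T D_def]
        using gaussian_density_pos[OF D] by (simp add: ennreal_mult less_imp_le mult.assoc)
      then show "(\<integral>\<^sup>+w. ennreal (gaussian_density 0 C x) * (ennreal (gaussian_density 0 V w) * g (T *v x + B *v w)) \<partial>lborel)
        = ennreal \<bar>det T\<bar> * ?h (T *v x)"
        by (simp add: nn_integral_cmult)
    qed
    also have "\<dots> = ennreal \<bar>det T\<bar> * (\<integral>\<^sup>+x. ?h (T *v x) \<partial>lborel)"
      by (rule nn_integral_cmult) measurable
    also have "\<dots> = (\<integral>\<^sup>+z. ?h z \<partial>lborel)"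
      using T by (intro nn_integral_lborel_linear h) (simp add: invertible_det_nz)
    also have "\<dots> = (\<integral>\<^sup>+w. \<integral>\<^sup>+z. ennreal (gaussian_density 0 D z) * (ennreal (gaussian_density 0 V w) * g (z + B *v w)) \<partial>lborel \<partial>lborel)"
      by (rule lborel_pair.Fubini') measurable
    also have "\<dots> = (\<integral>\<^sup>+w. \<integral>\<^sup>+z. ennreal (gaussian_density 0 D (z - B *v w)) * (ennreal (gaussian_density 0 V w) * g z) \<partial>lborel \<partial>lborel)"
    proof (rule nn_integral_cong)
      fix w
      show "(\<integral>\<^sup>+z. ennreal (gaussian_density 0 D z) * (ennreal (gaussian_density 0 V w) * g (z + B *v w)) \<partial>lborel)
        = (\<integral>\<^sup>+z. ennreal (gaussian_density 0 D (z - B *v w)) * (ennreal (gaussian_density 0 V w) * g z) \<partial>lborel)"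
        using nn_integral_lborel_translate[of "\<lambda>z. ennreal (gaussian_density 0 D (z - B *v w)) * (ennreal (gaussian_density 0 V w) * g z)" "B *v w"]
        by (simp add: add.commute)
    qed
    also have "\<dots> = (\<integral>\<^sup>+z. \<integral>\<^sup>+w. ennreal (gaussian_density 0 D (z - B *v w)) * (ennreal (gaussian_density 0 V w) * g z) \<partial>lborel \<partial>lborel)"
      by (rule lborel_pair.Fubini') measurable
    also have "\<dots> = (\<integral>\<^sup>+z. \<integral>\<^sup>+w. (ennreal (gaussian_density 0 V w) * ennreal (gaussian_density 0 D (z - B *v w))) * g z \<partial>lborel \<partial>lborel)"
      by (simp add: mult_ac)
    also have "\<dots> = (\<integral>\<^sup>+z. ennreal (gaussian_density 0 E z) * K * g z \<partial>lborel)"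
    proof (intro nn_integral_cong)
      fix z
      have "(\<integral>\<^sup>+w. (ennreal (gaussian_density 0 V w) * ennreal (gaussian_density 0 D (z - B *v w))) * g z \<partial>lborel)
          = (\<integral>\<^sup>+w. ennreal (gaussian_density 0 V w) * ennreal (gaussian_density 0 D (z - B *v w)) \<partial>lborel) * g z"
        by (rule nn_integral_multc) measurable
      then show "(\<integral>\<^sup>+w. (ennreal (gaussian_density 0 V w) * ennreal (gaussian_density 0 D (z - B *v w))) * g z \<partial>lborel)
          = ennreal (gaussian_density 0 E z) * K * g z"
        by (simp only: marginal)
    qed
    finally show ?thesis .
  qed
  \<comment> \<open>for the function \<open>1\<close>, both sides are total masses of probability densities\<close>
  have "K = 1"
    using main[of "\<lambda>_. 1"]
    by (simp add: nn_integral_cmult nn_integral_multc nn_integral_gaussian_density C V E(1))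
  then show ?thesis using main[OF f] by simp
qed

section \<open>Kernels with a density\<close>

locale density_kernel = prob_space M for M :: "'a measure" +
  fixes p :: "'a \<Rightarrow> 'b::euclidean_space \<Rightarrow> real"
  assumes density_measurable: "(\<lambda>(h, v). p h v) \<in> borel_measurable (M \<Otimes>\<^sub>M borel)"
    and density_nonneg: "\<And>h v. h \<in> space M \<Longrightarrow> 0 \<le> p h v"
    and density_normalized: "\<And>h. h \<in> space M \<Longrightarrow> (\<integral>\<^sup>+v. ennreal (p h v) \<partial>lborel) = 1"
begin

definition joint :: "('a \<times> 'b) measure" where
  "joint = density (M \<Otimes>\<^sub>M lborel) (\<lambda>(h, v). ennreal (p h v))"

sublocale pair: pair_sigma_finite M "lborel :: 'b measure"
  by standard

lemma density_measurable' [measurable]: "(\<lambda>(h, v). p h v) \<in> borel_measurable (M \<Otimes>\<^sub>M lborel)"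
  using density_measurable by (simp cong: measurable_cong_sets sets_pair_measure_cong)

lemma sets_joint [simp, measurable_cong]: "sets joint = sets (M \<Otimes>\<^sub>M borel)"
  by (simp add: joint_def cong: sets_pair_measure_cong)

lemma space_joint [simp]: "space joint = space M \<times> UNIV"
  by (simp add: joint_def space_pair_measure)

lemma density_slice [measurable]: "h \<in> space M \<Longrightarrow> p h \<in> borel_measurable borel"
  using measurable_compose[OF measurable_Pair1'[of h M borel] density_measurable] by simp

lemma nn_integral_joint:
  assumes [measurable]: "f \<in> borel_measurable (M \<Otimes>\<^sub>M borel)"
  shows "(\<integral>\<^sup>+z. f z \<partial>joint) = (\<integral>\<^sup>+h. \<integral>\<^sup>+v. ennreal (p h v) * f (h, v) \<partial>lborel \<partial>M)"
proof -
  have [measurable]: "f \<in> borel_measurable (M \<Otimes>\<^sub>M lborel)"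
    using assms by (simp cong: measurable_cong_sets sets_pair_measure_cong)
  have "(\<integral>\<^sup>+z. f z \<partial>joint) = (\<integral>\<^sup>+z. (case z of (h, v) \<Rightarrow> ennreal (p h v)) * f z \<partial>(M \<Otimes>\<^sub>M lborel))"
    unfolding joint_def by (rule nn_integral_density) measurable
  also have "\<dots> = (\<integral>\<^sup>+h. \<integral>\<^sup>+v. (case (h, v) of (h, v) \<Rightarrow> ennreal (p h v)) * f (h, v) \<partial>lborel \<partial>M)"
    by (rule lborel.nn_integral_fst[symmetric]) measurable
  finally show ?thesis by simp
qed

lemma nn_integral_joint_fst:
  assumes [measurable]: "f \<in> borel_measurable M"
  shows "(\<integral>\<^sup>+z. f (fst z) \<partial>joint) = (\<integral>\<^sup>+h. f h \<partial>M)"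
proof -
  have "(\<integral>\<^sup>+z. f (fst z) \<partial>joint) = (\<integral>\<^sup>+h. \<integral>\<^sup>+v. ennreal (p h v) * f h \<partial>lborel \<partial>M)"
    by (subst nn_integral_joint) simp_all
  also have "\<dots> = (\<integral>\<^sup>+h. f h \<partial>M)"
    by (intro nn_integral_cong) (simp add: nn_integral_multc density_normalized)
  finally show ?thesis .
qed

lemma distr_joint_fst: "distr joint M fst = M"
proof (rule measure_eqI)
  fix X assume "X \<in> sets (distr joint M fst)"
  then have [measurable]: "X \<in> sets M" by simp
  have "emeasure (distr joint M fst) X = (\<integral>\<^sup>+x. indicator X x \<partial>distr joint M fst)"
    by simp
  also have "\<dots> = (\<integral>\<^sup>+z. indicator X (fst z) \<partial>joint)"
    by (rule nn_integral_distr) measurable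
  also have "\<dots> = emeasure M X"
    by (simp add: nn_integral_joint_fst)
  finally show "emeasure (distr joint M fst) X = emeasure M X" .
qed simp

lemma prob_space_joint: "prob_space joint"
proof (rule prob_spaceI)
  have "emeasure joint (space joint) = (\<integral>\<^sup>+z. 1 \<partial>joint)" by simp
  also have "\<dots> = 1"
    using nn_integral_joint_fst[of "\<lambda>_. 1"] by (simp add: emeasure_space_1)
  finally show "emeasure joint (space joint) = 1" .
qed

text \<open>One step of the construction of a law by \<open>bind\<close> is the image of a measure with a density on a product
  space.\<close>

lemma bind_density_kernel:
  assumes T[measurable]: "T \<in> M \<Otimes>\<^sub>M borel \<rightarrow>\<^sub>M K"
  shows "M \<bind> (\<lambda>h. distr (density lborel (\<lambda>v. ennreal (p h v))) K (\<lambda>v. T (h, v))) = distr joint K T"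
proof -
  let ?k = "\<lambda>h. distr (density lborel (\<lambda>v. ennreal (p h v))) K (\<lambda>v. T (h, v))"
  have slice[measurable]: "(\<lambda>v. T (h, v)) \<in> borel \<rightarrow>\<^sub>M K" if "h \<in> space M" for h
    using measurable_compose[OF measurable_Pair1'[OF that] T] .
  have em: "emeasure (?k h) X = (\<integral>\<^sup>+v. ennreal (p h v) * indicator X (T (h, v)) \<partial>lborel)"
    if h: "h \<in> space M" and [measurable]: "X \<in> sets K" for h X
  proof -
    note [measurable] = slice[OF h] density_slice[OF h]
    have "emeasure (?k h) X = (\<integral>\<^sup>+y. indicator X y \<partial>?k h)" by simp
    also have "\<dots> = (\<integral>\<^sup>+v. indicator X (T (h, v)) \<partial>density lborel (\<lambda>v. ennreal (p h v)))"
      by (rule nn_integral_distr) measurable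
    also have "\<dots> = (\<integral>\<^sup>+v. ennreal (p h v) * indicator X (T (h, v)) \<partial>lborel)"
      by (rule nn_integral_density) measurable
    finally show ?thesis .
  qed
  have kernel: "?k \<in> M \<rightarrow>\<^sub>M subprob_algebra K"
  proof (rule measurable_subprob_algebra)
    fix h assume h: "h \<in> space M"
    note [measurable] = slice[OF h] density_slice[OF h]
    have "prob_space (density lborel (\<lambda>v. ennreal (p h v)))"
      using density_normalized[OF h] by (intro prob_spaceI) (simp add: emeasure_density)
    then show "subprob_space (?k h)"
      by (intro prob_space_imp_subprob_space prob_space.prob_space_distr) simp_all
  next
    fix X assume X[measurable]: "X \<in> sets K"
    have "(\<lambda>h. \<integral>\<^sup>+v. ennreal (p h v) * indicator X (T (h, v)) \<partial>lborel) \<in> borel_measurable M"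
      by measurable
    then show "(\<lambda>h. emeasure (?k h) X) \<in> borel_measurable M"
      by (simp add: em cong: measurable_cong)
  qed simp
  show ?thesis
  proof (rule measure_eqI)
    show "sets (M \<bind> ?k) = sets (distr joint K T)"
      using not_empty by simp
    fix X assume "X \<in> sets (M \<bind> ?k)"
    then have X[measurable]: "X \<in> sets K" using not_empty by simp
    have "emeasure (M \<bind> ?k) X = (\<integral>\<^sup>+h. emeasure (?k h) X \<partial>M)"
      by (rule emeasure_bind[OF not_empty kernel X])
    also have "\<dots> = (\<integral>\<^sup>+h. \<integral>\<^sup>+v. ennreal (p h v) * indicator X (T (h, v)) \<partial>lborel \<partial>M)"
      by (intro nn_integral_cong em X)
    also have "\<dots> = (\<integral>\<^sup>+z. indicator X (T z) \<partial>joint)"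
      by (rule nn_integral_joint[symmetric]) measurable
    also have "\<dots> = emeasure (distr joint K T) X"
    proof -
      have "(\<integral>\<^sup>+z. indicator X (T z) \<partial>joint) = (\<integral>\<^sup>+x. indicator X x \<partial>distr joint K T)"
        by (rule nn_integral_distr[symmetric]) measurable
      then show ?thesis by simp
    qed
    finally show "emeasure (M \<bind> ?k) X = emeasure (distr joint K T) X" .
  qed
qed

lemma integrable_joint:
  fixes f :: "'a \<times> 'b \<Rightarrow> real"
  assumes f: "integrable joint f"
  shows "AE h in M. integrable lborel (\<lambda>v. p h v * f (h, v))"
    and "integrable M (\<lambda>h. \<integral>v. p h v * f (h, v) \<partial>lborel)"
    and "(\<integral>h. \<integral>v. p h v * f (h, v) \<partial>lborel \<partial>M) = (\<integral>z. f z \<partial>joint)"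
proof -
  have "f \<in> borel_measurable joint" using f by simp
  then have [measurable]: "f \<in> borel_measurable (M \<Otimes>\<^sub>M lborel)"
    by (simp cong: measurable_cong_sets sets_pair_measure_cong)
  have nn: "AE z in M \<Otimes>\<^sub>M lborel. 0 \<le> (case z of (h, v) \<Rightarrow> p h v)"
    by (rule AE_I2) (auto simp: space_pair_measure density_nonneg)
  have eq: "joint = density (M \<Otimes>\<^sub>M lborel) (\<lambda>z. ennreal (case z of (h, v) \<Rightarrow> p h v))"
    by (simp add: joint_def case_prod_unfold)
  have int: "integrable (M \<Otimes>\<^sub>M lborel) (\<lambda>z. (case z of (h, v) \<Rightarrow> p h v) *\<^sub>R f z)"
    using f nn unfolding eq by (subst (asm) integrable_density) auto
  show "AE h in M. integrable lborel (\<lambda>v. p h v * f (h, v))"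
    using pair.AE_integrable_fst'[OF int] by simp
  show "integrable M (\<lambda>h. \<integral>v. p h v * f (h, v) \<partial>lborel)"
    using pair.integrable_fst'[OF int] by simp
  have "(\<integral>z. f z \<partial>joint) = (\<integral>z. (case z of (h, v) \<Rightarrow> p h v) *\<^sub>R f z \<partial>(M \<Otimes>\<^sub>M lborel))"
    unfolding eq using nn by (intro integral_density) auto
  then show "(\<integral>h. \<integral>v. p h v * f (h, v) \<partial>lborel \<partial>M) = (\<integral>z. f z \<partial>joint)"
    using pair.integral_fst'[OF int] by simp
qed

end


section \<open>Relative entropy\<close>

text \<open>The defect in \<open>ln x \<le> x - 1\<close> at \<open>x = b / a\<close>.\<close>

lemma gibbs_pointwise:
  fixes a b :: real
  assumes "0 \<le> a" "0 < b"
  shows "0 \<le> a * ln a - a * ln b - a + b"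
    and "a * ln a - a * ln b - a + b = 0 \<Longrightarrow> a = b"
proof -
  have *: "a * ln a - a * ln b - a + b = a * (b / a - 1 - ln (b / a))" if "0 < a"
    using that assms by (simp add: ln_div algebra_simps)
  show "0 \<le> a * ln a - a * ln b - a + b"
  proof (cases "a = 0")
    case False
    then have "0 < a" using assms by simp
    moreover have "ln (b / a) \<le> b / a - 1"
      using \<open>0 < a\<close> assms by (intro ln_le_minus_one) simp
    ultimately show ?thesis unfolding *[OF \<open>0 < a\<close>] by simp
  qed (use assms in simp)
  assume 0: "a * ln a - a * ln b - a + b = 0"
  then have "0 < a" using assms by (cases "a = 0") auto
  then have "ln (b / a) = b / a - 1" using 0 *[OF \<open>0 < a\<close>] by simp
  then have "b / a = 1" using \<open>0 < a\<close> assms by (intro ln_eq_minus_one) auto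
  then show "a = b" using \<open>0 < a\<close> by simp
qed

lemma gibbs_inequality:
  fixes f g :: "'a \<Rightarrow> real"
  assumes f: "\<And>x. 0 \<le> f x" "integrable M f" and g: "\<And>x. 0 < g x" "integrable M g"
    and mass: "(\<integral>x. f x \<partial>M) = (\<integral>x. g x \<partial>M)"
    and ff: "integrable M (\<lambda>x. f x * ln (f x))" and fg: "integrable M (\<lambda>x. f x * ln (g x))"
  shows "(\<integral>x. f x * ln (g x) \<partial>M) \<le> (\<integral>x. f x * ln (f x) \<partial>M)"
    and "(\<integral>x. f x * ln (f x) \<partial>M) = (\<integral>x. f x * ln (g x) \<partial>M) \<Longrightarrow> AE x in M. f x = g x"
proof -
  let ?d = "\<lambda>x. f x * ln (f x) - f x * ln (g x) - f x + g x"
  have int: "integrable M ?d"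
    using f g ff fg by simp
  have eq: "(\<integral>x. ?d x \<partial>M) = (\<integral>x. f x * ln (f x) \<partial>M) - (\<integral>x. f x * ln (g x) \<partial>M)"
    using f g ff fg mass by simp
  have nn: "0 \<le> ?d x" for x
    by (rule gibbs_pointwise(1)[OF f(1) g(1)])
  have "0 \<le> (\<integral>x. ?d x \<partial>M)" using nn by simp
  then show "(\<integral>x. f x * ln (g x) \<partial>M) \<le> (\<integral>x. f x * ln (f x) \<partial>M)"
    unfolding eq by simp
  assume "(\<integral>x. f x * ln (f x) \<partial>M) = (\<integral>x. f x * ln (g x) \<partial>M)"
  then have "AE x in M. ?d x = 0"
    using integral_nonneg_eq_0_iff_AE[OF int] nn eq by simp
  then show "AE x in M. f x = g x"
    by eventually_elim (rule gibbs_pointwise(2)[OF f(1) g(1)])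
qed

lemma unit_mass_integral:
  fixes f :: "'a \<Rightarrow> real"
  assumes "f \<in> borel_measurable M" "\<And>x. 0 \<le> f x" "(\<integral>\<^sup>+x. ennreal (f x) \<partial>M) = 1"
  shows "integrable M f" "(\<integral>x. f x \<partial>M) = 1"
  using assms by (auto intro: integrableI_nonneg simp: integral_eq_nn_integral)

context density_kernel
begin

text \<open>The mean over \<open>M\<close> of the relative entropy of \<open>p h\<close> with respect to \<open>g h\<close>. The cross term is an
  integral over the joint law, where it is a quadratic function of state and control in the application.\<close>

definition relative_entropy :: "('a \<Rightarrow> 'b \<Rightarrow> real) \<Rightarrow> real" where
  "relative_entropy g = (\<integral>h. \<integral>v. p h v * ln (p h v) \<partial>lborel \<partial>M) - (\<integral>(h, v). ln (g h v) \<partial>joint)"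

lemma relative_entropy_nonneg:
  assumes g: "\<And>h v. 0 < g h v" "\<And>h. g h \<in> borel_measurable borel"
      "\<And>h. (\<integral>\<^sup>+v. ennreal (g h v) \<partial>lborel) = 1"
    and pp: "AE h in M. integrable lborel (\<lambda>v. p h v * ln (p h v))"
      "integrable M (\<lambda>h. \<integral>v. p h v * ln (p h v) \<partial>lborel)"
    and pg: "integrable joint (\<lambda>(h, v). ln (g h v))"
  shows "0 \<le> relative_entropy g"
    and "relative_entropy g = 0 \<Longrightarrow> AE h in M. AE v in lborel. p h v = g h v"
proof -
  note j = integrable_joint[OF pg, simplified]
  define d where "d h = (\<integral>v. p h v * ln (p h v) \<partial>lborel) - (\<integral>v. p h v * ln (g h v) \<partial>lborel)" for h
  have int: "integrable M d"
    unfolding d_def using pp(2) j(2) by simp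
  have eq: "relative_entropy g = (\<integral>h. d h \<partial>M)"
    unfolding d_def relative_entropy_def using pp(2) j(2,3) by simp
  have gibbs: "0 \<le> d h \<and> (d h = 0 \<longrightarrow> (AE v in lborel. p h v = g h v))"
    if h: "h \<in> space M" and "integrable lborel (\<lambda>v. p h v * ln (p h v))"
      "integrable lborel (\<lambda>v. p h v * ln (g h v))" for h
  proof -
    have p1: "integrable lborel (p h)" "(\<integral>v. p h v \<partial>lborel) = 1"
      using h by (intro unit_mass_integral; simp add: density_nonneg density_normalized density_slice)+
    have g1: "integrable lborel (g h)" "(\<integral>v. g h v \<partial>lborel) = 1"
      using g by (intro unit_mass_integral; simp add: less_imp_le)+
    have mass: "(\<integral>v. p h v \<partial>lborel) = (\<integral>v. g h v \<partial>lborel)"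
      using p1(2) g1(2) by simp
    note gibbs = gibbs_inequality[OF density_nonneg[OF h] p1(1) g(1) g1(1) mass that(2,3)]
    show ?thesis
      using gibbs(1) gibbs(2) unfolding d_def by auto
  qed
  have ae: "AE h in M. 0 \<le> d h \<and> (d h = 0 \<longrightarrow> (AE v in lborel. p h v = g h v))"
    using pp(1) j(1) AE_space by eventually_elim (rule gibbs)
  then have nn: "AE h in M. 0 \<le> d h" by eventually_elim simp
  then show "0 \<le> relative_entropy g"
    unfolding eq by (rule integral_nonneg_AE)
  assume "relative_entropy g = 0"
  then have "AE h in M. d h = 0"
    using integral_nonneg_eq_0_iff_AE[OF int nn] eq by simp
  with ae show "AE h in M. AE v in lborel. p h v = g h v"
    by eventually_elim simp
qed

end

section \<open>The law of the history\<close>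

lemma measurable_state [measurable]:
  assumes "i \<le> k"
  shows "(\<lambda>h. fst h i) \<in> borel_measurable (hist_space k)"
  unfolding hist_space_def
  by (rule measurable_compose[OF measurable_fst measurable_component_singleton]) (use assms in simp)

lemma measurable_control [measurable]:
  assumes "i < k"
  shows "(\<lambda>h. snd h i) \<in> borel_measurable (hist_space k)"
  unfolding hist_space_def
  by (rule measurable_compose[OF measurable_snd measurable_component_singleton]) (use assms in simp)

definition extend_hist ::
  "(nat \<Rightarrow> real^'n^'n) \<Rightarrow> (nat \<Rightarrow> real^'m^'n) \<Rightarrow> nat \<Rightarrow> ('n, 'm) hist \<times> (real^'m) \<Rightarrow> ('n::finite, 'm::finite) hist" where
  "extend_hist A B k = (\<lambda>(h, v). ((fst h)(Suc k := A k *v fst h k + B k *v v), (snd h)(k := v)))"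

lemma measurable_extend_hist [measurable]:
  "extend_hist A B k \<in> hist_space k \<Otimes>\<^sub>M borel \<rightarrow>\<^sub>M hist_space (Suc k)"
proof -
  let ?M = "hist_space k \<Otimes>\<^sub>M borel :: (('a, 'b) hist \<times> (real^'b)) measure"
  have x: "(\<lambda>z. fst (fst z)) \<in> ?M \<rightarrow>\<^sub>M PiM {..k} (\<lambda>_. borel)"
    and u: "(\<lambda>z. snd (fst z)) \<in> ?M \<rightarrow>\<^sub>M PiM {..<k} (\<lambda>_. borel)"
    unfolding hist_space_def by measurable
  have [measurable]: "(\<lambda>z. fst (fst z) k) \<in> borel_measurable ?M"
    by (rule measurable_compose[OF measurable_fst measurable_state]) simp
  have "(\<lambda>z. (fst (fst z))(Suc k := A k *v fst (fst z) k + B k *v snd z)) \<in> ?M \<rightarrow>\<^sub>M PiM {..Suc k} (\<lambda>_. borel)"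
    by (rule measurable_fun_upd[OF _ x]) (auto simp: atMost_Suc)
  moreover have "(\<lambda>z. (snd (fst z))(k := snd z)) \<in> ?M \<rightarrow>\<^sub>M PiM {..<Suc k} (\<lambda>_. borel)"
    by (rule measurable_fun_upd[OF _ u]) (auto simp: lessThan_Suc)
  ultimately show ?thesis
    unfolding extend_hist_def case_prod_unfold hist_space_def[of "Suc k"] by (rule measurable_Pair)
qed

lemma measurable_initial_hist [measurable]:
  "(\<lambda>x0. (\<lambda>i\<in>{..0}. x0, \<lambda>i. undefined)) \<in> borel \<rightarrow>\<^sub>M (hist_space 0 :: ('n::finite, 'm::finite) hist measure)"
proof -
  have "(\<lambda>x0::real^'n. \<lambda>i\<in>{..0::nat}. x0) \<in> borel \<rightarrow>\<^sub>M PiM {..0} (\<lambda>_. borel)"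
    by (rule measurable_restrict) simp
  moreover have "(\<lambda>_::real^'n. \<lambda>i. undefined) \<in> borel \<rightarrow>\<^sub>M PiM {..<0::nat} (\<lambda>_. borel :: (real^'m) measure)"
    by (simp add: space_PiM)
  ultimately show ?thesis unfolding hist_space_def by (rule measurable_Pair)
qed

lemma measurable_past [measurable]:
  "k \<le> m \<Longrightarrow> past k \<in> hist_space m \<rightarrow>\<^sub>M hist_space k"
  unfolding past_def[abs_def] hist_space_def
  by (intro measurable_Pair measurable_compose[OF measurable_fst measurable_restrict_subset]
      measurable_compose[OF measurable_snd measurable_restrict_subset]) auto

lemma past_extend_hist:
  "h \<in> space (hist_space k) \<Longrightarrow> past k (extend_hist A B k (h, v)) = h"
  by (cases h) (auto simp: past_def extend_hist_def hist_space_def space_pair_measure space_PiM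
      PiE_def extensional_def restrict_def fun_eq_iff)

lemma past_past: "k \<le> m \<Longrightarrow> past k (past m h) = past k h"
  by (auto simp: past_def restrict_def fun_eq_iff)

declare hist_law.simps [simp del]

context
  fixes A :: "nat \<Rightarrow> real^'n^'n" and B :: "nat \<Rightarrow> real^'m^'n" and N :: nat
    and \<Sigma>0 :: "real^'n^'n" and \<pi> :: "('n, 'm) policy"
  assumes \<Sigma>0_pd: "pos_def \<Sigma>0" and policy: "is_policy N \<pi>"
begin

abbreviation "policy_law k \<equiv> hist_law A B \<Sigma>0 \<pi> k"

lemma density_kernel_if_prob_space:
  assumes "k < N" "prob_space (policy_law k)" "sets (policy_law k) = sets (hist_space k)"
  shows "density_kernel (policy_law k) (\<pi> k)"
proof -
  have "space (policy_law k) = space (hist_space k)"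
    using assms(3) by (rule sets_eq_imp_space_eq)
  moreover have "sets (policy_law k \<Otimes>\<^sub>M borel) = sets (hist_space k \<Otimes>\<^sub>M (borel :: (real^'m) measure))"
    using assms(3) by (intro sets_pair_measure_cong) auto
  ultimately show ?thesis
    using policy assms(1,2) unfolding is_policy_def density_kernel_def density_kernel_axioms_def
    by (simp cong: measurable_cong_sets)
qed

lemma hist_law_Suc_if_prob_space:
  assumes k: "k < N" "prob_space (policy_law k)" and sets: "sets (policy_law k) = sets (hist_space k)"
  shows "policy_law (Suc k) = distr (density_kernel.joint (policy_law k) (\<pi> k)) (hist_space (Suc k)) (extend_hist A B k)"
proof -
  have "extend_hist A B k \<in> policy_law k \<Otimes>\<^sub>M borel \<rightarrow>\<^sub>M hist_space (Suc k)"
    using measurable_extend_hist[of A B k] sets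
    by (simp cong: measurable_cong_sets sets_pair_measure_cong)
  from density_kernel.bind_density_kernel[OF density_kernel_if_prob_space[OF assms] this]
  show ?thesis by (simp add: extend_hist_def hist_law.simps)
qed

lemma hist_law_prob_space: "k \<le> N \<Longrightarrow> prob_space (policy_law k) \<and> sets (policy_law k) = sets (hist_space k)"
proof (induction k)
  case 0
  show ?case
    using measurable_initial_hist prob_space_gaussian_density[OF \<Sigma>0_pd, of 0]
    by (auto simp: gaussian_measure_def hist_law.simps intro!: prob_space.prob_space_distr)
next
  case (Suc k)
  then have k: "k < N" "prob_space (policy_law k)" and sets: "sets (policy_law k) = sets (hist_space k)" by auto
  interpret density_kernel "policy_law k" "\<pi> k" by (rule density_kernel_if_prob_space[OF k sets])
  have "extend_hist A B k \<in> joint \<rightarrow>\<^sub>M hist_space (Suc k)"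
    using measurable_extend_hist[of A B k] sets
    by (simp cong: measurable_cong_sets sets_pair_measure_cong)
  then show ?case
    using prob_space_joint unfolding hist_law_Suc_if_prob_space[OF k sets]
    by (auto intro: prob_space.prob_space_distr)
qed

lemma sets_law [simp, measurable_cong]: "k \<le> N \<Longrightarrow> sets (policy_law k) = sets (hist_space k)"
  using hist_law_prob_space by blast

lemma space_law: "k \<le> N \<Longrightarrow> space (policy_law k) = space (hist_space k)"
  by (rule sets_eq_imp_space_eq) simp

lemma density_kernel_law: "k < N \<Longrightarrow> density_kernel (policy_law k) (\<pi> k)"
  using hist_law_prob_space[of k] by (intro density_kernel_if_prob_space) auto

abbreviation "policy_joint k \<equiv> density_kernel.joint (policy_law k) (\<pi> k)"

lemma sets_joint_law [measurable_cong]: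
  "k < N \<Longrightarrow> sets (policy_joint k) = sets (hist_space k \<Otimes>\<^sub>M borel)"
  by (simp add: density_kernel.sets_joint[OF density_kernel_law] cong: sets_pair_measure_cong)

lemma space_joint_law: "k < N \<Longrightarrow> space (policy_joint k) = space (hist_space k) \<times> UNIV"
  by (simp add: density_kernel.space_joint[OF density_kernel_law] space_law)

lemma hist_law_Suc:
  "k < N \<Longrightarrow> policy_law (Suc k) = distr (policy_joint k) (hist_space (Suc k)) (extend_hist A B k)"
  using hist_law_prob_space[of k] by (intro hist_law_Suc_if_prob_space) auto

lemma distr_law_Suc:
  assumes k: "k < N" and f: "f \<in> hist_space (Suc k) \<rightarrow>\<^sub>M L"
  shows "distr (policy_law (Suc k)) L f = distr (policy_joint k) L (\<lambda>z. f (extend_hist A B k z))"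
proof -
  have "extend_hist A B k \<in> policy_joint k \<rightarrow>\<^sub>M hist_space (Suc k)"
    using measurable_extend_hist[of A B k] by (simp add: sets_joint_law[OF k] cong: measurable_cong_sets)
  then show ?thesis
    unfolding hist_law_Suc[OF k] using f by (simp add: distr_distr comp_def)
qed

lemma distr_past_Suc: "k < N \<Longrightarrow> distr (policy_law (Suc k)) (hist_space k) (past k) = policy_law k"
proof -
  assume k: "k < N"
  have past: "past k \<in> hist_space (Suc k) \<rightarrow>\<^sub>M hist_space k"
    by (rule measurable_past) simp
  have "distr (policy_law (Suc k)) (hist_space k) (past k) = distr (policy_joint k) (hist_space k) fst"
    unfolding distr_law_Suc[OF k past]
    by (rule distr_cong) (auto simp: space_joint_law[OF k] past_extend_hist)
  also have "\<dots> = distr (policy_joint k) (policy_law k) fst"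
    using k by (intro distr_cong) auto
  finally show ?thesis
    by (simp add: density_kernel.distr_joint_fst[OF density_kernel_law[OF k]])
qed

lemma distr_past:
  assumes "k \<le> m" "m \<le> N"
  shows "distr (policy_law m) (hist_space k) (past k) = policy_law k"
  using assms
proof (induction m rule: dec_induct)
  case base
  then have "distr (policy_law k) (hist_space k) (past k) = distr (policy_law k) (policy_law k) (\<lambda>h. h)"
  proof (intro distr_cong)
    fix h assume "h \<in> space (policy_law k)"
    then have "h \<in> space (hist_space k)" using base by (simp add: space_law)
    then show "past k h = h"
      by (cases h) (auto simp: past_def hist_space_def space_pair_measure space_PiM
          PiE_def extensional_restrict)
  qed auto
  then show ?case by simp
next
  case (step m)
  have [measurable]: "past m \<in> policy_law (Suc m) \<rightarrow>\<^sub>M hist_space m"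
    using step.prems measurable_past[of m "Suc m"] by (simp cong: measurable_cong_sets)
  have "distr (policy_law (Suc m)) (hist_space k) (past k)
      = distr (policy_law (Suc m)) (hist_space k) (\<lambda>h. past k (past m h))"
    using step.hyps by (simp add: past_past)
  also have "\<dots> = distr (distr (policy_law (Suc m)) (hist_space m) (past m)) (hist_space k) (past k)"
    using step.hyps by (subst distr_distr) (auto simp: comp_def intro: measurable_past)
  also have "\<dots> = policy_law k"
    using step by (simp add: distr_past_Suc)
  finally show ?case .
qed

text \<open>Costs are expectations over the whole history \<open>h\<^sub>N\<close>; this transfers them to the joint law of \<open>h\<^sub>k\<close>
  and \<open>u\<^sub>k\<close>.\<close>

lemma distr_past_control:
  assumes k: "k < N"
  shows "distr (policy_law N) (hist_space k \<Otimes>\<^sub>M borel) (\<lambda>h. (past k h, snd h k)) = policy_joint k"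
proof -
  have [measurable]: "past (Suc k) \<in> policy_law N \<rightarrow>\<^sub>M hist_space (Suc k)"
    using k measurable_past[of "Suc k" N] by (simp cong: measurable_cong_sets)
  have m: "(\<lambda>h. (past k h, snd h k)) \<in> hist_space (Suc k) \<rightarrow>\<^sub>M hist_space k \<Otimes>\<^sub>M borel"
    by (intro measurable_Pair measurable_past measurable_control) auto
  have "distr (policy_law N) (hist_space k \<Otimes>\<^sub>M borel) (\<lambda>h. (past k h, snd h k))
      = distr (policy_law N) (hist_space k \<Otimes>\<^sub>M borel) (\<lambda>h. (past k (past (Suc k) h), snd (past (Suc k) h) k))"
    by (simp add: past_past) (simp add: past_def)
  also have "\<dots> = distr (distr (policy_law N) (hist_space (Suc k)) (past (Suc k))) (hist_space k \<Otimes>\<^sub>M borel) (\<lambda>h. (past k h, snd h k))"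
    by (subst distr_distr[OF m]) (auto simp: comp_def)
  also have "\<dots> = distr (policy_law (Suc k)) (hist_space k \<Otimes>\<^sub>M borel) (\<lambda>h. (past k h, snd h k))"
    using k by (simp add: distr_past)
  also have "\<dots> = distr (policy_joint k) (hist_space k \<Otimes>\<^sub>M borel) (\<lambda>z. (past k (extend_hist A B k z), snd (extend_hist A B k z) k))"
    by (rule distr_law_Suc[OF k m])
  also have "\<dots> = distr (policy_joint k) (policy_joint k) (\<lambda>z. z)"
    using k by (intro distr_cong) (auto simp: space_joint_law sets_joint_law past_extend_hist, simp add: extend_hist_def)
  finally show ?thesis by simp
qed

end

section \<open>Square integrable random vectors\<close>

definition square_integrable :: "'a measure \<Rightarrow> ('a \<Rightarrow> real^'n) \<Rightarrow> bool" where
  "square_integrable M f \<longleftrightarrow> f \<in> borel_measurable M \<and> integrable M (\<lambda>x. f x \<bullet> f x)"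

lemma square_integrable_quadratic:
  assumes f: "square_integrable M f" and g: "square_integrable M g"
  shows "integrable M (\<lambda>x. f x \<bullet> (X *v g x))"
proof -
  obtain c where c: "0 \<le> c" "\<And>v w. \<bar>v \<bullet> (X *v w)\<bar> \<le> c * (norm v * norm w)"
    using quadratic_form_bound[of X] by blast
  have [measurable]: "f \<in> borel_measurable M" "g \<in> borel_measurable M"
    using f g by (auto simp: square_integrable_def)
  show ?thesis
  proof (rule Bochner_Integration.integrable_bound)
    show "integrable M (\<lambda>x. c * (f x \<bullet> f x + g x \<bullet> g x))"
      using f g by (simp add: square_integrable_def)
    show "AE x in M. norm (f x \<bullet> (X *v g x)) \<le> norm (c * (f x \<bullet> f x + g x \<bullet> g x))"
    proof (rule AE_I2)
      fix x
      have "0 \<le> (norm (f x) - norm (g x))\<^sup>2" "0 \<le> (norm (f x))\<^sup>2" "0 \<le> (norm (g x))\<^sup>2" by auto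
      then have "norm (f x) * norm (g x) \<le> (norm (f x))\<^sup>2 + (norm (g x))\<^sup>2"
        unfolding power2_diff by linarith
      then have "norm (f x) * norm (g x) \<le> f x \<bullet> f x + g x \<bullet> g x"
        by (simp add: power2_norm_eq_inner)
      then have "c * (norm (f x) * norm (g x)) \<le> c * (f x \<bullet> f x + g x \<bullet> g x)"
        using c(1) by (rule mult_left_mono)
      then show "norm (f x \<bullet> (X *v g x)) \<le> norm (c * (f x \<bullet> f x + g x \<bullet> g x))"
        using c(2)[of "f x" "g x"] by simp
    qed
  qed measurable
qed

lemma square_integrable_inner:
  "square_integrable M f \<Longrightarrow> square_integrable M g \<Longrightarrow> integrable M (\<lambda>x. f x \<bullet> g x)"
  using square_integrable_quadratic[of M f g "mat 1"] by simp

lemma square_integrable_matrix: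
  assumes "square_integrable M f"
  shows "square_integrable M (\<lambda>x. X *v f x)"
proof -
  have "(X *v v) \<bullet> (X *v v) = v \<bullet> ((transpose X ** X) *v v)" for v
    by (simp add: matrix_vector_mul_assoc[symmetric] inner_matrix_transpose[of v "transpose X"])
  moreover have "(\<lambda>x. X *v f x) \<in> borel_measurable M"
    using assms by (intro borel_measurable_matrix_vector) (simp add: square_integrable_def)
  ultimately show ?thesis
    using square_integrable_quadratic[OF assms assms, of "transpose X ** X"]
    by (simp add: square_integrable_def)
qed

lemma square_integrable_add:
  assumes "square_integrable M f" "square_integrable M g"
  shows "square_integrable M (\<lambda>x. f x + g x)"
  using assms square_integrable_inner[of M f g] square_integrable_inner[of M g f]
  by (auto simp: square_integrable_def inner_add intro!: borel_measurable_add)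

lemma square_integrable_diff:
  assumes "square_integrable M f" "square_integrable M g"
  shows "square_integrable M (\<lambda>x. f x - g x)"
  using assms square_integrable_inner[of M f g] square_integrable_inner[of M g f]
  by (auto simp: square_integrable_def inner_diff intro!: borel_measurable_diff)

lemma square_integrable_distr:
  assumes g: "g \<in> M \<rightarrow>\<^sub>M L" and f: "f \<in> borel_measurable L"
  shows "square_integrable (distr M L g) f \<longleftrightarrow> square_integrable M (\<lambda>x. f (g x))"
  using f measurable_compose[OF g f]
  by (simp add: square_integrable_def integrable_distr_eq[OF g])

section \<open>The cost of a policy\<close>

lemma stage_cost_complete_square:
  "stage_cost Q S k x v = (1/2) * (x \<bullet> (Qbar Q S k *v x)
     + (v + transpose (S k) *v x) \<bullet> (v + transpose (S k) *v x))"
  by (simp add: stage_cost_def block_matrix_vector inner_block_vec Qbar_def matrix_vector_expand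
      inner_add inner_diff inner_matrix_transpose[of x "S k"] inner_commute algebra_simps)

lemma borel_measurable_stage_cost [measurable (raw)]:
  assumes [measurable]: "f \<in> borel_measurable M" "g \<in> borel_measurable M"
  shows "(\<lambda>x. stage_cost Q S k (f x) (g x)) \<in> borel_measurable M"
  unfolding stage_cost_complete_square by measurable

context density_control
begin

text \<open>The gain for the control \<open>u\<close> itself, as opposed to the gain \<open>F k\<close> for \<open>u + S\<^sup>\<top> x\<close>; the two differ by
  \<open>S\<^sup>\<top>\<close>.\<close>

definition K :: "nat \<Rightarrow> real^'n^'m" where
  "K k = matrix_inv (R k) ** (transpose (B k) ** P (Suc k) ** A k + transpose (S k))"

definition opt_policy :: "('n, 'm) policy" where
  "opt_policy k h v = gaussian_density (- (K k *v fst h k)) (matrix_inv (R k)) v"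

definition log_norm :: "nat \<Rightarrow> real" where
  "log_norm k = (1/2) * ln ((2 * pi) ^ CARD('m) * det (matrix_inv (R k)))"

lemma K_vector:
  assumes "k < N"
  shows "K k *v x = F k *v x + transpose (S k) *v x"
proof -
  note R = R_invertible[OF assms]
  have "R k *v (F k *v x + transpose (S k) *v x)
      = (transpose (B k) ** P (Suc k) ** A k + transpose (S k)) *v x"
    unfolding matrix_vector_right_distrib control_hessian_gain[OF R]
    by (simp add: control_hessian_vector Abar_def matrix_vector_expand)
  then show ?thesis
    unfolding K_def by (metis matrix_inv_vector_mul(2)[OF R] matrix_vector_mul_assoc)
qed

lemma Ab_vector: "A k *v x + B k *v v = Ab k *v x + B k *v (v + transpose (S k) *v x)"
  by (simp add: Abar_def matrix_vector_expand)

lemma closed_loop_dynamics: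
  assumes "k < N"
  shows "A k *v x + B k *v v = T k *v x + B k *v (v + K k *v x)"
  by (simp add: Ab_vector K_vector[OF assms] closed_loop_vector matrix_vector_expand)

text \<open>The residual \<open>v + K k *v x\<close> is the deviation of the control from the mean of the candidate policy.\<close>

lemma stage_cost_riccati:
  fixes x :: "real^'n" and v :: "real^'m"
  assumes k: "k < N"
  defines "x' \<equiv> A k *v x + B k *v v"
  shows "stage_cost Q S k x v = (1/2) * (x \<bullet> (P k *v x)) - (1/2) * (x' \<bullet> (P (Suc k) *v x'))
    + (1/2) * ((v + K k *v x) \<bullet> (R k *v (v + K k *v x)))"
proof -
  define y where "y = v + transpose (S k) *v x"
  have r: "v + K k *v x = y + F k *v x"
    by (simp add: K_vector[OF k] y_def)
  have x': "x' = Ab k *v x + B k *v y"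
    by (simp add: x'_def Ab_vector y_def)
  have "symmetric_matrix (P (Suc k))" using k by (simp add: symmetric_P)
  from riccati_step_complete_square[where B = B and k = k, OF this R_invertible[OF k], of x Q S y A]
  show ?thesis
    unfolding stage_cost_complete_square riccati[OF k] r x' y_def[symmetric] by simp
qed

lemma inv_R_pos_def: "k < N \<Longrightarrow> pos_def (matrix_inv (R k))"
  by (intro pos_def_matrix_inv R_pos_def)

lemma opt_policy_pos: "k < N \<Longrightarrow> 0 < opt_policy k h v"
  unfolding opt_policy_def by (intro gaussian_density_pos inv_R_pos_def)

lemma ln_opt_policy:
  assumes k: "k < N"
  shows "ln (opt_policy k h v)
    = - (1/2) * ((v + K k *v fst h k) \<bullet> (R k *v (v + K k *v fst h k))) - log_norm k"
proof -
  have "matrix_inv (matrix_inv (R k)) = R k"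
    by (intro matrix_inv_eqI matrix_inv_mul R_invertible k)
  then show ?thesis
    unfolding opt_policy_def ln_gaussian_density[OF inv_R_pos_def[OF k]] log_norm_def by simp
qed

end

locale controlled_process = density_control A B Q S N \<Sigma>0 \<Sigma>N P
  for A :: "nat \<Rightarrow> real^'n^'n" and B :: "nat \<Rightarrow> real^'m^'n"
    and Q :: "nat \<Rightarrow> real^'n^'n" and S :: "nat \<Rightarrow> real^'m^'n" and N :: nat
    and \<Sigma>0 \<Sigma>N :: "real^'n^'n" and P :: "nat \<Rightarrow> real^'n^'n" +
  fixes \<pi> :: "('n, 'm) policy"
  assumes policy: "is_policy N \<pi>"
begin

abbreviation "law k \<equiv> hist_law A B \<Sigma>0 \<pi> k"
abbreviation "joint_law k \<equiv> density_kernel.joint (law k) (\<pi> k)"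
abbreviation "state \<equiv> \<lambda>k (h :: ('n, 'm) hist). fst h k"

lemmas prob_space_law = hist_law_prob_space[OF \<Sigma>0_pd policy, THEN conjunct1]
lemmas sets_law' [simp, measurable_cong] = sets_law[OF \<Sigma>0_pd policy]
lemmas density_kernel_law' = density_kernel_law[OF \<Sigma>0_pd policy]
lemmas sets_joint_law' [measurable_cong] = sets_joint_law[OF \<Sigma>0_pd policy]
lemmas distr_past' = distr_past[OF \<Sigma>0_pd policy]
lemmas distr_past_control' = distr_past_control[OF \<Sigma>0_pd policy]

lemma measurable_joint_state [measurable]:
  "k < N \<Longrightarrow> (\<lambda>z. state k (fst z)) \<in> borel_measurable (joint_law k)"
proof -
  assume k: "k < N"
  have "(\<lambda>z::('n, 'm) hist \<times> (real^'m). fst (fst z) k) \<in> borel_measurable (hist_space k \<Otimes>\<^sub>M borel)"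
    by (rule measurable_compose[OF measurable_fst measurable_state]) simp
  then show ?thesis by (simp add: sets_joint_law'[OF k] cong: measurable_cong_sets)
qed

lemma measurable_joint_control [measurable]:
  "k < N \<Longrightarrow> (\<lambda>z. snd z) \<in> borel_measurable (joint_law k)"
  by (simp add: sets_joint_law' cong: measurable_cong_sets)

lemma measurable_law_state [measurable]:
  "k \<le> N \<Longrightarrow> state k \<in> borel_measurable (law k)"
  using measurable_state[of k k] by (simp cong: measurable_cong_sets)

lemma measurable_fst_joint: "k < N \<Longrightarrow> fst \<in> joint_law k \<rightarrow>\<^sub>M law k"
  by (simp add: sets_joint_law' cong: measurable_cong_sets sets_pair_measure_cong)

lemma distr_fst_joint: "k < N \<Longrightarrow> distr (joint_law k) (law k) fst = law k"
  by (rule density_kernel.distr_joint_fst[OF density_kernel_law'])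

lemma distr_joint_Suc_state:
  assumes k: "k < N"
  shows "distr (law (Suc k)) borel (state (Suc k))
    = distr (joint_law k) borel (\<lambda>z. A k *v state k (fst z) + B k *v snd z)"
proof -
  have "distr (law (Suc k)) borel (state (Suc k))
      = distr (joint_law k) borel (\<lambda>z. state (Suc k) (extend_hist A B k z))"
    by (rule distr_law_Suc[OF \<Sigma>0_pd policy k]) measurable
  then show ?thesis by (simp add: extend_hist_def case_prod_unfold)
qed

lemma square_integrable_joint_state:
  assumes k: "k < N"
  shows "square_integrable (joint_law k) (\<lambda>z. state k (fst z)) \<longleftrightarrow> square_integrable (law k) (state k)"
  using k square_integrable_distr[OF measurable_fst_joint[OF k], of "state k"]
  by (simp add: distr_fst_joint)

lemma distr_state_0: "distr (law 0) borel (state 0) = gaussian_measure 0 \<Sigma>0"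
proof -
  have sets: "sets (gaussian_measure 0 \<Sigma>0) = sets borel"
    by (simp add: gaussian_measure_def)
  have m: "(\<lambda>x0. (\<lambda>i\<in>{..0}. x0, \<lambda>i. undefined)) \<in> gaussian_measure 0 \<Sigma>0 \<rightarrow>\<^sub>M (hist_space 0 :: ('n, 'm) hist measure)"
    using measurable_initial_hist measurable_cong_sets[OF sets refl] by blast
  have "distr (law 0) borel (state 0) = distr (gaussian_measure 0 \<Sigma>0) borel (\<lambda>x0. x0)"
    unfolding hist_law.simps(1) distr_distr[OF measurable_state[OF order_refl] m]
    by (simp add: comp_def)
  also have "\<dots> = gaussian_measure 0 \<Sigma>0"
    by (rule distr_id2) (simp add: gaussian_measure_def)
  finally show ?thesis .
qed

lemma square_integrable_state_0: "square_integrable (law 0) (state 0)"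
proof -
  have "integrable (gaussian_measure 0 \<Sigma>0) (\<lambda>x. x \<bullet> x)"
    using gaussian_second_moment[OF \<Sigma>0_pd] gaussian_density_pos[OF \<Sigma>0_pd]
    by (intro integrableI_nonneg)
      (auto simp: gaussian_measure_def nn_integral_density ennreal_mult less_imp_le)
  then have "square_integrable (distr (law 0) borel (state 0)) (\<lambda>x. x)"
    unfolding distr_state_0 by (simp add: square_integrable_def gaussian_measure_def)
  then show ?thesis
    by (subst (asm) square_integrable_distr) auto
qed

lemma square_integrable_Suc:
  assumes k: "k < N" and x: "square_integrable (law k) (state k)"
    and u: "square_integrable (joint_law k) snd"
  shows "square_integrable (law (Suc k)) (state (Suc k))"
proof -
  have "square_integrable (joint_law k) (\<lambda>z. A k *v state k (fst z) + B k *v snd z)"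
    using x u by (intro square_integrable_add square_integrable_matrix)
      (simp_all add: square_integrable_joint_state[OF k])
  then have "square_integrable (distr (joint_law k) borel (\<lambda>z. A k *v state k (fst z) + B k *v snd z)) (\<lambda>x. x)"
    using k by (subst square_integrable_distr) auto
  then have "square_integrable (distr (law (Suc k)) borel (state (Suc k))) (\<lambda>x. x)"
    by (simp only: distr_joint_Suc_state[OF k])
  then show ?thesis
    using k by (subst (asm) square_integrable_distr) auto
qed

text \<open>As \<open>Qbar\<close> is positive semidefinite, the stage cost dominates half of the square of \<open>u + S\<^sup>\<top> x\<close>.\<close>

lemma square_integrable_control:
  assumes k: "k < N" and x: "square_integrable (law k) (state k)"
    and cost: "integrable (joint_law k) (\<lambda>z. stage_cost Q S k (state k (fst z)) (snd z))"
  shows "square_integrable (joint_law k) snd"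
proof -
  note [measurable] = measurable_joint_state[OF k] measurable_joint_control[OF k]
  let ?w = "\<lambda>z. snd z + transpose (S k) *v state k (fst z)"
  have X: "square_integrable (joint_law k) (\<lambda>z. state k (fst z))"
    using x k by (simp add: square_integrable_joint_state)
  have "square_integrable (joint_law k) ?w"
    unfolding square_integrable_def
  proof
    show "integrable (joint_law k) (\<lambda>z. ?w z \<bullet> ?w z)"
    proof (rule Bochner_Integration.integrable_bound)
      show "integrable (joint_law k) (\<lambda>z. 2 * stage_cost Q S k (state k (fst z)) (snd z))"
        using cost by simp
      show "AE z in joint_law k. norm (?w z \<bullet> ?w z) \<le> norm (2 * stage_cost Q S k (state k (fst z)) (snd z))"
        using Qb_psd[OF k] by (intro AE_I2) (simp add: stage_cost_complete_square)
    qed measurable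
  qed measurable
  from square_integrable_diff[OF this square_integrable_matrix[OF X, of "transpose (S k)"]]
  show ?thesis by simp
qed

definition state_energy :: "nat \<Rightarrow> real" where
  "state_energy k = (\<integral>h. state k h \<bullet> (P k *v state k h) \<partial>law k)"

lemma state_energy_distr:
  "k \<le> N \<Longrightarrow> state_energy k = (\<integral>x. x \<bullet> (P k *v x) \<partial>distr (law k) borel (state k))"
  unfolding state_energy_def by (rule integral_distr[symmetric]) auto

text \<open>Half of the form \<open>R k\<close> at the residual is, up to the constant \<open>log_norm k\<close>, minus the logarithm of the
  candidate density; this turns the stage cost minus the entropy into a relative entropy.\<close>

lemma stage_cost_relative_entropy:
  assumes k: "k < N" and x: "square_integrable (law k) (state k)"
    and u: "square_integrable (joint_law k) snd"
  shows "integrable (joint_law k) (\<lambda>(h, v). ln (opt_policy k h v))"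
    and "integrable (joint_law k) (\<lambda>z. stage_cost Q S k (state k (fst z)) (snd z))"
    and "(\<integral>z. stage_cost Q S k (state k (fst z)) (snd z) \<partial>joint_law k) - (\<integral>h. diff_entropy (\<pi> k h) \<partial>law k)
      = (1/2) * state_energy k - (1/2) * state_energy (Suc k)
        + density_kernel.relative_entropy (law k) (\<pi> k) (opt_policy k) - log_norm k"
proof -
  interpret density_kernel "law k" "\<pi> k" by (rule density_kernel_law'[OF k])
  interpret J: prob_space joint by (rule prob_space_joint)
  let ?x = "\<lambda>z. state k (fst z)" and ?x' = "\<lambda>z. A k *v state k (fst z) + B k *v snd z"
    and ?r = "\<lambda>z. snd z + K k *v state k (fst z)"
  have X: "square_integrable joint ?x"
    using x k by (simp add: square_integrable_joint_state)
  have X': "square_integrable joint ?x'" and r: "square_integrable joint ?r"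
    using X u by (intro square_integrable_add square_integrable_matrix; simp)+
  have iX: "integrable joint (\<lambda>z. ?x z \<bullet> (P k *v ?x z))"
    and iX': "integrable joint (\<lambda>z. ?x' z \<bullet> (P (Suc k) *v ?x' z))"
    and ir: "integrable joint (\<lambda>z. ?r z \<bullet> (R k *v ?r z))"
    using X X' r by (auto intro: square_integrable_quadratic)
  have ln: "(\<lambda>(h, v). ln (opt_policy k h v)) = (\<lambda>z. - (1/2) * (?r z \<bullet> (R k *v ?r z)) - log_norm k)"
    by (auto simp: ln_opt_policy[OF k])
  show "integrable joint (\<lambda>(h, v). ln (opt_policy k h v))"
    unfolding ln using ir by simp
  have int_ln: "(\<integral>(h, v). ln (opt_policy k h v) \<partial>joint)
      = - (1/2) * (\<integral>z. ?r z \<bullet> (R k *v ?r z) \<partial>joint) - log_norm k"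
    unfolding ln using ir J.prob_space by (simp del: space_joint)
  have stage: "(\<lambda>z. stage_cost Q S k (?x z) (snd z)) = (\<lambda>z. (1/2) * (?x z \<bullet> (P k *v ?x z))
      - (1/2) * (?x' z \<bullet> (P (Suc k) *v ?x' z)) + (1/2) * (?r z \<bullet> (R k *v ?r z)))"
    by (simp add: stage_cost_riccati[OF k])
  show "integrable joint (\<lambda>z. stage_cost Q S k (?x z) (snd z))"
    unfolding stage using iX iX' ir by simp
  have "(\<integral>z. ?x z \<bullet> (P k *v ?x z) \<partial>joint) = (\<integral>h. state k h \<bullet> (P k *v state k h) \<partial>distr joint (law k) fst)"
    using k by (intro integral_distr[symmetric] measurable_fst_joint) measurable
  then have E: "(\<integral>z. ?x z \<bullet> (P k *v ?x z) \<partial>joint) = state_energy k"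
    by (simp add: state_energy_def distr_fst_joint[OF k])
  have "(\<integral>z. ?x' z \<bullet> (P (Suc k) *v ?x' z) \<partial>joint) = (\<integral>x. x \<bullet> (P (Suc k) *v x) \<partial>distr joint borel ?x')"
    using X' by (intro integral_distr[symmetric]) (auto simp: square_integrable_def)
  then have E': "(\<integral>z. ?x' z \<bullet> (P (Suc k) *v ?x' z) \<partial>joint) = state_energy (Suc k)"
    using k by (simp add: state_energy_distr distr_joint_Suc_state)
  have "(\<integral>z. stage_cost Q S k (?x z) (snd z) \<partial>joint) = (1/2) * state_energy k - (1/2) * state_energy (Suc k)
      + (1/2) * (\<integral>z. ?r z \<bullet> (R k *v ?r z) \<partial>joint)"
    unfolding stage using iX iX' ir by (simp add: E E')
  then show "(\<integral>z. stage_cost Q S k (?x z) (snd z) \<partial>joint) - (\<integral>h. diff_entropy (\<pi> k h) \<partial>law k)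
      = (1/2) * state_energy k - (1/2) * state_energy (Suc k)
        + relative_entropy (opt_policy k) - log_norm k"
    by (simp add: relative_entropy_def int_ln diff_entropy_def)
qed

end

section \<open>Decomposition of the cost\<close>

context controlled_process
begin

lemma measurable_policy: "k < N \<Longrightarrow> (\<lambda>(h, v). \<pi> k h v) \<in> borel_measurable (hist_space k \<Otimes>\<^sub>M borel)"
  using policy by (simp add: is_policy_def)

lemma measurable_entropy_integrand:
  assumes k: "k < N"
  shows "(\<lambda>(h, v). \<pi> k h v * ln (\<pi> k h v)) \<in> borel_measurable (hist_space k \<Otimes>\<^sub>M lborel)"
proof -
  have [measurable]: "(\<lambda>z. \<pi> k (fst z) (snd z)) \<in> borel_measurable (hist_space k \<Otimes>\<^sub>M lborel)"
    using measurable_policy[OF k] by (simp add: case_prod_unfold cong: measurable_cong_sets sets_pair_measure_cong)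
  show ?thesis unfolding case_prod_unfold by measurable
qed

lemma measurable_diff_entropy:
  assumes k: "k < N"
  shows "(\<lambda>h. diff_entropy (\<pi> k h)) \<in> borel_measurable (hist_space k)"
  unfolding diff_entropy_def
  using lborel.borel_measurable_lebesgue_integral[OF measurable_entropy_integrand[OF k]] by simp

lemma measurable_past_law: "k \<le> N \<Longrightarrow> past k \<in> law N \<rightarrow>\<^sub>M hist_space k"
  using measurable_past[of k N] by (simp cong: measurable_cong_sets)

lemma measurable_past_control_law:
  "k < N \<Longrightarrow> (\<lambda>h. (past k h, snd h k)) \<in> law N \<rightarrow>\<^sub>M hist_space k \<Otimes>\<^sub>M borel"
  using measurable_control[of k N] by (intro measurable_Pair measurable_past_law) (simp_all cong: measurable_cong_sets)

lemma measurable_stage_cost: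
  "(\<lambda>z. stage_cost Q S k (state k (fst z)) (snd z)) \<in> borel_measurable (hist_space k \<Otimes>\<^sub>M borel)"
proof -
  have [measurable]: "(\<lambda>z::('n, 'm) hist \<times> (real^'m). fst (fst z) k) \<in> borel_measurable (hist_space k \<Otimes>\<^sub>M borel)"
    by (rule measurable_compose[OF measurable_fst measurable_state]) simp
  show ?thesis by measurable
qed

lemma state_past [simp]: "state k (past k h) = state k h"
  by (simp add: past_def)

lemma stage_cost_law:
  assumes k: "k < N"
  shows "integrable (law N) (\<lambda>h. stage_cost Q S k (fst h k) (snd h k))
      \<longleftrightarrow> integrable (joint_law k) (\<lambda>z. stage_cost Q S k (state k (fst z)) (snd z))"
    and "(\<integral>h. stage_cost Q S k (fst h k) (snd h k) \<partial>law N)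
      = (\<integral>z. stage_cost Q S k (state k (fst z)) (snd z) \<partial>joint_law k)"
  unfolding distr_past_control'[OF k, symmetric]
    integrable_distr_eq[OF measurable_past_control_law[OF k] measurable_stage_cost]
    integral_distr[OF measurable_past_control_law[OF k] measurable_stage_cost]
  by simp_all

lemma entropy_law:
  assumes k: "k < N"
  shows "integrable (law N) (\<lambda>h. diff_entropy (\<pi> k (past k h)))
      \<longleftrightarrow> integrable (law k) (\<lambda>h. diff_entropy (\<pi> k h))"
    and "(\<integral>h. diff_entropy (\<pi> k (past k h)) \<partial>law N) = (\<integral>h. diff_entropy (\<pi> k h) \<partial>law k)"
    and "(AE h in law N. integrable lborel (\<lambda>v. \<pi> k (past k h) v * ln (\<pi> k (past k h) v)))
      \<longleftrightarrow> (AE h in law k. integrable lborel (\<lambda>v. \<pi> k h v * ln (\<pi> k h v)))"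
proof -
  have past: "past k \<in> law N \<rightarrow>\<^sub>M hist_space k" using k by (intro measurable_past_law) simp
  have law_k: "law k = distr (law N) (hist_space k) (past k)"
    using k by (simp add: distr_past')
  show "integrable (law N) (\<lambda>h. diff_entropy (\<pi> k (past k h)))
      \<longleftrightarrow> integrable (law k) (\<lambda>h. diff_entropy (\<pi> k h))"
    unfolding law_k by (rule integrable_distr_eq[OF past measurable_diff_entropy[OF k], symmetric])
  show "(\<integral>h. diff_entropy (\<pi> k (past k h)) \<partial>law N) = (\<integral>h. diff_entropy (\<pi> k h) \<partial>law k)"
    unfolding law_k by (rule integral_distr[OF past measurable_diff_entropy[OF k], symmetric])
  have "Measurable.pred (hist_space k) (\<lambda>h. integrable lborel (\<lambda>v. \<pi> k h v * ln (\<pi> k h v)))"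
    using measurable_entropy_integrand[OF k] by measurable
  then have "{h \<in> space (hist_space k). integrable lborel (\<lambda>v. \<pi> k h v * ln (\<pi> k h v))} \<in> sets (hist_space k)"
    by measurable
  then show "(AE h in law N. integrable lborel (\<lambda>v. \<pi> k (past k h) v * ln (\<pi> k (past k h) v)))
      \<longleftrightarrow> (AE h in law k. integrable lborel (\<lambda>v. \<pi> k h v * ln (\<pi> k h v)))"
    unfolding law_k by (rule AE_distr_iff[OF past, symmetric])
qed

lemma finite_cost_iff:
  "finite_cost A B Q S N \<Sigma>0 \<pi> \<longleftrightarrow> (\<forall>k<N.
     integrable (joint_law k) (\<lambda>z. stage_cost Q S k (state k (fst z)) (snd z)) \<and>
     (AE h in law k. integrable lborel (\<lambda>v. \<pi> k h v * ln (\<pi> k h v))) \<and>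
     integrable (law k) (\<lambda>h. diff_entropy (\<pi> k h)))"
  unfolding finite_cost_def by (simp add: stage_cost_law(1) entropy_law(1,3))

lemma square_integrable_of_finite_cost:
  assumes "finite_cost A B Q S N \<Sigma>0 \<pi>" "k \<le> N"
  shows "square_integrable (law k) (state k)"
  using assms(2)
proof (induction k)
  case 0
  show ?case by (rule square_integrable_state_0)
next
  case (Suc k)
  then show ?case
    using assms(1) by (intro square_integrable_Suc square_integrable_control) (auto simp: finite_cost_iff)
qed

abbreviation "excess k \<equiv> density_kernel.relative_entropy (law k) (\<pi> k) (opt_policy k)"

lemma maxent_cost_decomposition:
  assumes fin: "finite_cost A B Q S N \<Sigma>0 \<pi>"
  shows "maxent_cost A B Q S N \<Sigma>0 \<pi> = ereal ((1/2) * state_energy 0 - (1/2) * state_energy N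
     - (\<Sum>k<N. log_norm k) + (\<Sum>k<N. excess k))"
proof -
  have "(\<integral>h. (\<Sum>k<N. stage_cost Q S k (fst h k) (snd h k) - diff_entropy (\<pi> k (past k h))) \<partial>law N)
      = (\<Sum>k<N. (\<integral>h. stage_cost Q S k (fst h k) (snd h k) \<partial>law N) - (\<integral>h. diff_entropy (\<pi> k (past k h)) \<partial>law N))"
    using fin by (simp add: finite_cost_def Bochner_Integration.integral_sum)
  also have "\<dots> = (\<Sum>k<N. ((1/2) * state_energy k - (1/2) * state_energy (Suc k)) + excess k - log_norm k)"
  proof (rule sum.cong[OF refl])
    fix k assume "k \<in> {..<N}"
    then have k: "k < N" by simp
    have x: "square_integrable (law k) (state k)"
      using square_integrable_of_finite_cost[OF fin] k by simp
    have u: "square_integrable (joint_law k) snd"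
      using fin k by (intro square_integrable_control x) (auto simp: finite_cost_iff)
    show "(\<integral>h. stage_cost Q S k (fst h k) (snd h k) \<partial>law N) - (\<integral>h. diff_entropy (\<pi> k (past k h)) \<partial>law N)
      = ((1/2) * state_energy k - (1/2) * state_energy (Suc k)) + excess k - log_norm k"
      unfolding stage_cost_law(2)[OF k] entropy_law(2)[OF k]
      by (rule stage_cost_relative_entropy(3)[OF k x u])
  qed
  also have "\<dots> = (1/2) * state_energy 0 - (1/2) * state_energy N - (\<Sum>k<N. log_norm k) + (\<Sum>k<N. excess k)"
    unfolding sum.distrib sum_subtractf sum_lessThan_telescope' sum_distrib_left[symmetric]
    using sum_lessThan_telescope'[of state_energy N] by (simp add: sum_subtractf algebra_simps)
  finally show ?thesis
    using fin by (simp add: maxent_cost_def)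
qed

lemma excess_nonneg:
  assumes fin: "finite_cost A B Q S N \<Sigma>0 \<pi>" and k: "k < N"
  shows "0 \<le> excess k"
    and "excess k = 0 \<Longrightarrow> AE h in law k. AE v in lborel. \<pi> k h v = opt_policy k h v"
proof -
  interpret density_kernel "law k" "\<pi> k" by (rule density_kernel_law'[OF k])
  have x: "square_integrable (law k) (state k)"
    using square_integrable_of_finite_cost[OF fin] k by simp
  have u: "square_integrable (joint_law k) snd"
    using fin k by (intro square_integrable_control x) (auto simp: finite_cost_iff)
  have meas: "opt_policy k h \<in> borel_measurable borel" for h
    unfolding opt_policy_def[abs_def] by measurable
  have mass: "(\<integral>\<^sup>+v. ennreal (opt_policy k h v) \<partial>lborel) = 1" for h
    unfolding opt_policy_def by (intro nn_integral_gaussian_density inv_R_pos_def k)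
  have pp: "AE h in law k. integrable lborel (\<lambda>v. \<pi> k h v * ln (\<pi> k h v))"
    using fin k by (auto simp: finite_cost_iff)
  have "integrable (law k) (\<lambda>h. diff_entropy (\<pi> k h))"
    using fin k by (auto simp: finite_cost_iff)
  then have pp': "integrable (law k) (\<lambda>h. \<integral>v. \<pi> k h v * ln (\<pi> k h v) \<partial>lborel)"
    by (simp add: diff_entropy_def)
  note * = relative_entropy_nonneg[OF opt_policy_pos[OF k] meas mass pp pp'
      stage_cost_relative_entropy(1)[OF k x u]]
  show "0 \<le> excess k" by (rule *(1))
  show "AE h in law k. AE v in lborel. \<pi> k h v = opt_policy k h v" if "excess k = 0"
    by (rule *(2)[OF that])
qed

end

section \<open>The optimal policy\<close>

lemma integrable_gaussian_quadratic:
  assumes X: "pos_def (X :: real^'n^'n)"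
  shows "integrable lborel (\<lambda>v. gaussian_density 0 X v * (v \<bullet> (Y *v v)))"
proof -
  have sq: "square_integrable (density lborel (\<lambda>v. ennreal (gaussian_density 0 X v))) (\<lambda>v. v)"
    using gaussian_second_moment[OF X] gaussian_density_pos[OF X]
    by (auto simp: square_integrable_def nn_integral_density ennreal_mult less_imp_le intro!: integrableI_nonneg)
  from square_integrable_quadratic[OF sq sq, of Y] show ?thesis
    using gaussian_density_pos[OF X] by (simp add: integrable_density less_imp_le)
qed

lemma gaussian_entropy_integrable:
  assumes X: "pos_def (X :: real^'n^'n)"
  shows "integrable lborel (\<lambda>v. gaussian_density \<mu> X v * ln (gaussian_density \<mu> X v))"
    and "diff_entropy (gaussian_density \<mu> X) = diff_entropy (gaussian_density 0 X)"
proof -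
  let ?f = "\<lambda>v. gaussian_density \<mu> X v * ln (gaussian_density \<mu> X v)"
  let ?g = "\<lambda>v. gaussian_density 0 X v * ln (gaussian_density 0 X v)"
  have shift: "?f (\<mu> + v) = ?g v" for v by (simp add: gaussian_density_shift)
  have "integrable lborel (gaussian_density 0 X)"
    using gaussian_density_pos[OF X] nn_integral_gaussian_density[OF X, of 0]
    by (intro unit_mass_integral) (auto simp: less_imp_le)
  then have "integrable lborel ?g"
    using integrable_gaussian_quadratic[OF X, of "matrix_inv X"]
    by (simp add: ln_gaussian_density[OF X] algebra_simps)
  then have "integrable lborel (\<lambda>v. ?f (\<mu> + v))" by (simp only: shift)
  then have "integrable (distr lborel borel ((+) \<mu>)) ?f"
    by (subst integrable_distr_eq) auto
  then show "integrable lborel ?f" by (simp only: lborel_distr_plus)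
  have "(\<integral>v. ?f v \<partial>distr lborel borel ((+) \<mu>)) = (\<integral>v. ?f (\<mu> + v) \<partial>lborel)"
    by (rule integral_distr) auto
  then show "diff_entropy (gaussian_density \<mu> X) = diff_entropy (gaussian_density 0 X)"
    by (simp only: lborel_distr_plus shift diff_entropy_def)
qed

context density_control
begin

lemma opt_is_policy: "is_policy N opt_policy"
  unfolding is_policy_def
proof (intro allI impI conjI ballI)
  fix k assume k: "k < N"
  have [measurable]: "(\<lambda>z::('n, 'm) hist \<times> (real^'m). fst (fst z) k) \<in> borel_measurable (hist_space k \<Otimes>\<^sub>M borel)"
    by (rule measurable_compose[OF measurable_fst measurable_state]) simp
  show "(\<lambda>(h, v). opt_policy k h v) \<in> borel_measurable (hist_space k \<Otimes>\<^sub>M borel)"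
    unfolding opt_policy_def case_prod_unfold by measurable
  fix h :: "('n, 'm) hist"
  show "(\<integral>\<^sup>+v. ennreal (opt_policy k h v) \<partial>lborel) = 1"
    unfolding opt_policy_def by (intro nn_integral_gaussian_density inv_R_pos_def k)
  show "0 \<le> opt_policy k h v" for v
    by (rule less_imp_le[OF opt_policy_pos[OF k]])
qed

sublocale opt: controlled_process A B Q S N \<Sigma>0 \<Sigma>N P opt_policy
  by unfold_locales (rule opt_is_policy)

text \<open>Under the candidate policy, \<open>v + K k *v x\<close> is a centred Gaussian independent of the history.\<close>

lemma nn_integral_opt_joint:
  fixes f :: "(real^'n) \<times> (real^'m) \<Rightarrow> ennreal"
  assumes k: "k < N" and f: "f \<in> borel_measurable (borel \<Otimes>\<^sub>M borel)"
  shows "(\<integral>\<^sup>+z. f (opt.state k (fst z), snd z + K k *v opt.state k (fst z)) \<partial>opt.joint_law k)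
    = (\<integral>\<^sup>+x. \<integral>\<^sup>+w. ennreal (gaussian_density 0 (matrix_inv (R k)) w) * f (x, w) \<partial>lborel
        \<partial>distr (opt.law k) borel (opt.state k))"
proof -
  interpret density_kernel "opt.law k" "opt_policy k" by (rule opt.density_kernel_law'[OF k])
  have st[measurable]: "opt.state k \<in> borel_measurable (opt.law k)"
    using k by (intro opt.measurable_law_state) simp
  note f[measurable]
  have "(\<integral>\<^sup>+z. f (opt.state k (fst z), snd z + K k *v opt.state k (fst z)) \<partial>joint)
      = (\<integral>\<^sup>+h. \<integral>\<^sup>+v. ennreal (opt_policy k h v) * f (opt.state k h, v + K k *v opt.state k h) \<partial>lborel \<partial>opt.law k)"
    by (subst nn_integral_joint) simp_all
  also have "\<dots> = (\<integral>\<^sup>+h. \<integral>\<^sup>+w. ennreal (gaussian_density 0 (matrix_inv (R k)) w) * f (opt.state k h, w) \<partial>lborel \<partial>opt.law k)"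
  proof (rule nn_integral_cong)
    fix h :: "('n, 'm) hist"
    show "(\<integral>\<^sup>+v. ennreal (opt_policy k h v) * f (opt.state k h, v + K k *v opt.state k h) \<partial>lborel)
      = (\<integral>\<^sup>+w. ennreal (gaussian_density 0 (matrix_inv (R k)) w) * f (opt.state k h, w) \<partial>lborel)"
      using nn_integral_lborel_translate[of "\<lambda>v. ennreal (opt_policy k h v) * f (opt.state k h, v + K k *v opt.state k h)"
          "- (K k *v opt.state k h)"]
      unfolding opt_policy_def gaussian_density_shift by simp
  qed
  also have "\<dots> = (\<integral>\<^sup>+x. \<integral>\<^sup>+w. ennreal (gaussian_density 0 (matrix_inv (R k)) w) * f (x, w) \<partial>lborel
        \<partial>distr (opt.law k) borel (opt.state k))"
    by (rule nn_integral_distr[symmetric]) measurable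
  finally show ?thesis .
qed

lemma opt_state_law: "k \<le> N \<Longrightarrow> distr (opt.law k) borel (opt.state k) = gaussian_measure 0 (closed_loop_cov k)"
proof (induction k)
  case 0
  then show ?case by (simp add: opt.distr_state_0)
next
  case (Suc k)
  then have k: "k < N" by simp
  note [measurable] = opt.measurable_joint_state[OF k] opt.measurable_joint_control[OF k]
  let ?x' = "\<lambda>z. A k *v opt.state k (fst z) + B k *v snd z"
  have "distr (opt.law (Suc k)) borel (opt.state (Suc k)) = distr (opt.joint_law k) borel ?x'"
    by (rule opt.distr_joint_Suc_state[OF k])
  also have "\<dots> = gaussian_measure 0 (closed_loop_cov (Suc k))"
  proof (rule measure_eqI)
    fix X assume "X \<in> sets (distr (opt.joint_law k) borel ?x')"
    then have [measurable]: "X \<in> sets borel" by simp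
    define f where "f = (\<lambda>(x, w). indicator X (T k *v x + B k *v w) :: ennreal)"
    have f[measurable]: "f \<in> borel_measurable (borel \<Otimes>\<^sub>M borel)"
      unfolding f_def case_prod_unfold by measurable
    have "emeasure (distr (opt.joint_law k) borel ?x') X = (\<integral>\<^sup>+x. indicator X x \<partial>distr (opt.joint_law k) borel ?x')"
      by simp
    also have "\<dots> = (\<integral>\<^sup>+z. indicator X (?x' z) \<partial>opt.joint_law k)"
      by (rule nn_integral_distr) measurable
    also have "\<dots> = (\<integral>\<^sup>+z. f (opt.state k (fst z), snd z + K k *v opt.state k (fst z)) \<partial>opt.joint_law k)"
      by (simp add: f_def closed_loop_dynamics[OF k])
    also have "\<dots> = (\<integral>\<^sup>+x. \<integral>\<^sup>+w. ennreal (gaussian_density 0 (matrix_inv (R k)) w) * f (x, w) \<partial>lborel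
        \<partial>gaussian_measure 0 (closed_loop_cov k))"
      unfolding nn_integral_opt_joint[OF k f] using Suc by simp
    also have "\<dots> = (\<integral>\<^sup>+x. \<integral>\<^sup>+w. ennreal (gaussian_density 0 (closed_loop_cov k) x)
        * (ennreal (gaussian_density 0 (matrix_inv (R k)) w) * indicator X (T k *v x + B k *v w)) \<partial>lborel \<partial>lborel)"
      unfolding gaussian_measure_def by (subst nn_integral_density) (simp_all add: f_def nn_integral_cmult)
    also have "\<dots> = (\<integral>\<^sup>+z. ennreal (gaussian_density 0 (closed_loop_cov (Suc k)) z) * indicator X z \<partial>lborel)"
      using k Suc.prems by (intro gaussian_affine_kernel closed_loop_cov_pos_def inv_R_pos_def T_invertible) auto
    also have "\<dots> = emeasure (gaussian_measure 0 (closed_loop_cov (Suc k))) X"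
      by (simp add: gaussian_measure_def emeasure_density)
    finally show "emeasure (distr (opt.joint_law k) borel ?x') X
      = emeasure (gaussian_measure 0 (closed_loop_cov (Suc k))) X" .
  qed (simp add: gaussian_measure_def)
  finally show ?case .
qed

lemma opt_feasible: "feasible A B N \<Sigma>0 \<Sigma>N opt_policy"
  using opt_state_law[of N] by (simp add: feasible_def opt_is_policy closed_loop_cov_final)

lemma opt_square_integrable:
  assumes k: "k < N" and x: "square_integrable (opt.law k) (opt.state k)"
  shows "square_integrable (opt.joint_law k) snd"
proof -
  note [measurable] = opt.measurable_joint_state[OF k] opt.measurable_joint_control[OF k]
  interpret law: prob_space "opt.law k" using k by (intro opt.prob_space_law) simp
  let ?r = "\<lambda>z. snd z + K k *v opt.state k (fst z)" and ?V = "matrix_inv (R k)"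
  have X: "square_integrable (opt.joint_law k) (\<lambda>z. opt.state k (fst z))"
    using x k by (simp add: opt.square_integrable_joint_state)
  have "(\<integral>\<^sup>+z. ennreal (?r z \<bullet> ?r z) \<partial>opt.joint_law k)
      = (\<integral>\<^sup>+x. (\<integral>\<^sup>+w. ennreal (gaussian_density 0 ?V w) * ennreal (w \<bullet> w) \<partial>lborel) \<partial>distr (opt.law k) borel (opt.state k))"
    using nn_integral_opt_joint[OF k, of "\<lambda>(x, w). ennreal (w \<bullet> w)"] by (simp add: case_prod_unfold)
  also have "\<dots> = (\<integral>\<^sup>+w. ennreal (gaussian_density 0 ?V w * (w \<bullet> w)) \<partial>lborel)"
  proof -
    have "emeasure (distr (opt.law k) borel (opt.state k)) UNIV = 1"
      using k prob_space.emeasure_space_1[OF law.prob_space_distr[of "opt.state k" borel]] by simp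
    then show ?thesis
      using gaussian_density_pos[OF inv_R_pos_def[OF k]] by (simp add: ennreal_mult less_imp_le)
  qed
  also have "\<dots> < \<infinity>" by (rule gaussian_second_moment[OF inv_R_pos_def[OF k]])
  finally have "square_integrable (opt.joint_law k) ?r"
    by (auto simp: square_integrable_def intro!: integrableI_nonneg)
  from square_integrable_diff[OF this square_integrable_matrix[OF X, of "K k"]]
  show ?thesis by simp
qed

lemma opt_state_square_integrable: "k \<le> N \<Longrightarrow> square_integrable (opt.law k) (opt.state k)"
proof (induction k)
  case 0
  show ?case by (rule opt.square_integrable_state_0)
next
  case (Suc k)
  then show ?case by (intro opt.square_integrable_Suc opt_square_integrable) auto
qed

lemma opt_finite_cost: "finite_cost A B Q S N \<Sigma>0 opt_policy"
  unfolding opt.finite_cost_iff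
proof (intro allI impI conjI)
  fix k assume k: "k < N"
  interpret law: prob_space "opt.law k" using k by (intro opt.prob_space_law) simp
  note V = inv_R_pos_def[OF k]
  have x: "square_integrable (opt.law k) (opt.state k)"
    using k by (intro opt_state_square_integrable) simp
  show "integrable (opt.joint_law k) (\<lambda>z. stage_cost Q S k (opt.state k (fst z)) (snd z))"
    by (rule opt.stage_cost_relative_entropy(2)[OF k x opt_square_integrable[OF k x]])
  show "AE h in opt.law k. integrable lborel (\<lambda>v. opt_policy k h v * ln (opt_policy k h v))"
    unfolding opt_policy_def by (intro AE_I2 gaussian_entropy_integrable V)
  have "diff_entropy (opt_policy k h) = diff_entropy (gaussian_density 0 (matrix_inv (R k)))" for h
    unfolding opt_policy_def[abs_def] by (rule gaussian_entropy_integrable(2)[OF V])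
  then show "integrable (opt.law k) (\<lambda>h. diff_entropy (opt_policy k h))"
    by simp
qed

lemma opt_excess: "k < N \<Longrightarrow> opt.excess k = 0"
proof -
  assume k: "k < N"
  interpret density_kernel "opt.law k" "opt_policy k" by (rule opt.density_kernel_law'[OF k])
  have x: "square_integrable (opt.law k) (opt.state k)"
    using k by (intro opt_state_square_integrable) simp
  show ?thesis
    unfolding relative_entropy_def
    using integrable_joint(3)[OF opt.stage_cost_relative_entropy(1)[OF k x opt_square_integrable[OF k x]]]
    by (simp add: case_prod_unfold)
qed

definition opt_cost :: real where
  "opt_cost = (1/2) * (\<integral>x. x \<bullet> (P 0 *v x) \<partial>gaussian_measure 0 \<Sigma>0)
     - (1/2) * (\<integral>x. x \<bullet> (P N *v x) \<partial>gaussian_measure 0 \<Sigma>N) - (\<Sum>k<N. log_norm k)"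

text \<open>The laws of the initial and of the final state are prescribed. Hence the costs of two feasible
  policies differ only in their relative entropies.\<close>

lemma feasible_cost:
  assumes feas: "feasible A B N \<Sigma>0 \<Sigma>N \<pi>" and fin: "finite_cost A B Q S N \<Sigma>0 \<pi>"
  shows "maxent_cost A B Q S N \<Sigma>0 \<pi>
    = ereal (opt_cost + (\<Sum>k<N. density_kernel.relative_entropy (hist_law A B \<Sigma>0 \<pi> k) (\<pi> k) (opt_policy k)))"
proof -
  interpret c: controlled_process A B Q S N \<Sigma>0 \<Sigma>N P \<pi>
    using feas by unfold_locales (simp add: feasible_def)
  have "c.state_energy 0 = (\<integral>x. x \<bullet> (P 0 *v x) \<partial>gaussian_measure 0 \<Sigma>0)"
    by (simp add: c.state_energy_distr c.distr_state_0)
  moreover have "c.state_energy N = (\<integral>x. x \<bullet> (P N *v x) \<partial>gaussian_measure 0 \<Sigma>N)"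
    using feas by (simp add: c.state_energy_distr feasible_def)
  ultimately show ?thesis
    unfolding c.maxent_cost_decomposition[OF fin] opt_cost_def by simp
qed

theorem opt_policy_unique_optimal: "unique_optimal A B Q S N \<Sigma>0 \<Sigma>N opt_policy"
proof -
  have opt_cost: "maxent_cost A B Q S N \<Sigma>0 opt_policy = ereal opt_cost"
    unfolding feasible_cost[OF opt_feasible opt_finite_cost] by (simp add: opt_excess)
  have le: "ereal opt_cost \<le> maxent_cost A B Q S N \<Sigma>0 \<pi>" if feas: "feasible A B N \<Sigma>0 \<Sigma>N \<pi>" for \<pi> :: "('n, 'm) policy"
  proof (cases "finite_cost A B Q S N \<Sigma>0 \<pi>")
    case True
    interpret c: controlled_process A B Q S N \<Sigma>0 \<Sigma>N P \<pi>
      using feas by unfold_locales (simp add: feasible_def)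
    have "0 \<le> (\<Sum>k<N. c.excess k)"
      by (intro sum_nonneg c.excess_nonneg(1)[OF True]) simp
    then show ?thesis by (simp add: feasible_cost[OF feas True])
  qed (simp add: maxent_cost_def)
  have "AE h in hist_law A B \<Sigma>0 \<pi> k. AE v in lborel. \<pi> k h v = opt_policy k h v"
    if opt: "optimal A B Q S N \<Sigma>0 \<Sigma>N \<pi>" and k: "k < N" for \<pi> :: "('n, 'm) policy" and k
  proof -
    have feas: "feasible A B N \<Sigma>0 \<Sigma>N \<pi>" and "maxent_cost A B Q S N \<Sigma>0 \<pi> \<le> ereal opt_cost"
      using opt opt_feasible opt_cost unfolding optimal_def by metis+
    then have fin: "finite_cost A B Q S N \<Sigma>0 \<pi>"
      unfolding maxent_cost_def by (auto split: if_splits)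
    interpret c: controlled_process A B Q S N \<Sigma>0 \<Sigma>N P \<pi>
      using feas by unfold_locales (simp add: feasible_def)
    note nonneg = c.excess_nonneg(1)[OF fin]
    have "(\<Sum>k<N. c.excess k) \<le> 0"
      using \<open>maxent_cost A B Q S N \<Sigma>0 \<pi> \<le> ereal opt_cost\<close> by (simp add: feasible_cost[OF feas fin])
    then have "(\<Sum>k<N. c.excess k) = 0"
      using nonneg by (intro antisym sum_nonneg) auto
    then have "c.excess k = 0"
      using nonneg k by (subst (asm) sum_nonneg_eq_0_iff) auto
    then show ?thesis by (rule c.excess_nonneg(2)[OF fin k])
  qed
  then show ?thesis
    using le opt_feasible by (simp add: unique_optimal_def optimal_def opt_cost)
qed

end

theorem theorem1:
  fixes A :: "nat \<Rightarrow> real^'n^'n" and B :: "nat \<Rightarrow> real^'m^'n"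
    and Q :: "nat \<Rightarrow> real^'n^'n" and S :: "nat \<Rightarrow> real^'m^'n"
    and N :: nat and \<Sigma>0 \<Sigma>N :: "real^'n^'n" and P :: "nat \<Rightarrow> real^'n^'n"
  assumes N_pos: "N \<ge> 1"
    and Q_sym: "\<And>k. k < N \<Longrightarrow> symmetric_matrix (Q k)"
    and Qbar_psd: "\<And>k. k < N \<Longrightarrow> pos_semidef (Qbar Q S k)"
    and \<Sigma>0_pd: "pos_def \<Sigma>0" and \<Sigma>N_pd: "pos_def \<Sigma>N"
    and A1: "\<And>k. k < N \<Longrightarrow> invertible (Abar A B S k)"
    and A2: "\<exists>kr \<in> {1..N}. (\<forall>k \<in> {kr..N}. invertible (reach_gramian A B S k 0)) \<and>
                           (\<forall>k \<in> {0..kr}. invertible (reach_gramian A B S N k))"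
    and riccati: "\<And>k. k < N \<Longrightarrow> P k = riccati_step A B Q S k (P (k + 1))"
    and terminal: "P N = riccati_terminal A B Q S N \<Sigma>0 \<Sigma>N"
  shows "unique_optimal A B Q S N \<Sigma>0 \<Sigma>N
    (\<lambda>k h v. gaussian_density
       (- (matrix_inv (mat 1 + transpose (B k) ** P (k + 1) ** B k)
            ** (transpose (B k) ** P (k + 1) ** A k + transpose (S k)) *v fst h k))
       (matrix_inv (mat 1 + transpose (B k) ** P (k + 1) ** B k)) v)"
proof -
  have "invertible (reach_gramian A B S N 0)"
    using A2 by auto
  then interpret density_control A B Q S N \<Sigma>0 \<Sigma>N P
    using Qbar_psd A1 \<Sigma>0_pd \<Sigma>N_pd riccati terminal by unfold_locales auto
  have "opt_policy = (\<lambda>k h v. gaussian_density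
       (- (matrix_inv (mat 1 + transpose (B k) ** P (k + 1) ** B k)
            ** (transpose (B k) ** P (k + 1) ** A k + transpose (S k)) *v fst h k))
       (matrix_inv (mat 1 + transpose (B k) ** P (k + 1) ** B k)) v)"
    by (simp add: opt_policy_def[abs_def] K_def control_hessian_def)
  with opt_policy_unique_optimal show ?thesis by simp
qed

end
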